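(* Let $A=kQ/I$ be a finite-dimensional algebra and let $\{0\}=\mathcal{T}_0\subsetneq\mathcal{T}_1\subsetneq\cdots\subsetneq\mathcal{T}_r=\operatorname{mod}A$ be a maximal green sequence in $\operatorname{mod}A$. Then there exists a $\mathfrak{D}$-generic path $\gamma:[0,1]\to\mathbb{R}^n$ such that: 1. $\gamma$ crosses exactly $r$ walls, at parameters $t_1<t_2<\dots<t_r$ (i.e. these are exactly the parameters $t\in[0,1]$ for which $\gamma(t)$ lies in the stability space of some nonzero module); 2. every wall crossing of $\gamma$ is green; 3. for every $t\in[0,1]$, the torsion class $\mathcal{T}_{\gamma(t)}$ associated to $\gamma(t)$ coincides with some torsion class $\mathcal{T}_k$ in the maximal green sequence; 4. $\mathcal{T}_{\gamma(t')}\subseteq\mathcal{T}_{\gamma(t'')}$ whenever $t'<t''$.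
   Context: $A=kQ/I$ is a finite-dimensional algebra over a field $k$, with $Q$ a finite quiver with $n$ vertices and $I$ admissible; $\operatorname{mod}A$ is the category of finitely generated modules, $[N]\in\mathbb{Z}^n$ the dimension vector of $N$, and $\langle\cdot,\cdot\rangle$ the standard inner product on $\mathbb{R}^n$. A maximal green sequence in $\operatorname{mod}A$ is a finite chain of torsion classes $\{0\}=\mathcal{T}_0\subsetneq\mathcal{T}_1\subsetneq\dots\subsetneq\mathcal{T}_r=\operatorname{mod}A$ such that for every $i\in\{0,\dots,r-1\}$, any torsion class $\mathcal{T}$ with $\mathcal{T}_i\subseteq\mathcal{T}\subseteq\mathcal{T}_{i+1}$ satisfies $\mathcal{T}=\mathcal{T}_i$ or $\mathcal{T}=\mathcal{T}_{i+1}$. For a nonzero module $N$, the stability space is $\mathfrak{D}(N)=\{\theta\in\mathbb{R}^n:\langle\theta,[N]\rangle=0\text{ and }\langle\theta,[L]\rangle\le 0\text{ for every submodule }L\subseteq N\}$; it is a wall if it has codimension one. A smooth path $\gamma:[0,1]\to\mathbb{R}^n$ is $\mathfrak{D}$-generic if: (1) $\gamma(0)$ and $\gamma(1)$ do not belong to $\mathfrak{D}(N)$ for any nonzero $N$, that is, they are located inside some chambers (a chamber being a connected component of $\mathbb{R}^n\setminus\overline{\bigcup_{0\neq N}\mathfrak{D}(N)}$); (2) if $\gamma(t)\in\mathfrak{D}(N)\cap\mathfrak{D}(N')$ for two walls, then $[N]$ is a scalar multiple of $[N']$; (3) whenever $\gamma(t)\in\mathfrak{D}(N)$ (with $N\ne0$),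 $\langle\gamma'(t),[N]\rangle\ne 0$. A crossing at $t$ with $\gamma(t)\in\mathfrak{D}(N)$ is green if $\langle\gamma'(t),[N]\rangle>0$. For $\theta\in\mathbb{R}^n$, the associated torsion class is $\mathcal{T}_\theta=\{X\in\operatorname{mod}A:\langle\theta,[Y]\rangle\ge 0\text{ for every quotient }Y\text{ of }X\}$. *)

theory Defs
  imports
    "HOL-Analysis.Analysis"
    "HOL-Algebra.QuotRing"
    "HOL-Algebra.Ideal_Product"
    "Graph_Theory.Graph_Theory"
    "Jordan_Normal_Form.Missing_VectorSpace"
begin

section \<open>Bound quiver algebras\<close>

text \<open>
  A finite quiver is a \<^locale>\<open>fin_digraph\<close>, in which loops and parallel arrows are allowed. Its
  \<open>n\<close> vertices are all elements of a finite type, so that \<open>real ^ 'v\<close> is the space of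
  stability vectors.

  A path is a pair of its source and the list of its arrows in the order of traversal; \<open>(u, [])\<close> is
  the trivial path at \<open>u\<close>. An element of the path algebra is a finitely supported function on
  paths. Products of paths are written like compositions of maps: \<open>f \<otimes> g\<close> means first \<open>g\<close>, then \<open>f\<close>,
  so that left modules are the representations of the quiver. The opposite convention amounts to
  replacing the quiver by its opposite.
\<close>

type_synonym ('v, 'a) qpath = "'v \<times> 'a list"

definition path_end :: "('v, 'a) pre_digraph \<Rightarrow> ('v, 'a) qpath \<Rightarrow> 'v" where
  "path_end Q = (\<lambda>(u, p). last (pre_digraph.awalk_verts Q u p))"

definition qpaths :: "('v, 'a) pre_digraph \<Rightarrow> ('v, 'a) qpath set" where
  "qpaths Q = {(u, p). pre_digraph.awalk Q u p (path_end Q (u, p))}"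

definition pa_scalar :: "('v, 'a) pre_digraph \<Rightarrow> 'k::field \<Rightarrow> ('v, 'a) qpath \<Rightarrow> 'k" where
  "pa_scalar Q c = (\<lambda>(u, p). if u \<in> verts Q \<and> p = [] then c else 0)"

definition pa_path :: "('v, 'a) qpath \<Rightarrow> ('v, 'a) qpath \<Rightarrow> 'k::field" where
  "pa_path q = (\<lambda>p. if p = q then 1 else 0)"

definition path_algebra :: "('v, 'a) pre_digraph \<Rightarrow> (('v, 'a) qpath \<Rightarrow> 'k::field) ring" where
  "path_algebra Q =
    \<lparr>carrier = {f. finite {p. f p \<noteq> 0} \<and> {p. f p \<noteq> 0} \<subseteq> qpaths Q},
     mult = (\<lambda>f g. \<lambda>(u, p).
       \<Sum>i\<le>length p. f (path_end Q (u, take i p), drop i p) * g (u, take i p)),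
     one = pa_scalar Q 1,
     zero = (\<lambda>_. 0),
     add = (\<lambda>f g p. f p + g p)\<rparr>"

definition arrow_ideal :: "('v, 'a) pre_digraph \<Rightarrow> (('v, 'a) qpath \<Rightarrow> 'k::field) set" where
  "arrow_ideal Q = genideal (path_algebra Q) ((\<lambda>a. pa_path (tail Q a, [a])) ` arcs Q)"

primrec arrow_ideal_power ::
    "('v, 'a) pre_digraph \<Rightarrow> nat \<Rightarrow> (('v, 'a) qpath \<Rightarrow> 'k::field) set" where
  "arrow_ideal_power Q 0 = carrier (path_algebra Q)"
| "arrow_ideal_power Q (Suc m) =
    ideal_prod (path_algebra Q) (arrow_ideal_power Q m) (arrow_ideal Q)"

definition admissible_ideal ::
    "('v, 'a) pre_digraph \<Rightarrow> (('v, 'a) qpath \<Rightarrow> 'k::field) set \<Rightarrow> bool" where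
  "admissible_ideal Q I \<longleftrightarrow> ideal I (path_algebra Q) \<and>
    I \<subseteq> arrow_ideal_power Q 2 \<and> (\<exists>m\<ge>2. arrow_ideal_power Q m \<subseteq> I)"

definition bound_quiver ::
    "('v::finite, 'a) pre_digraph \<Rightarrow> (('v, 'a) qpath \<Rightarrow> 'k::field) set \<Rightarrow> bool" where
  "bound_quiver Q I \<longleftrightarrow> fin_digraph Q \<and> verts Q = UNIV \<and> admissible_ideal Q I"

type_synonym ('v, 'a, 'k) bqa = "(('v, 'a) qpath \<Rightarrow> 'k) set"

abbreviation bq_algebra ::
    "('v, 'a) pre_digraph \<Rightarrow> (('v, 'a) qpath \<Rightarrow> 'k::field) set \<Rightarrow> ('v, 'a, 'k) bqa ring" where
  "bq_algebra Q I \<equiv> path_algebra Q Quot I"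


section \<open>Modules over a not necessarily commutative ring\<close>

text \<open>
  The locale \<^locale>\<open>Module.module\<close> presupposes a commutative ring. The record fields \<^const>\<open>mult\<close> and
  \<^const>\<open>one\<close> of a module carry no information.
\<close>

locale left_module = R?: ring R + M?: abelian_group M
  for R :: "('r, 'x) ring_scheme" (structure) and M :: "('r, 'm, 'y) module_scheme" (structure) +
  assumes lsmult_closed: "\<lbrakk>a \<in> carrier R; x \<in> carrier M\<rbrakk> \<Longrightarrow> a \<odot>\<^bsub>M\<^esub> x \<in> carrier M"
    and lsmult_l_distr: "\<lbrakk>a \<in> carrier R; b \<in> carrier R; x \<in> carrier M\<rbrakk> \<Longrightarrow>
      (a \<oplus>\<^bsub>R\<^esub> b) \<odot>\<^bsub>M\<^esub> x = a \<odot>\<^bsub>M\<^esub> x \<oplus>\<^bsub>M\<^esub> b \<odot>\<^bsub>M\<^esub> x"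
    and lsmult_r_distr: "\<lbrakk>a \<in> carrier R; x \<in> carrier M; y \<in> carrier M\<rbrakk> \<Longrightarrow>
      a \<odot>\<^bsub>M\<^esub> (x \<oplus>\<^bsub>M\<^esub> y) = a \<odot>\<^bsub>M\<^esub> x \<oplus>\<^bsub>M\<^esub> a \<odot>\<^bsub>M\<^esub> y"
    and lsmult_assoc: "\<lbrakk>a \<in> carrier R; b \<in> carrier R; x \<in> carrier M\<rbrakk> \<Longrightarrow>
      (a \<otimes>\<^bsub>R\<^esub> b) \<odot>\<^bsub>M\<^esub> x = a \<odot>\<^bsub>M\<^esub> (b \<odot>\<^bsub>M\<^esub> x)"
    and lsmult_one: "x \<in> carrier M \<Longrightarrow> \<one>\<^bsub>R\<^esub> \<odot>\<^bsub>M\<^esub> x = x"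

definition left_submodule :: "'r ring \<Rightarrow> 'm set \<Rightarrow> ('r, 'm) module \<Rightarrow> bool" where
  "left_submodule R L M \<longleftrightarrow> L \<subseteq> carrier M \<and> left_module R (M\<lparr>carrier := L\<rparr>)"

definition fin_gen :: "'r ring \<Rightarrow> ('r, 'm) module \<Rightarrow> bool" where
  "fin_gen R M \<longleftrightarrow> (\<exists>S. finite S \<and> S \<subseteq> carrier M \<and>
    (\<forall>L. left_submodule R L M \<and> S \<subseteq> L \<longrightarrow> L = carrier M))"

definition fg_modules :: "'r ring \<Rightarrow> ('r, 'm) module set" where
  "fg_modules R = {M. left_module R M \<and> fin_gen R M}"

definition is_quotient :: "'r ring \<Rightarrow> ('r, 'm) module \<Rightarrow> ('r, 'm) module \<Rightarrow> bool" where
  "is_quotient R X Y \<longleftrightarrow>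
    (\<exists>f \<in> LinearCombinations.module_hom R X Y. f ` carrier X = carrier Y)"

definition short_exact ::
    "'r ring \<Rightarrow> ('r, 'm) module \<Rightarrow> ('r, 'm) module \<Rightarrow> ('r, 'm) module \<Rightarrow> bool" where
  "short_exact R X Y Z \<longleftrightarrow>
    (\<exists>f \<in> LinearCombinations.module_hom R X Y. \<exists>g \<in> LinearCombinations.module_hom R Y Z.
      inj_on f (carrier X) \<and> g ` carrier Y = carrier Z \<and>
      f ` carrier X = {y \<in> carrier Y. g y = \<zero>\<^bsub>Z\<^esub>})"

definition torsion_class :: "'r ring \<Rightarrow> ('r, 'm) module set \<Rightarrow> bool" where
  "torsion_class R T \<longleftrightarrow> T \<subseteq> fg_modules R \<and> T \<noteq> {} \<and>
    (\<forall>X \<in> T. \<forall>Y \<in> fg_modules R. is_quotient R X Y \<longrightarrow> Y \<in> T) \<and>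
    (\<forall>X \<in> T. \<forall>Z \<in> T. \<forall>Y \<in> fg_modules R. short_exact R X Y Z \<longrightarrow> Y \<in> T)"

definition maximal_green_sequence ::
    "'r ring \<Rightarrow> (nat \<Rightarrow> ('r, 'm) module set) \<Rightarrow> nat \<Rightarrow> bool" where
  "maximal_green_sequence R T r \<longleftrightarrow>
    (\<forall>i\<le>r. torsion_class R (T i)) \<and>
    T 0 = {M \<in> fg_modules R. carrier M = {\<zero>\<^bsub>M\<^esub>}} \<and> T r = fg_modules R \<and>
    (\<forall>i<r. T i \<subset> T (Suc i)) \<and>
    (\<forall>i<r. \<forall>U. torsion_class R U \<and> T i \<subseteq> U \<and> U \<subseteq> T (Suc i) \<longrightarrow> U = T i \<or> U = T (Suc i))"


section \<open>Stability spaces\<close>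

text \<open>
  Finitely generated modules over a bound quiver algebra over \<open>'k\<close> are finite-dimensional
  vector spaces, so up to isomorphism their underlying sets are subsets of \<open>nat \<Rightarrow> 'k\<close>. As torsion
  classes are closed under isomorphism, it suffices to consider modules on such sets; all
  such modules are admitted, with arbitrary operations, and not only subspaces of \<open>nat \<Rightarrow> 'k\<close>.
\<close>

type_synonym ('v, 'a, 'k) bq_module = "(('v, 'a, 'k) bqa, nat \<Rightarrow> 'k) module"

definition bq_mod ::
    "('v, 'a) pre_digraph \<Rightarrow> (('v, 'a) qpath \<Rightarrow> 'k::field) set \<Rightarrow> ('v, 'a, 'k) bq_module set" where
  "bq_mod Q I = fg_modules (bq_algebra Q I)"

definition bq_mod_nonzero ::
    "('v, 'a) pre_digraph \<Rightarrow> (('v, 'a) qpath \<Rightarrow> 'k::field) set \<Rightarrow> ('v, 'a, 'k) bq_module set" where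
  "bq_mod_nonzero Q I = {M \<in> bq_mod Q I. carrier M \<noteq> {\<zero>\<^bsub>M\<^esub>}}"

abbreviation field_ring :: "'k::field ring" where
  "field_ring \<equiv> \<lparr>carrier = UNIV, mult = (*), one = 1, zero = 0, add = (+)\<rparr>"

text \<open>The vector space \<open>e\<^sub>i M\<close> over \<open>'k\<close>, where \<open>e\<^sub>i\<close> is the idempotent of the vertex \<open>i\<close> in the bound quiver algebra.\<close>

definition vertex_space :: "('v, 'a) pre_digraph \<Rightarrow> (('v, 'a) qpath \<Rightarrow> 'k::field) set \<Rightarrow>
    ('v, 'a, 'k) bq_module \<Rightarrow> 'v \<Rightarrow> ('k, nat \<Rightarrow> 'k) module" where
  "vertex_space Q I M i =
    \<lparr>carrier = (\<lambda>x. (I +>\<^bsub>path_algebra Q\<^esub> pa_path (i, [])) \<odot>\<^bsub>M\<^esub> x) ` carrier M,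
     mult = mult M, one = one M, zero = zero M, add = add M,
     smult = (\<lambda>c x. (I +>\<^bsub>path_algebra Q\<^esub> pa_scalar Q c) \<odot>\<^bsub>M\<^esub> x)\<rparr>"

definition dimension_vector :: "('v::finite, 'a) pre_digraph \<Rightarrow> (('v, 'a) qpath \<Rightarrow> 'k::field) set \<Rightarrow>
    ('v, 'a, 'k) bq_module \<Rightarrow> real ^ 'v" where
  "dimension_vector Q I M = (\<chi> i. real (vectorspace.dim field_ring (vertex_space Q I M i)))"

definition stability_space :: "('v::finite, 'a) pre_digraph \<Rightarrow> (('v, 'a) qpath \<Rightarrow> 'k::field) set \<Rightarrow>
    ('v, 'a, 'k) bq_module \<Rightarrow> (real ^ 'v) set" where
  "stability_space Q I N =
    {\<theta>. inner \<theta> (dimension_vector Q I N) = 0 \<and>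
      (\<forall>L. left_submodule (bq_algebra Q I) L N \<longrightarrow> inner \<theta> (dimension_vector Q I (N\<lparr>carrier := L\<rparr>)) \<le> 0)}"

text \<open>For a convex set, \<^const>\<open>aff_dim\<close> is its dimension.\<close>

definition is_wall :: "('v::finite, 'a) pre_digraph \<Rightarrow> (('v, 'a) qpath \<Rightarrow> 'k::field) set \<Rightarrow>
    ('v, 'a, 'k) bq_module \<Rightarrow> bool" where
  "is_wall Q I N \<longleftrightarrow> N \<in> bq_mod_nonzero Q I \<and>
    aff_dim (stability_space Q I N) = int CARD('v) - 1"

definition chambers :: "('v::finite, 'a) pre_digraph \<Rightarrow> (('v, 'a) qpath \<Rightarrow> 'k::field) set \<Rightarrow>
    (real ^ 'v) set set" where
  "chambers Q I = components (UNIV - closure (\<Union>N \<in> bq_mod_nonzero Q I. stability_space Q I N))"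

definition torsion_class_of :: "('v::finite, 'a) pre_digraph \<Rightarrow> (('v, 'a) qpath \<Rightarrow> 'k::field) set \<Rightarrow>
    real ^ 'v \<Rightarrow> ('v, 'a, 'k) bq_module set" where
  "torsion_class_of Q I \<theta> = {X \<in> bq_mod Q I. \<forall>Y \<in> bq_mod Q I.
    is_quotient (bq_algebra Q I) X Y \<longrightarrow> inner \<theta> (dimension_vector Q I Y) \<ge> 0}"


section \<open>Generic paths\<close>

abbreviation velocity :: "(real \<Rightarrow> 'b::real_normed_vector) \<Rightarrow> real \<Rightarrow> 'b" where
  "velocity \<gamma> t \<equiv> vector_derivative \<gamma> (at t within {0..1})"

text \<open>Smooth means infinitely differentiable on \<open>{0..1}\<close>, one-sidedly at the end points;
  \<open>D m\<close> is the \<open>m\<close>-th derivative.\<close>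

definition smooth_path :: "(real \<Rightarrow> 'b::real_normed_vector) \<Rightarrow> bool" where
  "smooth_path \<gamma> \<longleftrightarrow> (\<exists>D :: nat \<Rightarrow> real \<Rightarrow> 'b. D 0 = \<gamma> \<and>
    (\<forall>m. \<forall>t\<in>{0..1}. (D m has_vector_derivative D (Suc m) t) (at t within {0..1})))"

definition D_generic :: "('v::finite, 'a) pre_digraph \<Rightarrow> (('v, 'a) qpath \<Rightarrow> 'k::field) set \<Rightarrow>
    (real \<Rightarrow> real ^ 'v) \<Rightarrow> bool" where
  "D_generic Q I \<gamma> \<longleftrightarrow> smooth_path \<gamma> \<and>
    (\<forall>t\<in>{0, 1}. (\<forall>N \<in> bq_mod_nonzero Q I. \<gamma> t \<notin> stability_space Q I N) \<and>
      (\<exists>C \<in> chambers Q I. \<gamma> t \<in> C)) \<and>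
    (\<forall>t\<in>{0..1}. \<forall>N N'. is_wall Q I N \<and> is_wall Q I N' \<and>
      \<gamma> t \<in> stability_space Q I N \<inter> stability_space Q I N' \<longrightarrow>
      (\<exists>c::real. dimension_vector Q I N = c *\<^sub>R dimension_vector Q I N')) \<and>
    (\<forall>t\<in>{0..1}. \<forall>N \<in> bq_mod_nonzero Q I. \<gamma> t \<in> stability_space Q I N \<longrightarrow>
      inner (velocity \<gamma> t) (dimension_vector Q I N) \<noteq> 0)"

text \<open>Every stability space met by \<open>\<gamma>\<close> at \<open>t\<close> is crossed in the green direction. This is vacuous if
  \<open>\<gamma> t\<close> lies in no stability space.\<close>

definition green_at :: "('v::finite, 'a) pre_digraph \<Rightarrow> (('v, 'a) qpath \<Rightarrow> 'k::field) set \<Rightarrow>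
    (real \<Rightarrow> real ^ 'v) \<Rightarrow> real \<Rightarrow> bool" where
  "green_at Q I \<gamma> t \<longleftrightarrow> (\<forall>N \<in> bq_mod_nonzero Q I. \<gamma> t \<in> stability_space Q I N \<longrightarrow>
    inner (velocity \<gamma> t) (dimension_vector Q I N) > 0)"

end

theory Submission
  imports Defs
begin

text \<open>
  Let \<open>T i\<close> be the given chain, with torsion-free classes \<open>F i\<close>, and let \<open>B (i+1)\<close> be a nonzero object
  of \<open>T (i+1) \<inter> F i\<close> of least dimension. Maximality of the chain makes \<open>B (i+1)\<close> the only simple object of this
  intersection, so every object of it has a dimension vector that is a multiple of \<open>[B (i+1)]\<close>.

  It suffices to find vectors \<open>\<theta> 0, \<dots>, \<theta> r\<close> with \<open>\<langle>\<theta> k, [B j]\<rangle> > 0\<close> for \<open>j \<le> k\<close> and \<open>< 0\<close> for \<open>j > k\<close>. These come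
  by induction on \<open>k\<close>. Given \<open>\<theta> k\<close>, the form \<open>w = \<langle>\<theta> k, -\<rangle>\<close> is positive on \<open>T k\<close> and negative on \<open>F k\<close>, so
  it makes the heart obtained by tilting at \<open>(T k, F k)\<close> a finite length category, in which \<open>B (k+1)\<close>, shifted, is
  simple. The multiplicity of all other simple objects is additive, hence given by a
  vector; it vanishes on \<open>B (k+1)\<close>, and adding a small multiple of the total dimension to a large multiple of it
  gives \<open>\<theta> (k+1)\<close>. No derived category is needed: additivity is a Jordan-Hoelder argument on objects of
  \<open>T k \<union> F k\<close>, with shifted short exact sequences.

  The path is \<open>\<gamma>(x) = \<Sum>k. a k * x ^ k * \<theta> k\<close>. As a polynomial in \<open>x\<close>, \<open>\<langle>\<gamma>(x), [B j]\<rangle>\<close> has exactly one sign change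
  in its coefficients, hence exactly one positive root, a simple one at which the sign becomes positive. With
  \<open>a k = M powr (- k\<^sup>2)\<close> for large \<open>M\<close>, the term for \<open>k = l\<close> dominates at \<open>x = M powr (2 * l)\<close>, so the root for \<open>j\<close>
  lies between the points for \<open>j - 1\<close> and \<open>j\<close>.
\<close>

subsection \<open>Torsion pairs on an abstract class of short exact sequences\<close>

text \<open>The broken line through \<open>\<theta> 0\<close>, ..., \<open>\<theta> r\<close>
  already has the right crossings: from \<open>\<theta> k\<close> to \<open>\<theta> (k+1)\<close>
  only the sign on \<open>B (k+1)\<close> changes. The polynomial realises the same succession of
  sign patterns smoothly. Finitely many signs control all modules because the chain filters every
  object of \<open>T k\<close> by objects of \<open>T (j+1) \<inter> F j\<close> with
  \<open>j < k\<close>, and every object of \<open>F k\<close> by those with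
  \<open>j \<ge> k\<close>. The obstacle is the existence of \<open>\<theta> k\<close>: the vectors
  \<open>[B j]\<close> for \<open>j \<le> k\<close> and \<open>- [B j]\<close> for
  \<open>j > k\<close> must lie in an open half-space, for which linear algebra alone gives no
  reason. Finite length does: in the tilted heart all of them are classes of objects, hence sums of
  classes of simple objects, and counting simple objects is a positive functional. The axioms below
  record only which triples are short exact, without morphisms. They are stable under reversal of
  the sequences, so statements about torsion-free objects are mirror images of statements about
  torsion objects.\<close>

locale short_exact_sequences =
  fixes Ob :: "'o set" and S :: "'o \<Rightarrow> 'o \<Rightarrow> 'o \<Rightarrow> bool"
    and iso :: "'o \<Rightarrow> 'o \<Rightarrow> bool" (infix "\<asymp>" 50) and d :: "'o \<Rightarrow> nat"
  assumes S_Ob: "S L M N \<Longrightarrow> L \<in> Ob \<and> M \<in> Ob \<and> N \<in> Ob"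
    and d_add: "S L M N \<Longrightarrow> d M = d L + d N"
    and iso_refl: "M \<in> Ob \<Longrightarrow> M \<asymp> M"
    and iso_sym: "M \<asymp> N \<Longrightarrow> N \<asymp> M"
    and S_iso: "S L M N \<Longrightarrow> L \<asymp> L' \<Longrightarrow> M \<asymp> M' \<Longrightarrow> N \<asymp> N' \<Longrightarrow> S L' M' N'"
    and zero_sub: "S L M N \<Longrightarrow> d L = 0 \<Longrightarrow> M \<asymp> N"
    and zero_quot: "S L M N \<Longrightarrow> d N = 0 \<Longrightarrow> L \<asymp> M"
    and ex_zero_sub: "M \<in> Ob \<Longrightarrow> \<exists>Z. S Z M M \<and> d Z = 0"
    and ex_zero_quot: "M \<in> Ob \<Longrightarrow> \<exists>Z. S M M Z \<and> d Z = 0"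
    and preimage: "S Y X' X \<Longrightarrow> S X1 X C \<Longrightarrow> \<exists>Z. S Y Z X1 \<and> S Z X' C"
    and quotient_sub: "S A M N \<Longrightarrow> S K A P \<Longrightarrow> \<exists>Z. S K M Z \<and> S P Z N"
    and two_subs: "S A M A' \<Longrightarrow> S C M C' \<Longrightarrow> \<exists>D U V P P' R. S D A P \<and> S D C P' \<and>
      S A U P' \<and> S C U P \<and> S U M R \<and> S P C' R \<and> S P' A' R \<and> S D M V \<and> S P V A' \<and> S P' V C'"
    and pullback: "S Y' X' X \<Longrightarrow> S Y'' X'' X \<Longrightarrow> \<exists>Z. S Y' Z X'' \<and> S Y'' Z X'"
    and pushout: "S A M N \<Longrightarrow> S A M' N' \<Longrightarrow> \<exists>Z. S M Z N' \<and> S M' Z N"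
begin

text \<open>The axioms come in mirror pairs, such as \<open>preimage\<close> with
  \<open>quotient_sub\<close> and \<open>pullback\<close> with \<open>pushout\<close>.
  \<open>two_subs\<close> mirrors itself: with \<open>D\<close> the intersection, \<open>U\<close>
  the sum, \<open>V = M/D\<close> and \<open>R = M/U\<close>, reversal swaps \<open>D\<close> with
  \<open>R\<close> and \<open>U\<close> with \<open>V\<close>; this is why it lists all
  four.\<close>

lemma dual: "short_exact_sequences Ob (\<lambda>L M N. S N M L) iso d"
proof (unfold_locales, goal_cases)
  case (12 A M A' C C')
  then show ?case using two_subs[of A' M A C' C] by blast
next
  case (6 L M N)
  then show ?case using zero_quot iso_sym by blast
next
  case (7 L M N)
  then show ?case using zero_sub iso_sym by blast
next
  case (10 Y X' X X1 C)
  then show ?case using quotient_sub[of X X' Y C X1] by blast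
next
  case (11 A M N K P)
  then show ?case using preimage[of N M A P K] by blast
qed (auto dest: S_Ob d_add iso_sym intro: iso_refl S_iso
  ex_zero_sub ex_zero_quot pullback pushout)

lemma iso_Ob: assumes "M \<asymp> N" "M \<in> Ob" shows "N \<in> Ob"
proof -
  obtain Z where "S Z M M" using ex_zero_sub assms by blast
  then have "S Z M N" using S_iso[of Z M M Z M N] assms iso_refl S_Ob by blast
  then show ?thesis using S_Ob by blast
qed

lemma iso_seq:
  assumes "M \<asymp> N" "M \<in> Ob" shows "\<exists>Z. d Z = 0 \<and> S Z M N" "\<exists>Z. d Z = 0 \<and> S M N Z"
proof -
  obtain Z where "S Z M M" "d Z = 0" using ex_zero_sub assms by blast
  then show "\<exists>Z. d Z = 0 \<and> S Z M N" using S_iso[of Z M M Z M N] assms iso_refl S_Ob by blast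
  obtain Z where "S M M Z" "d Z = 0" using ex_zero_quot assms by blast
  then show "\<exists>Z. d Z = 0 \<and> S M N Z" using S_iso[of M M Z M N Z] assms iso_refl S_Ob by blast
qed

lemma iso_trans: "L \<asymp> M \<Longrightarrow> M \<asymp> N \<Longrightarrow> L \<in> Ob \<Longrightarrow> L \<asymp> N"
  by (meson S_Ob S_iso iso_refl iso_seq(1) zero_sub)

lemma iso_d: assumes "M \<asymp> N" "M \<in> Ob" shows "d M = d N"
proof -
  obtain Z where "d Z = 0" "S Z M N" using iso_seq assms by blast
  then show ?thesis using d_add[of Z M N] by simp
qed

lemma zero_seq: assumes "Z \<in> Ob" "d Z = 0" shows "S Z Z Z"
proof -
  obtain Z' where "S Z' Z Z" "d Z' = 0" using ex_zero_sub assms by blast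
  then show ?thesis using zero_quot[of Z' Z Z] S_iso iso_refl assms by blast
qed

lemma additive_iso:
  fixes f :: "'o \<Rightarrow> 'b::ab_group_add"
  assumes f: "\<And>L M N. S L M N \<Longrightarrow> f M = f L + f N" and M: "M \<asymp> N" "M \<in> Ob"
  shows "f M = f N"
proof -
  obtain Z where Z: "d Z = 0" "S Z M N" using iso_seq M by blast
  then have "f Z = f Z + f Z" using f zero_seq S_Ob by blast
  then show ?thesis using f[OF Z(2)] by simp
qed

section \<open>Torsion classes, torsion-free classes and torsion pairs\<close>

definition torsion :: "'o set \<Rightarrow> bool" where
  "torsion U \<longleftrightarrow> U \<subseteq> Ob \<and> {M \<in> Ob. d M = 0} \<subseteq> U \<and>
    (\<forall>L M N. S L M N \<and> M \<in> U \<longrightarrow> N \<in> U) \<and> (\<forall>L M N. S L M N \<and> L \<in> U \<and> N \<in> U \<longrightarrow> M \<in> U)"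

lemma torsionD:
  assumes "torsion U"
  shows "U \<subseteq> Ob" "M \<in> Ob \<Longrightarrow> d M = 0 \<Longrightarrow> M \<in> U" "S L M N \<Longrightarrow> M \<in> U \<Longrightarrow> N \<in> U"
    "S L M N \<Longrightarrow> L \<in> U \<Longrightarrow> N \<in> U \<Longrightarrow> M \<in> U"
  using assms unfolding torsion_def by blast+

text \<open>Vanishing of morphisms from \<open>U\<close>, expressed by subobjects: for
  \<open>U\<close> closed under quotients the two agree, since images of objects of \<open>U\<close>
  stay in \<open>U\<close>.\<close>

definition free :: "'o set \<Rightarrow> 'o set" where
  "free U = {Y \<in> Ob. \<forall>L N. S L Y N \<and> L \<in> U \<longrightarrow> d L = 0}"

lemma comp_sub: "S A M N \<Longrightarrow> S L A P \<Longrightarrow> \<exists>Z. S L M Z"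
  using quotient_sub by blast

lemma comp_quot: "S L M N \<Longrightarrow> S K N P \<Longrightarrow> \<exists>Z. S Z M P"
  using preimage by blast

end

locale torsion_pair = short_exact_sequences +
  fixes T F :: "'a set"
  assumes T_Ob: "T \<subseteq> Ob" and F_Ob: "F \<subseteq> Ob"
    and T_quot: "S L M N \<Longrightarrow> M \<in> T \<Longrightarrow> N \<in> T"
    and F_sub: "S L M N \<Longrightarrow> M \<in> F \<Longrightarrow> L \<in> F"
    and T_ext: "S L M N \<Longrightarrow> L \<in> T \<Longrightarrow> N \<in> T \<Longrightarrow> M \<in> T"
    and F_ext: "S L M N \<Longrightarrow> L \<in> F \<Longrightarrow> N \<in> F \<Longrightarrow> M \<in> F"
    and TF: "M \<in> T \<Longrightarrow> M \<in> F \<Longrightarrow> d M = 0"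
    and decomp: "M \<in> Ob \<Longrightarrow> \<exists>X Y. S X M Y \<and> X \<in> T \<and> Y \<in> F"
begin

lemma dual_pair: "torsion_pair Ob (\<lambda>L M N. S N M L) iso d F T"
  by (intro torsion_pair.intro dual torsion_pair_axioms.intro)
    (use T_Ob F_Ob T_quot F_sub T_ext F_ext TF decomp in blast)+

lemma T_iso: "M \<in> T \<Longrightarrow> M \<asymp> N \<Longrightarrow> N \<in> T"
  using T_quot iso_seq(1) T_Ob by blast

lemma F_iso: "M \<in> F \<Longrightarrow> M \<asymp> N \<Longrightarrow> N \<in> F"
  using F_sub iso_seq(2) F_Ob iso_sym iso_Ob by blast

lemma T_of_zero_quot: "S X M Y \<Longrightarrow> X \<in> T \<Longrightarrow> d Y = 0 \<Longrightarrow> M \<in> T"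
  by (rule T_iso[OF _ zero_quot])

lemma F_of_zero_sub: "S X M Y \<Longrightarrow> Y \<in> F \<Longrightarrow> d X = 0 \<Longrightarrow> M \<in> F"
  by (rule F_iso[OF _ iso_sym[OF zero_sub]])

lemma T_not_F: "d M \<noteq> 0 \<Longrightarrow> M \<in> T \<Longrightarrow> M \<notin> F"
  using TF[of M] by argo

lemma zero_T: assumes "M \<in> Ob" "d M = 0" shows "M \<in> T"
proof -
  obtain X Y where XY: "S X M Y" "X \<in> T" using decomp assms by blast
  then have "d Y = 0" using d_add[of X M Y] assms by simp
  then show ?thesis using zero_quot XY T_iso by blast
qed

lemma zero_F: assumes "M \<in> Ob" "d M = 0" shows "M \<in> F"
proof -
  obtain X Y where XY: "S X M Y" "Y \<in> F" using decomp assms by blast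
  then have "d X = 0" using d_add[of X M Y] assms by simp
  then show ?thesis using zero_sub[of X M Y] XY F_iso iso_sym by blast
qed

end

context short_exact_sequences begin

text \<open>The decomposition comes from a subobject in \<open>U\<close> of greatest dimension: a
  nonzero subobject in \<open>U\<close> of its quotient would have a larger preimage, again in
  \<open>U\<close> by closure under extensions.\<close>

lemma torsion_pair_free: assumes U: "torsion U" shows "torsion_pair Ob S iso d U (free U)"
proof (unfold_locales)
  show "U \<subseteq> Ob" "free U \<subseteq> Ob" using torsionD(1)[OF U] unfolding free_def by blast+
  show "S L M N \<Longrightarrow> M \<in> U \<Longrightarrow> N \<in> U" for L M N by (rule torsionD(3)[OF U])
  show "S L M N \<Longrightarrow> L \<in> U \<Longrightarrow> N \<in> U \<Longrightarrow> M \<in> U" for L M N by (rule torsionD(4)[OF U])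
  show "L \<in> free U" if SM: "S L M N" "M \<in> free U" for L M N
    unfolding free_def
  proof (clarify, intro conjI allI impI)
    show "L \<in> Ob" using SM S_Ob by blast
    fix K P assume K: "S K L P \<and> K \<in> U"
    then obtain Z where "S K M Z" using comp_sub SM by blast
    then show "d K = 0" using SM(2) K unfolding free_def by blast
  qed
  show "d M = 0" if M: "M \<in> U" "M \<in> free U" for M
  proof -
    have "M \<in> Ob" using torsionD(1)[OF U] M(1) by blast
    then obtain Z where "S M M Z" using ex_zero_quot by blast
    then show ?thesis using M unfolding free_def by blast
  qed
  show "M \<in> free U" if SM: "S A M N" "A \<in> free U" "N \<in> free U" for A M N
    unfolding free_def
  proof (clarify, intro conjI allI impI)
    show "M \<in> Ob" using SM S_Ob by blast
    fix L C assume L: "S L M C \<and> L \<in> U"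
    \<comment> \<open>\<open>D\<close> is the intersection of \<open>L\<close> with
      \<open>A\<close>. The quotient \<open>P'\<close> of \<open>L\<close> embeds into
      \<open>N\<close>, so it vanishes, and \<open>L\<close> lies in \<open>A\<close> up to
      isomorphism.\<close>
    obtain D P P' R where *: "S D A P" "S D L P'" "S P' N R"
      using two_subs[OF SM(1), of L C] L by blast
    have "P' \<in> U" using torsionD(3)[OF U *(2)] L by blast
    then have P': "d P' = 0" using * SM unfolding free_def by blast
    then have "D \<asymp> L" using zero_quot * by blast
    then have "\<exists>Z. d Z = 0 \<and> S Z L D" using iso_seq iso_sym * S_Ob by blast
    then have "D \<in> U" using L torsionD(3)[OF U] by blast
    then have "d D = 0" using * SM unfolding free_def by blast
    then show "d L = 0" using d_add[OF *(2)] P' by simp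
  qed
  show "\<exists>X Y. S X M Y \<and> X \<in> U \<and> Y \<in> free U" if M: "M \<in> Ob" for M
  proof -
    define P where "P X \<longleftrightarrow> X \<in> U \<and> (\<exists>Y. S X M Y)" for X
    obtain Z where "S Z M M" "d Z = 0" using ex_zero_sub M by blast
    then have "P Z" using torsionD(2)[OF U] S_Ob unfolding P_def by blast
    moreover have "\<forall>X. P X \<longrightarrow> d X < Suc (d M)"
    proof (intro allI impI)
      fix X assume "P X"
      then obtain Y where "S X M Y" unfolding P_def by blast
      then show "d X < Suc (d M)" using d_add[of X M Y] by simp
    qed
    ultimately obtain X where X: "P X" "\<forall>X'. P X' \<longrightarrow> d X' \<le> d X"
      using ex_has_greatest_nat[of P Z d "Suc (d M)"] by blast
    then obtain Y where Y: "S X M Y" unfolding P_def by blast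
    have "Y \<in> free U" unfolding free_def
    proof (clarify, intro conjI allI impI)
      show "Y \<in> Ob" using Y S_Ob by blast
      fix L N assume L: "S L Y N \<and> L \<in> U"
      obtain Z where Z: "S X Z L" "S Z M N" using preimage[OF Y] L by blast
      then have "P Z" using X(1) L torsionD(4)[OF U Z(1)] unfolding P_def by blast
      then have "d Z \<le> d X" using X(2) by blast
      then show "d L = 0" using d_add[OF Z(1)] by simp
    qed
    then show ?thesis using Y X(1) unfolding P_def by blast
  qed
qed

end

text \<open>Shifting the objects of \<open>F\<close> reverses their sign, so \<open>|w|\<close> is
  additive along exact sequences of the tilted heart with terms in \<open>T\<close> or shifted
  \<open>F\<close>, and positive on nonzero ones. It plays the part of a length there, although the
  heart is never constructed.\<close>

locale finite_heart = torsion_pair +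
  fixes w :: "'a \<Rightarrow> int"
  assumes w_add: "S L M N \<Longrightarrow> w M = w L + w N"
    and w_pos: "M \<in> T \<Longrightarrow> d M \<noteq> 0 \<Longrightarrow> w M > 0"
    and w_neg: "M \<in> F \<Longrightarrow> d M \<noteq> 0 \<Longrightarrow> w M < 0"
begin

lemma dual_heart: "finite_heart Ob (\<lambda>L M N. S N M L) iso d F T (\<lambda>M. - w M)"
  by (intro finite_heart.intro dual_pair finite_heart_axioms.intro)
    (use w_add w_pos w_neg in fastforce)+

subsection \<open>Additive functions from the simple objects of a tilted heart\<close>

text \<open>In the heart whose objects in \<open>T\<close> and in \<open>F\<close> (shifted) carry the function \<open>\<phi>\<close> and \<open>- \<phi>\<close> respectively, \<open>v\<close> is
  the value forced upon \<open>E\<close> by a proper subobject and its quotient: the three cases are the short exact sequences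
  of the heart with all terms in \<open>T \<union> F\<close>. So \<open>E\<close> behaves as a simple object if no such \<open>v\<close> exists.\<close>

definition decval :: "('a \<Rightarrow> int) \<Rightarrow> 'a \<Rightarrow> int \<Rightarrow> bool" where
  "decval \<phi> E v \<longleftrightarrow>
    (\<exists>L N. S L E N \<and> d L \<noteq> 0 \<and> d N \<noteq> 0 \<and>
      (E \<in> T \<and> L \<in> T \<and> N \<in> T \<or> E \<in> F \<and> L \<in> F \<and> N \<in> F) \<and> v = \<phi> L + \<phi> N) \<or>
    (\<exists>L M. S L M E \<and> d L \<noteq> 0 \<and> d E \<noteq> 0 \<and> E \<in> T \<and> M \<in> T \<and> L \<in> F \<and> v = \<phi> M - \<phi> L) \<or>
    (\<exists>M N. S E M N \<and> d N \<noteq> 0 \<and> d E \<noteq> 0 \<and> E \<in> F \<and> M \<in> F \<and> N \<in> T \<and> v = \<phi> M - \<phi> N)"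

text \<open>The induction hypothesis of the construction below: additivity, known so far only for
  pure objects of small length in the heart.\<close>

definition add_below :: "int \<Rightarrow> ('a \<Rightarrow> int) \<Rightarrow> bool" where
  "add_below n \<phi> \<longleftrightarrow> (\<forall>L M N. S L M N \<and> {L, M, N} \<subseteq> T \<union> F \<and>
     \<bar>w L\<bar> < n \<and> \<bar>w M\<bar> < n \<and> \<bar>w N\<bar> < n \<longrightarrow> \<phi> M = \<phi> L + \<phi> N)"

lemma add_belowD: "add_below n \<phi> \<Longrightarrow> S L M N \<Longrightarrow> L \<in> T \<union> F \<Longrightarrow> M \<in> T \<union> F \<Longrightarrow> N \<in> T \<union> F \<Longrightarrow>
     \<bar>w L\<bar> < n \<Longrightarrow> \<bar>w M\<bar> < n \<Longrightarrow> \<bar>w N\<bar> < n \<Longrightarrow> \<phi> M = \<phi> L + \<phi> N"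
  unfolding add_below_def by blast

lemma w_zero: assumes "M \<in> Ob" "d M = 0" shows "w M = 0"
  using w_add[OF zero_seq[OF assms]] by simp

lemma w_T: assumes "M \<in> T" shows "w M \<ge> 0"
proof (cases "d M = 0")
  case True
  then show ?thesis using w_zero[of M] T_Ob assms by auto
next
  case False
  then show ?thesis using w_pos[of M] assms by simp
qed

lemma w_F: assumes "M \<in> F" shows "w M \<le> 0"
proof (cases "d M = 0")
  case True
  then show ?thesis using w_zero[of M] F_Ob assms by auto
next
  case False
  then show ?thesis using w_neg[of M] assms by simp
qed

text \<open>In this and the next three lemmas a single bound suffices, on the term that becomes the
  middle one in the heart: \<open>|w|\<close> of it is the sum of the other two. It is
  \<open>M\<close> for the patterns TTT and FFF, but \<open>N\<close> for FTT and \<open>L\<close>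
  for FFT.\<close>

lemma add_TTT:
  assumes "add_below n \<phi>" "S L M N" "L \<in> T" "N \<in> T" "w M < n" shows "\<phi> M = \<phi> L + \<phi> N"
proof -
  have "M \<in> T" using T_ext assms by blast
  then show ?thesis using add_belowD[OF assms(1,2)] assms w_T[of L] w_T[of M] w_T[of N] w_add[OF assms(2)] by simp
qed

lemma add_FFF:
  assumes "add_below n \<phi>" "S L M N" "L \<in> F" "N \<in> F" "- w M < n" shows "\<phi> M = \<phi> L + \<phi> N"
proof -
  have "M \<in> F" using F_ext assms by blast
  then show ?thesis using add_belowD[OF assms(1,2)] assms w_F[of L] w_F[of M] w_F[of N] w_add[OF assms(2)] by simp
qed

lemma add_FTT:
  assumes "add_below n \<phi>" "S L M N" "L \<in> F" "M \<in> T" "w N < n" shows "\<phi> M = \<phi> L + \<phi> N"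
proof -
  have "N \<in> T" using T_quot assms by blast
  then show ?thesis using add_belowD[OF assms(1,2)] assms w_F[of L] w_T[of M] w_T[of N] w_add[OF assms(2)] by simp
qed

lemma add_FFT:
  assumes "add_below n \<phi>" "S L M N" "M \<in> F" "N \<in> T" "- w L < n" shows "\<phi> M = \<phi> L + \<phi> N"
proof -
  have "L \<in> F" using F_sub assms by blast
  then show ?thesis using add_belowD[OF assms(1,2)] assms w_F[of L] w_F[of M] w_T[of N] w_add[OF assms(2)] by simp
qed

lemma dual_decval:
  "finite_heart.decval (\<lambda>L M N. S N M L) d F T \<phi> E v \<longleftrightarrow> decval \<phi> E v"
proof -
  have "finite_heart.decval (\<lambda>L M N. S N M L) d F T \<phi> E v \<longleftrightarrow>
    (\<exists>L N. S N E L \<and> d L \<noteq> 0 \<and> d N \<noteq> 0 \<and>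
      (E \<in> F \<and> L \<in> F \<and> N \<in> F \<or> E \<in> T \<and> L \<in> T \<and> N \<in> T) \<and> v = \<phi> L + \<phi> N) \<or>
    (\<exists>L M. S E M L \<and> d L \<noteq> 0 \<and> d E \<noteq> 0 \<and> E \<in> F \<and> M \<in> F \<and> L \<in> T \<and> v = \<phi> M - \<phi> L) \<or>
    (\<exists>M N. S N M E \<and> d N \<noteq> 0 \<and> d E \<noteq> 0 \<and> E \<in> T \<and> M \<in> T \<and> N \<in> F \<and> v = \<phi> M - \<phi> N)"
    by (rule finite_heart.decval_def[OF dual_heart])
  then show ?thesis unfolding decval_def by (smt (verit) add.commute)
qed

lemma dual_add_below:
  "finite_heart.add_below (\<lambda>L M N. S N M L) F T (\<lambda>M. - w M) n \<phi> \<longleftrightarrow> add_below n \<phi>"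
proof -
  have "finite_heart.add_below (\<lambda>L M N. S N M L) F T (\<lambda>M. - w M) n \<phi> \<longleftrightarrow>
    (\<forall>L M N. S N M L \<and> {L, M, N} \<subseteq> F \<union> T \<and>
     \<bar>- w L\<bar> < n \<and> \<bar>- w M\<bar> < n \<and> \<bar>- w N\<bar> < n \<longrightarrow> \<phi> M = \<phi> L + \<phi> N)"
    by (rule finite_heart.add_below_def[OF dual_heart])
  then have 1: "finite_heart.add_below (\<lambda>L M N. S N M L) F T (\<lambda>M. - w M) n \<phi> \<longleftrightarrow>
    (\<forall>N M L. S L M N \<and> {L, M, N} \<subseteq> T \<union> F \<and>
     \<bar>w L\<bar> < n \<and> \<bar>w M\<bar> < n \<and> \<bar>w N\<bar> < n \<longrightarrow> \<phi> M = \<phi> N + \<phi> L)"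
    by (simp only: abs_minus_cancel Un_commute insert_commute conj_ac)
  have "\<phi> N + \<phi> L = \<phi> L + \<phi> N" for L N by simp
  then show ?thesis unfolding 1 add_below_def by metis
qed

text \<open>\<open>Z\<close> need not be pure, so \<open>\<phi> Z\<close> is not at hand. Refining
  both sequences by the intersection \<open>D\<close> of \<open>Y\<close> and \<open>K\<close> gives
  four pure pieces \<open>D\<close>, \<open>P\<close>, \<open>Q\<close>, \<open>R\<close>, and both
  sides are the sum of \<open>\<phi>\<close> over them.\<close>

lemma torsion_of_extension:
  assumes \<phi>: "add_below n \<phi>" and S1: "S Y Z X" and S2: "S K Z G"
    and Y: "Y \<in> F" and X: "X \<in> T" and K: "K \<in> T" and G: "G \<in> F"
    and n: "- w Y < n" "w X < n"
  shows "\<phi> Y + \<phi> X = \<phi> K + \<phi> G"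
proof -
  obtain D P Q R where *: "S D Y P" "S D K Q" "S P G R" "S Q X R"
    using two_subs[OF S1 S2] by blast
  have m: "D \<in> F" "P \<in> F" "Q \<in> T" "R \<in> T"
    using * F_sub T_quot Y X K G by blast+
  note sgn = w_F[OF m(1)] w_F[OF m(2)] w_T[OF m(3)] w_T[OF m(4)] w_F[OF Y] w_F[OF G] w_T[OF X] w_T[OF K]
  note ws = w_add[OF *(1)] w_add[OF *(2)] w_add[OF *(3)] w_add[OF *(4)]
  have "w Q < n" "- w P < n" using sgn ws n by linarith+
  then have "\<phi> Y = \<phi> D + \<phi> P" "\<phi> K = \<phi> D + \<phi> Q" "\<phi> G = \<phi> P + \<phi> R" "\<phi> X = \<phi> Q + \<phi> R"
    using add_FFF[OF \<phi> *(1)] add_FTT[OF \<phi> *(2)] add_FFT[OF \<phi> *(3)] add_TTT[OF \<phi> *(4)]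
      m K G n by simp_all
  then show "\<phi> Y + \<phi> X = \<phi> K + \<phi> G" by linarith
qed

text \<open>Two decompositions are compared through their intersection, as in the Jordan-Hoelder theorem; the torsion part
  \<open>K\<close> of the intersection repairs that it need not be pure.\<close>

lemma decval_unique_T:
  assumes \<phi>: "add_below (w X) \<phi>" and X: "X \<in> T" and v: "decval \<phi> X v" and v': "decval \<phi> X v'"
  shows "v = v'"
proof -
  have nF: "X \<notin> F" if "d X \<noteq> 0" using X TF[of X] that by argo
  define TT where "TT v \<longleftrightarrow> (\<exists>L N. S L X N \<and> d L \<noteq> 0 \<and> d N \<noteq> 0 \<and> L \<in> T \<and> N \<in> T \<and> v = \<phi> L + \<phi> N)" for v
  define FT where "FT v \<longleftrightarrow> (\<exists>L M. S L M X \<and> d L \<noteq> 0 \<and> d X \<noteq> 0 \<and> M \<in> T \<and> L \<in> F \<and> v = \<phi> M - \<phi> L)" for v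
  have split: "TT v \<or> FT v" if "decval \<phi> X v" for v
    using that unfolding decval_def TT_def FT_def
  proof (elim disjE exE conjE, goal_cases)
    case (2 L N)
    then show ?case using nF d_add[OF 2(1)] by simp
  qed (use nF in blast)+
  have tt: "v = v'" if "TT v" "TT v'" for v v'
  proof -
    obtain X1 C1 where 1: "S X1 X C1" "d X1 \<noteq> 0" "d C1 \<noteq> 0" "X1 \<in> T" "C1 \<in> T" "v = \<phi> X1 + \<phi> C1"
      using \<open>TT v\<close> unfolding TT_def by blast
    obtain X2 C2 where 2: "S X2 X C2" "d X2 \<noteq> 0" "d C2 \<noteq> 0" "X2 \<in> T" "C2 \<in> T" "v' = \<phi> X2 + \<phi> C2"
      using \<open>TT v'\<close> unfolding TT_def by blast
    obtain D P Q R where *: "S D X1 P" "S D X2 Q" "S P C2 R" "S Q C1 R"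
      using two_subs[OF 1(1) 2(1)] by blast
    obtain K G where KG: "S K D G" "K \<in> T" "G \<in> F" using decomp S_Ob * by blast
    obtain V1 where V1: "S K X1 V1" "S G V1 P" using quotient_sub[OF *(1) KG(1)] by blast
    obtain V2 where V2: "S K X2 V2" "S G V2 Q" using quotient_sub[OF *(2) KG(1)] by blast
    have m: "P \<in> T" "Q \<in> T" "R \<in> T" "V1 \<in> T" "V2 \<in> T"
      using * V1 V2 1 2 T_quot by blast+
    note sgn = m[THEN w_T] KG(2)[THEN w_T] KG(3)[THEN w_F]
      w_pos[OF 1(4,2)] w_pos[OF 1(5,3)] w_pos[OF 2(4,2)] w_pos[OF 2(5,3)]
    note ws = w_add[OF 1(1)] w_add[OF 2(1)] *[THEN w_add] V1[THEN w_add] V2[THEN w_add]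
    have n: "w X1 < w X" "w X2 < w X" "w C1 < w X" "w C2 < w X" "w P < w X" "w Q < w X"
      using sgn ws by linarith+
    have "\<phi> X1 = \<phi> K + \<phi> V1" "\<phi> V1 = \<phi> G + \<phi> P" "\<phi> X2 = \<phi> K + \<phi> V2" "\<phi> V2 = \<phi> G + \<phi> Q"
      "\<phi> C2 = \<phi> P + \<phi> R" "\<phi> C1 = \<phi> Q + \<phi> R"
      using V1(1)[THEN add_TTT[OF \<phi>]] V2(1)[THEN add_TTT[OF \<phi>]] V1(2)[THEN add_FTT[OF \<phi>]]
        V2(2)[THEN add_FTT[OF \<phi>]] *(3,4)[THEN add_TTT[OF \<phi>]] m KG n by simp_all
    then show ?thesis using 1 2 by simp
  qed
  have tf: "v = v'" if "TT v" "FT v'" for v v'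
  proof -
    obtain X1 C where 1: "S X1 X C" "d X1 \<noteq> 0" "d C \<noteq> 0" "X1 \<in> T" "C \<in> T" "v = \<phi> X1 + \<phi> C"
      using \<open>TT v\<close> unfolding TT_def by blast
    obtain Y X' where 2: "S Y X' X" "d Y \<noteq> 0" "d X \<noteq> 0" "X' \<in> T" "Y \<in> F" "v' = \<phi> X' - \<phi> Y"
      using \<open>FT v'\<close> unfolding FT_def by blast
    \<comment> \<open>The preimage of \<open>X1\<close> in \<open>X'\<close> links the two kinds of
      decomposition: it is an extension of \<open>X1\<close> by \<open>Y\<close> and a subobject of
      \<open>X'\<close> with quotient \<open>C\<close>.\<close>
    obtain Z where Z: "S Y Z X1" "S Z X' C" using preimage[OF 2(1) 1(1)] by blast
    obtain K G where KG: "S K Z G" "K \<in> T" "G \<in> F" using decomp S_Ob Z by blast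
    obtain V where V: "S K X' V" "S G V C" using quotient_sub[OF Z(2) KG(1)] by blast
    have m: "V \<in> T" using V 2 T_quot by blast
    have dX': "d X' \<noteq> 0" using d_add[OF 2(1)] 2 by simp
    note sgn = m[THEN w_T] KG(2)[THEN w_T] KG(3)[THEN w_F]
      w_pos[OF 1(4,2)] w_pos[OF 1(5,3)] w_neg[OF 2(5,2)] w_pos[OF 2(4) dX']
    note ws = w_add[OF 1(1)] w_add[OF 2(1)] V[THEN w_add]
    have n: "- w Y < w X" "w X1 < w X" using sgn ws by linarith+
    have e: "\<phi> Y + \<phi> X1 = \<phi> K + \<phi> G"
      by (rule torsion_of_extension[OF \<phi> Z(1) KG(1) 2(5) 1(4) KG(2,3) n])
    have n': "w X' < w X" "w C < w X" using sgn ws by linarith+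
    have "\<phi> X' = \<phi> K + \<phi> V" "\<phi> V = \<phi> G + \<phi> C"
      using V(1)[THEN add_TTT[OF \<phi>]] V(2)[THEN add_FTT[OF \<phi>]] m KG n' by simp_all
    then show ?thesis using e 1 2 by simp
  qed
  have ff: "v = v'" if "FT v" "FT v'" for v v'
  proof -
    obtain Y' X' where 1: "S Y' X' X" "d Y' \<noteq> 0" "d X \<noteq> 0" "X' \<in> T" "Y' \<in> F" "v = \<phi> X' - \<phi> Y'"
      using \<open>FT v\<close> unfolding FT_def by blast
    obtain Y'' X'' where 2: "S Y'' X'' X" "d Y'' \<noteq> 0" "d X \<noteq> 0" "X'' \<in> T" "Y'' \<in> F" "v' = \<phi> X'' - \<phi> Y''"
      using \<open>FT v'\<close> unfolding FT_def by blast
    \<comment> \<open>The fibre product over \<open>X\<close> is an extension of \<open>X''\<close>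
      by \<open>Y'\<close> and also of \<open>X'\<close> by \<open>Y''\<close>. Comparing both with
      the torsion decomposition of \<open>Z\<close> gives
      \<open>\<phi> Y' + \<phi> X'' = \<phi> Y'' + \<phi> X'\<close>, which is the claim.\<close>
    obtain Z where Z: "S Y' Z X''" "S Y'' Z X'" using pullback[OF 1(1) 2(1)] by blast
    obtain K G where KG: "S K Z G" "K \<in> T" "G \<in> F" using decomp S_Ob Z by blast
    have dX': "d X' \<noteq> 0" "d X'' \<noteq> 0" using d_add[OF 1(1)] d_add[OF 2(1)] 1 2 by auto
    note sgn = w_neg[OF 2(5,2)] w_pos[OF 2(4) dX'(2)] w_neg[OF 1(5,2)] w_pos[OF 1(4) dX'(1)]
    note ws = w_add[OF 1(1)] w_add[OF 2(1)]
    have n: "- w Y' < w X" "w X' < w X" "- w Y'' < w X" "w X'' < w X" using sgn ws by linarith+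
    have e: "\<phi> Y' + \<phi> X'' = \<phi> K + \<phi> G"
      by (rule torsion_of_extension[OF \<phi> Z(1) KG(1) 1(5) 2(4) KG(2,3) n(1,4)])
    have e': "\<phi> Y'' + \<phi> X' = \<phi> K + \<phi> G"
      by (rule torsion_of_extension[OF \<phi> Z(2) KG(1) 2(5) 1(4) KG(2,3) n(3,2)])
    then show ?thesis using e e' 1 2 by simp
  qed
  show ?thesis using split[OF v] split[OF v'] tt tf ff by metis
qed

lemma decval_unique_F:
  assumes \<phi>: "add_below (- w X) \<phi>" and X: "X \<in> F" and v: "decval \<phi> X v" and v': "decval \<phi> X v'"
  shows "v = v'"
  using finite_heart.decval_unique_T[OF dual_heart, of X \<phi> v v'] assms
  unfolding dual_decval dual_add_below by blast

lemma decval_unique: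
  assumes \<phi>: "add_below \<bar>w X\<bar> \<phi>" and v: "decval \<phi> X v" and v': "decval \<phi> X v'"
  shows "v = v'"
proof -
  have "X \<in> T \<or> X \<in> F" using v unfolding decval_def by blast
  then show ?thesis
  proof
    assume X: "X \<in> T"
    then show ?thesis using decval_unique_T[OF _ X v v'] \<phi> w_T[OF X] by simp
  next
    assume X: "X \<in> F"
    then show ?thesis using decval_unique_F[OF _ X v v'] \<phi> w_F[OF X] by simp
  qed
qed

text \<open>The function with prescribed values \<open>c\<close> on simple objects, built by recursion on \<open>\<bar>w E\<bar>\<close>.\<close>

primrec lev :: "('a \<Rightarrow> int) \<Rightarrow> nat \<Rightarrow> 'a \<Rightarrow> int" where
  "lev c 0 = (\<lambda>E. 0)"
| "lev c (Suc n) = (\<lambda>E. if \<bar>w E\<bar> < int n then lev c n E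
     else if \<exists>v. decval (lev c n) E v then SOME v. decval (lev c n) E v else c E)"

lemma decval_iso: assumes "E \<asymp> E'" "E \<in> Ob" shows "decval \<phi> E v \<longleftrightarrow> decval \<phi> E' v"
proof -
  have "decval \<phi> A v \<Longrightarrow> decval \<phi> A' v" if "A \<asymp> A'" "A \<in> Ob" for A A'
  proof -
    have *: "S L A N \<Longrightarrow> S L A' N" "S L N A \<Longrightarrow> S L N A'" "S A L N \<Longrightarrow> S A' L N"
      "A \<in> T \<Longrightarrow> A' \<in> T" "A \<in> F \<Longrightarrow> A' \<in> F" "d A = d A'" for L N
      using that S_iso iso_refl S_Ob T_iso F_iso iso_d by blast+
    assume "decval \<phi> A v"
    then show ?thesis unfolding decval_def *(6)
    proof (elim disjE exE conjE, goal_cases)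
      case (1 L N) then show ?case using *(1)[of L N] *(4,5) by blast
    next
      case (2 L N) then show ?case using *(1)[of L N] *(4,5) by blast
    next
      case (3 L M) then show ?case using *(2)[of L M] *(4,5) by blast
    next
      case (4 M N) then show ?case using *(3)[of M N] *(4,5) by blast
    qed
  qed
  then show ?thesis using assms iso_sym iso_Ob by blast
qed

lemma lev_iso:
  assumes c: "\<And>E E'. E \<asymp> E' \<Longrightarrow> E \<in> Ob \<Longrightarrow> c E = c E'" and E: "E \<asymp> E'" "E \<in> Ob"
  shows "lev c n E = lev c n E'"
proof (induction n)
  case (Suc n)
  have "w E = w E'" by (rule additive_iso[OF w_add E])
  moreover have "decval (lev c n) E = decval (lev c n) E'" using decval_iso[OF E] by blast
  ultimately show ?case using Suc c[OF E] by (simp only: lev.simps)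
qed simp

lemma decval_nonzero: "decval \<phi> E v \<Longrightarrow> d E \<noteq> 0"
  unfolding decval_def using d_add by fastforce

lemma lev_zero:
  assumes "c E = 0" "d E = 0" shows "lev c n E = 0"
  by (induction n) (use decval_nonzero[of _ E] assms in auto)

lemma lev_stable: "\<bar>w E\<bar> < int n \<Longrightarrow> n \<le> m \<Longrightarrow> lev c m E = lev c n E"
  by (induction m) (auto simp: le_Suc_eq)

lemma lev_decval:
  assumes "add_below (int n) (lev c n)" "decval (lev c n) E v" "\<bar>w E\<bar> = int n"
  shows "lev c (Suc n) E = v"
  using decval_unique[of E "lev c n"] assms by (auto intro!: some_equality)

lemma decvalI:
  "S L E N \<Longrightarrow> d L \<noteq> 0 \<Longrightarrow> d N \<noteq> 0 \<Longrightarrow> E \<in> T \<Longrightarrow> L \<in> T \<Longrightarrow> N \<in> T \<Longrightarrow> decval \<phi> E (\<phi> L + \<phi> N)"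
  "S L E N \<Longrightarrow> d L \<noteq> 0 \<Longrightarrow> d N \<noteq> 0 \<Longrightarrow> E \<in> F \<Longrightarrow> L \<in> F \<Longrightarrow> N \<in> F \<Longrightarrow> decval \<phi> E (\<phi> L + \<phi> N)"
  "S L M E \<Longrightarrow> d L \<noteq> 0 \<Longrightarrow> d E \<noteq> 0 \<Longrightarrow> E \<in> T \<Longrightarrow> M \<in> T \<Longrightarrow> L \<in> F \<Longrightarrow> decval \<phi> E (\<phi> M - \<phi> L)"
  "S E M N \<Longrightarrow> d N \<noteq> 0 \<Longrightarrow> d E \<noteq> 0 \<Longrightarrow> E \<in> F \<Longrightarrow> M \<in> F \<Longrightarrow> N \<in> T \<Longrightarrow> decval \<phi> E (\<phi> M - \<phi> N)"
  unfolding decval_def by blast+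

text \<open>In a sequence without zero terms the middle term of the heart has strictly larger
  \<open>|w|\<close> than the other two. So at the new level only that term can be new, and its
  value was chosen to be the one forced by some sequence; by \<open>decval_unique\<close> every
  sequence forces the same.\<close>

lemma lev_additive:
  assumes c: "\<And>E E'. E \<asymp> E' \<Longrightarrow> E \<in> Ob \<Longrightarrow> c E = c E'" and c0: "\<And>E. d E = 0 \<Longrightarrow> c E = 0"
  shows "add_below (int n) (lev c n)"
proof (induction n)
  case 0 then show ?case by (auto simp: add_below_def)
next
  case (Suc n)
  show ?case unfolding add_below_def
  proof (intro allI impI, elim conjE)
    fix L M N
    assume SQ: "S L M N" and p: "{L, M, N} \<subseteq> T \<union> F"
      and b: "\<bar>w L\<bar> < int (Suc n)" "\<bar>w M\<bar> < int (Suc n)" "\<bar>w N\<bar> < int (Suc n)"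
    note Obs = S_Ob[OF SQ]
    have ws: "w M = w L + w N" by (rule w_add[OF SQ])
    have ext: "lev c (Suc n) E = v" if "decval (lev c n) E v" "\<bar>w E\<bar> < int (Suc n)"
      "\<bar>w E\<bar> < int n \<Longrightarrow> lev c n E = v" for E v
    proof (cases "\<bar>w E\<bar> < int n")
      case True then show ?thesis using that(3) by simp
    next
      case False
      then have "\<bar>w E\<bar> = int n" using that(2) by simp
      then show ?thesis by (rule lev_decval[OF Suc that(1)])
    qed
    have red: "lev c (Suc n) E = lev c n E" if "\<bar>w E\<bar> < int n" for E using that by simp
    show "lev c (Suc n) M = lev c (Suc n) L + lev c (Suc n) N"
    proof (cases "d L = 0 \<or> d N = 0")
      case True
      then show ?thesis
      proof
        assume z: "d L = 0"
        then have "lev c (Suc n) M = lev c (Suc n) N"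
          using lev_iso[of c, OF c zero_sub[OF SQ z]] Obs by blast
        moreover have "lev c (Suc n) L = 0" by (rule lev_zero[of c L "Suc n", OF c0[OF z] z])
        ultimately show ?thesis by simp
      next
        assume z: "d N = 0"
        then have "lev c (Suc n) L = lev c (Suc n) M"
          using lev_iso[of c, OF c zero_quot[OF SQ z]] Obs by blast
        moreover have "lev c (Suc n) N = 0" by (rule lev_zero[of c N "Suc n", OF c0[OF z] z])
        ultimately show ?thesis by simp
      qed
    next
      case False
      then have nz: "d L \<noteq> 0" "d N \<noteq> 0" "d M \<noteq> 0" using d_add[OF SQ] by auto
      \<comment> \<open>\<open>M\<close> in \<open>T\<close> forces \<open>N\<close> into
        \<open>T\<close>, and \<open>M\<close> in \<open>F\<close> forces \<open>L\<close> into
        \<open>F\<close>. The four remaining patterns are exactly the exact sequences of the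
        heart.\<close>
      consider (TTT) "L \<in> T" "M \<in> T" "N \<in> T" | (FTT) "L \<in> F" "M \<in> T" "N \<in> T"
        | (FFF) "L \<in> F" "M \<in> F" "N \<in> F" | (FFT) "L \<in> F" "M \<in> F" "N \<in> T"
        using p T_quot[OF SQ] F_sub[OF SQ] by blast
      then show ?thesis
      proof cases
        case TTT
        have lt: "w L < w M" "w N < w M" "0 < w L" "0 < w N" using w_pos TTT nz ws by auto
        then have "\<bar>w L\<bar> < int n" "\<bar>w N\<bar> < int n" using b by auto
        moreover have "lev c (Suc n) M = lev c n L + lev c n N"
          by (rule ext[OF decvalI(1)]) (use SQ nz TTT b add_TTT[OF Suc SQ] in auto)
        ultimately show ?thesis by (simp only: red)
      next
        case FTT
        have lt: "- w L < w N" "w M < w N" "w L < 0" "0 < w M" using w_neg[of L] w_pos[of M] FTT nz ws by simp_all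
        then have "\<bar>w L\<bar> < int n" "\<bar>w M\<bar> < int n" using b by auto
        moreover have "lev c (Suc n) N = lev c n M - lev c n L"
          by (rule ext[OF decvalI(3)]) (use SQ nz FTT b add_FTT[OF Suc SQ] in auto)
        ultimately show ?thesis by (simp only: red)
      next
        case FFF
        have lt: "w M < w L" "w M < w N" "w L < 0" "w N < 0" using w_neg FFF nz ws by auto
        then have "\<bar>w L\<bar> < int n" "\<bar>w N\<bar> < int n" using b by auto
        moreover have "lev c (Suc n) M = lev c n L + lev c n N"
          by (rule ext[OF decvalI(2)]) (use SQ nz FFF b add_FFF[OF Suc SQ] in auto)
        ultimately show ?thesis by (simp only: red)
      next
        case FFT
        have lt: "w N < - w L" "w L < w M" "w M < 0" "0 < w N" using w_neg[of M] w_pos[of N] FFT nz ws by simp_all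
        then have "\<bar>w N\<bar> < int n" "\<bar>w M\<bar> < int n" using b by auto
        moreover have "lev c (Suc n) L = lev c n M - lev c n N"
          by (rule ext[OF decvalI(4)]) (use SQ nz FFT b add_FFT[OF Suc SQ] in auto)
        ultimately show ?thesis by (simp only: red)
      qed
    qed
  qed
qed

text \<open>The levels have a limit: the value at \<open>E\<close> is final as soon as the level
  exceeds \<open>|w E|\<close>, so it may be read off at level \<open>|w E| + 1\<close>.\<close>

lemma ex_pure_additive:
  assumes c: "\<And>E E'. E \<asymp> E' \<Longrightarrow> E \<in> Ob \<Longrightarrow> c E = c E'" and c0: "\<And>E. d E = 0 \<Longrightarrow> c E = 0"
  obtains \<phi> where "\<And>n. add_below n \<phi>" "\<And>E. (\<nexists>v. decval \<phi> E v) \<Longrightarrow> \<phi> E = c E"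
proof
  define \<phi> where "\<phi> E = lev c (Suc (nat \<bar>w E\<bar>)) E" for E
  have lev: "lev c n E = \<phi> E" if "\<bar>w E\<bar> < int n" for n E
    unfolding \<phi>_def by (rule lev_stable) (use that in auto)
  show "add_below n \<phi>" for n
    unfolding add_below_def
  proof (intro allI impI, elim conjE)
    fix L M N assume *: "S L M N" "{L, M, N} \<subseteq> T \<union> F" "\<bar>w L\<bar> < n" "\<bar>w M\<bar> < n" "\<bar>w N\<bar> < n"
    then have "n = int (nat n)" by simp
    then have "lev c (nat n) M = lev c (nat n) L + lev c (nat n) N"
      using add_belowD[OF lev_additive[of c "nat n", OF c c0] *(1)] * by auto
    then show "\<phi> M = \<phi> L + \<phi> N" using lev * \<open>n = _\<close> by metis
  qed
  show "\<phi> E = c E" if "\<nexists>v. decval \<phi> E v" for E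
  proof -
    \<comment> \<open>Whether some value is forced on \<open>E\<close> depends only on the sequences
      through \<open>E\<close>, not on the function that is inserted.\<close>
    have "\<nexists>v. decval (lev c (nat \<bar>w E\<bar>)) E v" using that unfolding decval_def by blast
    then show ?thesis
      unfolding \<phi>_def lev.simps using if_not_P[of "\<bar>w E\<bar> < int (nat \<bar>w E\<bar>)"] by (auto split: if_split)
  qed
qed

section \<open>Passage from pure objects to all objects, and signs\<close>

lemma extend_additive:
  assumes \<phi>: "\<And>n. add_below n \<phi>"
  obtains \<psi> where "\<And>L M N. S L M N \<Longrightarrow> \<psi> M = \<psi> L + \<psi> N" "\<And>E. E \<in> T \<union> F \<Longrightarrow> \<psi> E = \<phi> E"
proof
  have TTT: "\<phi> M = \<phi> L + \<phi> N" if "S L M N" "L \<in> T" "N \<in> T" for L M N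
    using add_TTT[OF \<phi>, where n="w M + 1"] that by simp
  have FFF: "\<phi> M = \<phi> L + \<phi> N" if "S L M N" "L \<in> F" "N \<in> F" for L M N
    using add_FFF[OF \<phi>, where n="- w M + 1"] that by simp
  have FTT: "\<phi> M = \<phi> L + \<phi> N" if "S L M N" "L \<in> F" "M \<in> T" for L M N
    using add_FTT[OF \<phi>, where n="w N + 1"] that by simp
  have FFT: "\<phi> M = \<phi> L + \<phi> N" if "S L M N" "M \<in> F" "N \<in> T" for L M N
    using add_FFT[OF \<phi>, where n="- w L + 1"] that by simp
  have unique: "\<phi> X + \<phi> Y = \<phi> X' + \<phi> Y'"
    if XY: "S X M Y" "S X' M Y'" "X \<in> T" "X' \<in> T" "Y \<in> F" "Y' \<in> F" for X M Y X' Y'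
  proof -
    \<comment> \<open>\<open>P\<close> and \<open>Q\<close> are quotients of torsion and subobjects
      of torsion-free objects, hence zero: the two decompositions agree up to zero pieces.\<close>
    obtain D P Q R where *: "S D X P" "S D X' Q" "S P Y' R" "S Q Y R"
      using two_subs[OF XY(1,2)] by blast
    have m: "P \<in> T" "P \<in> F" "Q \<in> T" "Q \<in> F" using * T_quot F_sub XY by blast+
    then have z: "d P = 0" "d Q = 0" using TF by blast+
    have m': "D \<in> T" "R \<in> F"
      using T_iso[OF XY(3) iso_sym[OF zero_quot[OF *(1) z(1)]]] F_iso[OF XY(6) zero_sub[OF *(3) z(1)]] by auto
    have "\<phi> X = \<phi> D + \<phi> P" "\<phi> X' = \<phi> D + \<phi> Q" "\<phi> Y' = \<phi> P + \<phi> R" "\<phi> Y = \<phi> Q + \<phi> R"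
      using TTT FFF * m m' by blast+
    moreover have "\<phi> P = 0" "\<phi> Q = 0" using TTT[OF zero_seq] z m T_Ob by force+
    ultimately show ?thesis by simp
  qed
  define \<psi> where "\<psi> M = (SOME v. \<exists>X Y. S X M Y \<and> X \<in> T \<and> Y \<in> F \<and> v = \<phi> X + \<phi> Y)" for M
  have \<psi>: "\<psi> M = \<phi> X + \<phi> Y" if "S X M Y" "X \<in> T" "Y \<in> F" for X M Y
    unfolding \<psi>_def by (rule some_equality) (use that unique in blast)+
  show "\<psi> E = \<phi> E" if E: "E \<in> T \<union> F" for E
  proof -
    have EOb: "E \<in> Ob" using E T_Ob F_Ob by blast
    obtain Z where Z: "S Z E E" "d Z = 0" using ex_zero_sub EOb by blast
    obtain Z' where Z': "S E E Z'" "d Z' = 0" using ex_zero_quot EOb by blast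
    have m: "Z \<in> T" "Z \<in> F" "Z' \<in> T" "Z' \<in> F" using zero_T zero_F Z Z' S_Ob by blast+
    then have "\<phi> Z = 0" "\<phi> Z' = 0" using TTT[OF zero_seq] Z Z' T_Ob by force+
    then show ?thesis using \<psi>[OF Z(1)] \<psi>[OF Z'(1)] m E by auto
  qed
  show "\<psi> M = \<psi> L + \<psi> N" if SQ: "S L M N" for L M N
  proof -
    obtain X Y where XY: "S X M Y" "X \<in> T" "Y \<in> F" using decomp S_Ob SQ by blast
    \<comment> \<open>Refine \<open>L\<close> against the torsion part \<open>X\<close> of
      \<open>M\<close>. The pieces \<open>P\<close> and \<open>Q\<close> are pure, but the
      intersection \<open>D\<close> and the quotient \<open>R\<close> by the sum need not be, so
      each of them is decomposed once more. Then \<open>K\<close> is the torsion part of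
      \<open>L\<close> and \<open>W\<close> that of \<open>N\<close>.\<close>
    obtain D P Q R where *: "S D L P" "S D X Q" "S P Y R" "S Q N R"
      using two_subs[OF SQ XY(1)] by blast
    obtain K G where KG: "S K D G" "K \<in> T" "G \<in> F" using decomp S_Ob * by blast
    obtain V where V: "S K L V" "S G V P" using quotient_sub[OF *(1) KG(1)] by blast
    obtain V2 where V2: "S K X V2" "S G V2 Q" using quotient_sub[OF *(2) KG(1)] by blast
    obtain T1 F1 where R: "S T1 R F1" "T1 \<in> T" "F1 \<in> F" using decomp S_Ob * by blast
    obtain W where W: "S Q W T1" "S W N F1" using preimage[OF *(4) R(1)] by blast
    obtain W2 where W2: "S P W2 T1" "S W2 Y F1" using preimage[OF *(3) R(1)] by blast
    have m: "P \<in> F" "V \<in> F" "Q \<in> T" "W \<in> T" "V2 \<in> T" "W2 \<in> F"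
      using XY KG R * V V2 W W2 F_sub F_ext T_quot T_ext by blast+
    have "\<psi> L = \<phi> K + \<phi> V" "\<psi> N = \<phi> W + \<phi> F1" "\<psi> M = \<phi> X + \<phi> Y" using \<psi> XY V KG W R m by blast+
    moreover have "\<phi> V = \<phi> G + \<phi> P" "\<phi> W = \<phi> Q + \<phi> T1" "\<phi> X = \<phi> K + \<phi> V2" "\<phi> V2 = \<phi> G + \<phi> Q"
      "\<phi> Y = \<phi> W2 + \<phi> F1" "\<phi> W2 = \<phi> P + \<phi> T1"
      using FFF[OF V(2)] TTT[OF W(1)] TTT[OF V2(1)] FTT[OF V2(2)] FFF[OF W2(2)] FFT[OF W2(1)] m KG R by blast+
    ultimately show ?thesis by simp
  qed
qed

text \<open>Strictness is lost in one place only: an extension of torsion-free objects can have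
  value zero, but then both parts do and \<open>U\<close> is closed under extensions. In the two
  mixed cases a torsion object contributes strictly.\<close>

lemma pure_additive_sign:
  assumes \<phi>: "\<And>n. add_below n \<phi>"
    and c: "\<And>E. (\<nexists>v. decval \<phi> E v) \<Longrightarrow> E \<in> T \<Longrightarrow> d E \<noteq> 0 \<Longrightarrow> \<phi> E > 0"
      "\<And>E. (\<nexists>v. decval \<phi> E v) \<Longrightarrow> E \<in> F \<Longrightarrow> d E \<noteq> 0 \<Longrightarrow> \<phi> E \<le> 0 \<and> (\<phi> E = 0 \<longrightarrow> E \<in> U)"
    and U: "\<And>L M N. S L M N \<Longrightarrow> L \<in> U \<Longrightarrow> N \<in> U \<Longrightarrow> M \<in> U"
    and E: "d E \<noteq> 0"
  shows "(E \<in> T \<longrightarrow> \<phi> E > 0) \<and> (E \<in> F \<longrightarrow> \<phi> E \<le> 0 \<and> (\<phi> E = 0 \<longrightarrow> E \<in> U))"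
  using E
proof (induction "nat \<bar>w E\<bar>" arbitrary: E rule: less_induct)
  case less
  show ?case
  proof (cases "E \<in> T \<union> F \<and> (\<exists>v. decval \<phi> E v)")
    case False
    then show ?thesis using c less.prems by blast
  next
    case True
    then obtain v where v: "decval \<phi> E v" by blast
    have IH: "(A \<in> T \<longrightarrow> \<phi> A > 0) \<and> (A \<in> F \<longrightarrow> \<phi> A \<le> 0 \<and> (\<phi> A = 0 \<longrightarrow> A \<in> U))"
      if "d A \<noteq> 0" "\<bar>w A\<bar> < \<bar>w E\<bar>" for A
      using less.hyps[of A] that by simp
    have notboth: "\<not> (E \<in> T \<and> E \<in> F)" using T_not_F less.prems by blast
    from v show ?thesis unfolding decval_def
    proof (elim disjE exE conjE, goal_cases)
      case (1 L N)
      have "0 < w L" "0 < w N" "w E = w L + w N" using 1 w_pos[of L] w_pos[of N] w_add[OF 1(1)] by simp_all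
      then have "\<phi> L > 0" "\<phi> N > 0" using IH[of L] IH[of N] 1 by auto
      moreover have "\<phi> E = \<phi> L + \<phi> N" using add_TTT[OF \<phi> 1(1), where n="w E + 1"] 1 by auto
      ultimately show ?case using notboth 1 by auto
    next
      case (2 L N)
      have "0 > w L" "0 > w N" "w E = w L + w N" using 2 w_neg[of L] w_neg[of N] w_add[OF 2(1)] by simp_all
      then have "\<phi> L \<le> 0 \<and> (\<phi> L = 0 \<longrightarrow> L \<in> U)" "\<phi> N \<le> 0 \<and> (\<phi> N = 0 \<longrightarrow> N \<in> U)"
        using IH[of L] IH[of N] 2 by auto
      moreover have "\<phi> E = \<phi> L + \<phi> N" using add_FFF[OF \<phi> 2(1), where n="- w E + 1"] 2 by auto
      ultimately show ?case using notboth 2 U[OF 2(1)] by auto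
    next
      case (3 L M)
      have dM: "d M \<noteq> 0" using 3 d_add[OF 3(1)] by simp
      have "0 > w L" "0 < w M" "w M = w L + w E" using 3 dM w_neg[of L] w_pos[of M] w_add[OF 3(1)] by simp_all
      then have "\<phi> L \<le> 0" "\<phi> M > 0"
        using IH[of L] IH[of M] 3 dM by auto
      moreover have "\<phi> M = \<phi> L + \<phi> E" using add_FTT[OF \<phi> 3(1), where n="w E + 1"] 3 by auto
      ultimately show ?case using notboth 3 by auto
    next
      case (4 M N)
      have dM: "d M \<noteq> 0" using 4 d_add[OF 4(1)] by simp
      have "0 < w N" "0 > w M" "w M = w E + w N" using 4 dM w_neg[of M] w_pos[of N] w_add[OF 4(1)] by simp_all
      then have "\<phi> N > 0" "\<phi> M \<le> 0"
        using IH[of N] IH[of M] 4 dM by auto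
      moreover have "\<phi> M = \<phi> E + \<phi> N" using add_FFT[OF \<phi> 4(1), where n="- w E + 1"] 4 by auto
      ultimately show ?case using notboth 4 by auto
    qed
  qed
qed

text \<open>The third and fourth hypotheses say that \<open>B\<close>, shifted, has no proper
  subobject in the heart. An object of \<open>F\<close> on which \<open>\<psi>\<close> vanishes has
  \<open>B\<close> as its only composition factor there, so it is an iterated extension of copies of
  \<open>B\<close> and lies in \<open>U\<close>.\<close>

lemma ex_facet_functional:
  assumes B: "B \<in> F" "d B \<noteq> 0" "\<And>M N. S B M N \<Longrightarrow> M \<in> F \<Longrightarrow> N \<in> T \<Longrightarrow> d N = 0"
      "\<And>L N. S L B N \<Longrightarrow> N \<in> F \<Longrightarrow> d L = 0 \<or> d N = 0"
    and U: "\<And>L M N. S L M N \<Longrightarrow> L \<in> U \<Longrightarrow> N \<in> U \<Longrightarrow> M \<in> U" "B \<in> U" "\<And>M N. M \<in> U \<Longrightarrow> M \<asymp> N \<Longrightarrow> N \<in> U"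
  obtains \<psi> :: "'a \<Rightarrow> int" where "\<And>L M N. S L M N \<Longrightarrow> \<psi> M = \<psi> L + \<psi> N" "\<psi> B = 0"
    "\<And>X. X \<in> T \<Longrightarrow> d X \<noteq> 0 \<Longrightarrow> \<psi> X > 0" "\<And>Y. Y \<in> F \<Longrightarrow> \<psi> Y \<le> 0"
    "\<And>Y. Y \<in> F \<Longrightarrow> d Y \<noteq> 0 \<Longrightarrow> \<psi> Y = 0 \<Longrightarrow> Y \<in> U"
proof -
  \<comment> \<open>Each simple object other than \<open>B\<close> counts once; the value
    \<open>-1\<close> on \<open>F\<close> compensates the sign of the shift.\<close>
  define c :: "'a \<Rightarrow> int" where "c E = (if d E = 0 \<or> B \<asymp> E then 0 else if E \<in> T then 1 else -1)" for E
  have BOb: "B \<in> Ob" using B F_Ob by blast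
  have ciso: "c E = c E'" if "E \<asymp> E'" "E \<in> Ob" for E E'
  proof -
    have "B \<asymp> E \<longleftrightarrow> B \<asymp> E'" using that BOb iso_trans iso_sym by blast
    moreover have "E \<in> T \<longleftrightarrow> E' \<in> T" using that T_iso iso_sym by blast
    ultimately show ?thesis unfolding c_def using iso_d that by auto
  qed
  obtain \<phi> where \<phi>: "\<And>n. add_below n \<phi>" "\<And>E. (\<nexists>v. decval \<phi> E v) \<Longrightarrow> \<phi> E = c E"
    using ex_pure_additive[of c] ciso unfolding c_def by auto
  obtain \<psi> where \<psi>: "\<And>L M N. S L M N \<Longrightarrow> \<psi> M = \<psi> L + \<psi> N" "\<And>E. E \<in> T \<union> F \<Longrightarrow> \<psi> E = \<phi> E"
    using extend_additive[OF \<phi>(1)] by blast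
  have sgn: "(E \<in> T \<longrightarrow> \<phi> E > 0) \<and> (E \<in> F \<longrightarrow> \<phi> E \<le> 0 \<and> (\<phi> E = 0 \<longrightarrow> E \<in> U))" if "d E \<noteq> 0" for E
  proof (rule pure_additive_sign[OF \<phi>(1) _ _ U(1) that])
    fix E assume E: "\<nexists>v. decval \<phi> E v" "d E \<noteq> 0"
    { assume "E \<in> T"
      then have "\<not> B \<asymp> E" using F_iso[OF B(1)] T_not_F[OF E(2)] by blast
      then show "\<phi> E > 0" using \<phi>(2)[OF E(1)] E(2) \<open>E \<in> T\<close> unfolding c_def by simp }
    { assume "E \<in> F"
      then have "E \<notin> T" using T_not_F[OF E(2)] by blast
      then show "\<phi> E \<le> 0 \<and> (\<phi> E = 0 \<longrightarrow> E \<in> U)" using \<phi>(2)[OF E(1)] E(2) U(3)[OF U(2)] unfolding c_def by auto }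
  qed
  have "\<nexists>v. decval \<phi> B v"
  proof
    assume "\<exists>v. decval \<phi> B v"
    moreover have "B \<notin> T" using B T_not_F by blast
    ultimately show False unfolding decval_def
    proof (elim exE disjE conjE, goal_cases)
      case (2 v L N) then show ?case using B(4)[of L N] by simp
    next
      case (4 v M N) then show ?case using B(3)[of M N] by simp
    qed auto
  qed
  then have "\<phi> B = 0" using \<phi>(2) iso_refl BOb unfolding c_def by simp
  show ?thesis
  proof
    show "\<psi> B = 0" using \<open>\<phi> B = 0\<close> \<psi>(2) B by simp
    show "\<psi> Y \<le> 0" if Y: "Y \<in> F" for Y
    proof (cases "d Y = 0")
      case True
      then show ?thesis using \<psi>(1)[OF zero_seq[of Y]] Y F_Ob by auto
    next
      case False
      then show ?thesis using sgn \<psi>(2) Y by auto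
    qed
  qed (use \<psi> sgn in auto)
qed

end

subsection \<open>Bricks of a maximal chain of torsion classes\<close>

text \<open>\<open>linear\<close> turns integer counts into stability vectors. It holds for modules
  over a bound quiver algebra because the Grothendieck group is generated by the simple modules at
  the vertices.\<close>

locale graded_sequences = short_exact_sequences Ob S iso d
  for Ob :: "'o set" and S and iso (infix "\<asymp>" 50) and d :: "'o \<Rightarrow> nat" +
  fixes dv :: "'o \<Rightarrow> real ^ 'v"
  assumes dv_add: "S L M N \<Longrightarrow> dv M = dv L + dv N"
    and linear: "(\<And>L M N. S L M N \<Longrightarrow> (\<psi> M :: int) = \<psi> L + \<psi> N) \<Longrightarrow>
      \<exists>\<theta>. \<forall>M\<in>Ob. real_of_int (\<psi> M) = inner \<theta> (dv M)"

context short_exact_sequences begin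

text \<open>A left orthogonal inside \<open>T'\<close>. It is closed under extensions because
  \<open>P\<close> passes to subobjects: the image \<open>A\<close> of \<open>L\<close> in a
  quotient \<open>I\<close> of \<open>M\<close> is excluded, hence zero, so that \<open>I\<close> is
  already a quotient of \<open>N\<close>.\<close>

lemma torsion_perp:
  assumes T': "torsion T'" and P: "\<And>L M N. S L M N \<Longrightarrow> P M \<Longrightarrow> P L"
  shows "torsion {X \<in> T'. \<forall>K N. S K X N \<and> P N \<longrightarrow> d N = 0}" (is "torsion ?U")
  unfolding torsion_def
proof (intro conjI allI impI subsetI)
  show "x \<in> Ob" if "x \<in> ?U" for x using that torsionD(1)[OF T'] by blast
  show "M \<in> ?U" if "M \<in> {M \<in> Ob. d M = 0}" for M
    using that torsionD(2)[OF T', of M] d_add by auto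
  show "N \<in> ?U" if "S L M N \<and> M \<in> ?U" for L M N
  proof (intro CollectI conjI allI impI)
    show "N \<in> T'" using that torsionD(3)[OF T', of L M N] by blast
    fix K I assume "S K N I \<and> P I"
    then show "d I = 0" using comp_quot[of L M N K I] that by blast
  qed
  show "M \<in> ?U" if "S L M N \<and> L \<in> ?U \<and> N \<in> ?U" for L M N
  proof (intro CollectI conjI allI impI)
    have SQ: "S L M N" using that by blast
    show "M \<in> T'" using that torsionD(4)[OF T', of L M N] by blast
    fix K I assume I: "S K M I \<and> P I"
    obtain D A A' R where *: "S D L A" "S A I R" "S A' N R"
      using two_subs[OF SQ, of K I] I by blast
    have "d A = 0" using * I that P[of A I R] by blast
    then have "I \<asymp> R" using zero_sub * by blast
    then obtain Z where "S R I Z" using iso_seq(2)[OF iso_sym] iso_Ob I S_Ob by blast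
    then have "P R" using P I by blast
    then have "d R = 0" using * that by blast
    then show "d I = 0" using \<open>d A = 0\<close> d_add[OF *(2)] by simp
  qed
qed

lemma dv_zero:
  fixes f :: "'o \<Rightarrow> 'b::ab_group_add"
  assumes f: "\<And>L M N. S L M N \<Longrightarrow> f M = f L + f N" and "Z \<in> Ob" "d Z = 0"
  shows "f Z = 0"
  using f[OF zero_seq[OF assms(2,3)]] by simp

lemma free_antimono: "U \<subseteq> U' \<Longrightarrow> free U' \<subseteq> free U"
  unfolding free_def by blast

end

context graded_sequences begin

lemma dv0: "Z \<in> Ob \<Longrightarrow> d Z = 0 \<Longrightarrow> dv Z = 0"
  by (rule dv_zero[where f = dv, OF dv_add])

text \<open>The fourth and fifth conclusions make \<open>B\<close>, shifted, a simple object of the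
  heart tilted at \<open>T\<close>; the last comes from a filtration by copies of \<open>B\<close>.
  The covering property enters twice, through two auxiliary torsion classes between \<open>T\<close>
  and \<open>T'\<close>.\<close>

lemma ex_brick:
  assumes T: "torsion T" and T': "torsion T'" and sub: "T \<subset> T'"
    and cover: "\<And>U. torsion U \<Longrightarrow> T \<subseteq> U \<Longrightarrow> U \<subseteq> T' \<Longrightarrow> U = T \<or> U = T'"
  obtains B where "B \<in> T'" "B \<in> free T" "d B \<noteq> 0"
    "\<And>M N. S B M N \<Longrightarrow> M \<in> free T \<Longrightarrow> N \<in> T \<Longrightarrow> d N = 0"
    "\<And>L N. S L B N \<Longrightarrow> N \<in> free T \<Longrightarrow> d L = 0 \<or> d N = 0"
    "\<And>E. E \<in> T' \<Longrightarrow> E \<in> free T \<Longrightarrow> d E \<noteq> 0 \<Longrightarrow> \<exists>m\<ge>1. dv E = real m *\<^sub>R dv B"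
proof -
  define F where "F = free T"
  interpret torsion_pair Ob S iso d T F unfolding F_def by (rule torsion_pair_free[OF T])
  note T'_quot = torsionD(3)[OF T'] and T'_ext = torsionD(4)[OF T']
  have T'Ob: "T' \<subseteq> Ob" by (rule torsionD(1)[OF T'])
  have notboth: "d M = 0" if "M \<in> T" "M \<in> F" for M using TF that by blast
  obtain M where M: "M \<in> T'" "M \<notin> T" using sub by blast
  obtain X Y where XY: "S X M Y" "X \<in> T" "Y \<in> F" using decomp M T'Ob by blast
  have "d Y \<noteq> 0"
  proof
    assume "d Y = 0"
    then show False using T_of_zero_quot[OF XY(1,2)] M(2) by simp
  qed
  moreover have "Y \<in> T'" by (rule T'_quot[OF XY(1) M(1)])
  ultimately have "Y \<in> T' \<and> Y \<in> F \<and> d Y \<noteq> 0" using XY(3) by simp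
  then obtain B where B: "B \<in> T'" "B \<in> F" "d B \<noteq> 0" and
    Bmin: "\<And>E. E \<in> T' \<Longrightarrow> E \<in> F \<Longrightarrow> d E \<noteq> 0 \<Longrightarrow> d B \<le> d E"
    using ex_has_least_nat[of "\<lambda>E. E \<in> T' \<and> E \<in> F \<and> d E \<noteq> 0" Y d] by blast
  have BOb: "B \<in> Ob" using B T'Ob by blast
  have BT: "B \<notin> T" using T_not_F[OF B(3)] B(2) by blast
  \<comment> \<open>The torsion-free part of a proper quotient of \<open>B\<close> is still in
    \<open>T'\<close> but smaller than \<open>B\<close>, hence zero by minimality.\<close>
  have quotB: "N \<in> T" if N: "S K B N" "d K \<noteq> 0" for K N
  proof -
    obtain X Y where XY: "S X N Y" "X \<in> T" "Y \<in> F" using decomp N S_Ob by blast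
    have Y: "Y \<in> T'" by (rule T'_quot[OF XY(1) T'_quot[OF N(1) B(1)]])
    have "d Y < d B" using d_add[OF XY(1)] d_add[OF N(1)] N by simp
    then have "d Y = 0" using Bmin[OF Y XY(3)] by fastforce
    then show ?thesis by (rule T_of_zero_quot[OF XY(1,2)])
  qed
  have onto: "\<exists>K. S K E B" if E: "E \<in> T'" "E \<in> F" "d E \<noteq> 0" for E
  proof -
    \<comment> \<open>\<open>U\<close> consists of the objects of \<open>T'\<close> without a
      nonzero morphism to \<open>B\<close>. It contains \<open>T\<close> but not \<open>B\<close>,
      so it is \<open>T\<close>. Hence \<open>E\<close> has a nonzero image in \<open>B\<close>, and
      by minimality the image is all of \<open>B\<close>.\<close>
    define P where "P N \<longleftrightarrow> (\<exists>C. S N B C)" for N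
    define U where "U = {X \<in> T'. \<forall>K N. S K X N \<and> P N \<longrightarrow> d N = 0}"
    have "torsion U" unfolding U_def
    proof (rule torsion_perp[OF T'])
      show "P L" if "S L M N" "P M" for L M N using that comp_sub unfolding P_def by blast
    qed
    moreover have "T \<subseteq> U"
    proof
      fix X assume X: "X \<in> T"
      have "d N = 0" if N: "S K X N" "P N" for K N
      proof -
        obtain C where "S N B C" using N(2) unfolding P_def by blast
        then have "N \<in> F" using F_sub B(2) by blast
        then show ?thesis by (rule notboth[OF T_quot[OF N(1) X]])
      qed
      then show "X \<in> U" using X sub unfolding U_def by blast
    qed
    moreover have "B \<notin> U"
    proof
      assume BU: "B \<in> U"
      obtain Z where "S Z B B" using ex_zero_sub BOb by blast
      moreover obtain Z' where "S B B Z'" using ex_zero_quot BOb by blast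
      ultimately have "d B = 0" using BU unfolding U_def P_def by blast
      then show False using B by simp
    qed
    moreover have "U \<subseteq> T'" unfolding U_def by blast
    ultimately have "U = T" using cover[of U] B(1) by blast
    moreover have "E \<notin> T" using T_not_F[OF E(3)] E(2) by blast
    ultimately have "E \<notin> U" by simp
    then obtain K N where N: "S K E N" "P N" "d N \<noteq> 0" using E unfolding U_def by blast
    then obtain C where C: "S N B C" unfolding P_def by blast
    have "d B \<le> d N" by (rule Bmin[OF T'_quot[OF N(1) E(1)] F_sub[OF C B(2)] N(3)])
    then have "d C = 0" using d_add[OF C] by simp
    then have "N \<asymp> B" by (rule zero_quot[OF C])
    then have "S K E B" using S_iso[OF N(1) iso_refl iso_refl] S_Ob[OF N(1)] by blast
    then show ?thesis by blast
  qed
  have into: "\<exists>C. S B E C" if E: "E \<in> T'" "E \<in> F" "d E \<noteq> 0" for E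
  proof -
    \<comment> \<open>\<open>P\<close> holds for the torsion-free objects that receive no nonzero
      morphism from \<open>B\<close>. Both \<open>T\<close> and \<open>B\<close> are orthogonal to
      them, so \<open>U\<close> is all of \<open>T'\<close> and \<open>E\<close> is not among them.
      The image of \<open>B\<close> in \<open>E\<close> is torsion-free, so by \<open>quotB\<close>
      the kernel is zero.\<close>
    define P where "P N \<longleftrightarrow> N \<in> F \<and> (\<forall>J I K. S J B I \<and> S I N K \<longrightarrow> d I = 0)" for N
    define U where "U = {X \<in> T'. \<forall>K N. S K X N \<and> P N \<longrightarrow> d N = 0}"
    have "torsion U" unfolding U_def
    proof (rule torsion_perp[OF T'])
      show "P L" if "S L M N" "P M" for L M N
      proof -
        have "d I = 0" if I: "S J B I" "S I L K" for J I K
        proof -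
          obtain Z where "S I M Z" using comp_sub[OF \<open>S L M N\<close> I(2)] by blast
          then show ?thesis using \<open>P M\<close> I(1) unfolding P_def by blast
        qed
        moreover have "L \<in> F" using F_sub[OF that(1)] that(2) unfolding P_def by blast
        ultimately show ?thesis unfolding P_def by blast
      qed
    qed
    moreover have "T \<subseteq> U"
    proof
      fix X assume X: "X \<in> T"
      have "d N = 0" if "S K X N" "P N" for K N
        using that(2) notboth[OF T_quot[OF that(1) X]] unfolding P_def by simp
      then show "X \<in> U" using X sub unfolding U_def by blast
    qed
    moreover have "B \<in> U" unfolding U_def
    proof (intro CollectI conjI allI impI)
      show "B \<in> T'" by (rule B)
      fix K N assume N: "S K B N \<and> P N"
      obtain Z where "S N N Z" using ex_zero_quot N S_Ob by blast
      then show "d N = 0" using N unfolding P_def by blast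
    qed
    moreover have "U \<subseteq> T'" unfolding U_def by blast
    ultimately have "U = T'" using cover[of U] BT by blast
    then have EU: "E \<in> U" using E by simp
    obtain Z where "S Z E E" using ex_zero_sub E T'Ob by blast
    then have "\<not> P E" using EU E(3) unfolding U_def by auto
    then obtain I J K where I: "S J B I" "S I E K" "d I \<noteq> 0" using E unfolding P_def by blast
    have "I \<in> F" by (rule F_sub[OF I(2) E(2)])
    then have "I \<notin> T" using T_not_F[OF I(3)] by blast
    then have "d J = 0" using quotB[OF I(1)] by blast
    then have "I \<asymp> B" using zero_sub[OF I(1)] iso_sym by blast
    then have "S B E K" using S_iso[OF I(2) _ iso_refl iso_refl] S_Ob[OF I(2)] by blast
    then show ?thesis by blast
  qed
  have simple: "d N = 0" if SN: "S B M N" "M \<in> F" "N \<in> T" for M N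
  proof -
    have MT': "M \<in> T'" using T'_ext[OF SN(1) B(1)] SN(3) sub by blast
    have "d M \<noteq> 0" using d_add[OF SN(1)] B by simp
    \<comment> \<open>\<open>M\<close> lies in \<open>T'\<close> and is torsion-free, so it maps
      onto \<open>B\<close> with some kernel \<open>K\<close>. If \<open>B\<close> meets
      \<open>K\<close>, then by \<open>quotB\<close> it lies inside \<open>K\<close>, and
      \<open>N\<close> has \<open>B\<close> as a quotient, which is impossible. Otherwise
      \<open>B\<close> maps isomorphically, so \<open>N\<close> and \<open>K\<close> are isomorphic
      and \<open>K\<close> is both torsion and torsion-free.\<close>
    then obtain K where K: "S K M B" using onto MT' SN by blast
    obtain D P P' R where *: "S D B P" "S D K P'" "S P B R" "S P' N R"
      using two_subs[OF SN(1) K] by blast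
    show ?thesis
    proof (cases "d D = 0")
      case False
      have "d P = 0" by (rule notboth[OF quotB[OF *(1) False] F_sub[OF *(3) B(2)]])
      then have "R \<asymp> B" using iso_sym[OF zero_sub[OF *(3)]] by blast
      moreover have "R \<in> T" by (rule T_quot[OF *(4) SN(3)])
      ultimately show ?thesis using T_iso BT by blast
    next
      case True
      then have dR: "d R = 0" using d_add[OF *(1)] d_add[OF *(3)] by simp
      then have "N \<asymp> P'" using zero_quot[OF *(4)] iso_sym by blast
      then have "P' \<in> T" by (rule T_iso[OF SN(3)])
      moreover have "P' \<asymp> K" using iso_sym[OF zero_sub[OF *(2) True]] .
      ultimately have "K \<in> T" by (rule T_iso)
      then have "d K = 0" by (rule notboth[OF _ F_sub[OF K SN(2)]])
      then show ?thesis using d_add[OF *(2)] d_add[OF *(4)] dR by simp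
    qed
  qed
  have mult: "\<exists>m\<ge>1. dv E = real m *\<^sub>R dv B" if E: "E \<in> T'" "E \<in> F" "d E \<noteq> 0" for E
    using E
  proof (induction "d E" arbitrary: E rule: less_induct)
    case less
    obtain C where C: "S B E C" using into[OF less.prems] by blast
    have CT': "C \<in> T'" by (rule T'_quot[OF C less.prems(1)])
    obtain X Y where XY: "S X C Y" "X \<in> T" "Y \<in> F" using decomp C S_Ob by blast
    \<comment> \<open>The preimage of the torsion part \<open>X\<close> of \<open>C\<close> is a
      torsion-free extension of \<open>X\<close> by \<open>B\<close>, and \<open>simple\<close>
      makes \<open>X\<close> vanish. So \<open>C\<close> is again in \<open>T'\<close> and
      torsion-free, and the induction continues.\<close>
    obtain Z where Z: "S B Z X" "S Z E Y" using preimage[OF C XY(1)] by blast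
    have "d X = 0" by (rule simple[OF Z(1) F_sub[OF Z(2) less.prems(2)] XY(2)])
    then have CF: "C \<in> F" by (rule F_of_zero_sub[OF XY(1,3)])
    have dE: "d E = d B + d C" "dv E = dv B + dv C" using d_add[OF C] dv_add[OF C] .
    show ?case
    proof (cases "d C = 0")
      case True
      then have "dv C = 0" using dv0 S_Ob[OF C] by blast
      then show ?thesis using dE by (intro exI[of _ 1]) simp
    next
      case False
      then obtain m where "m \<ge> 1" "dv C = real m *\<^sub>R dv B" using less.hyps[OF _ CT' CF] dE B by auto
      then show ?thesis using dE by (intro exI[of _ "Suc m"]) (simp add: algebra_simps)
    qed
  qed
  show ?thesis
  proof
    show "d L = 0 \<or> d N = 0" if "S L B N" "N \<in> free T" for L N
      using quotB[OF that(1)] notboth[of N] that(2) unfolding F_def by (cases "d L = 0") simp_all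
  qed (use B simple mult in \<open>auto simp: F_def\<close>)
qed

section \<open>Maximal chains and sign patterns on their bricks\<close>

definition max_chain :: "(nat \<Rightarrow> 'o set) \<Rightarrow> nat \<Rightarrow> bool" where
  "max_chain T r \<longleftrightarrow> (\<forall>i\<le>r. torsion (T i)) \<and> T 0 = {M \<in> Ob. d M = 0} \<and> T r = Ob \<and>
    (\<forall>i<r. T i \<subset> T (Suc i)) \<and>
    (\<forall>i<r. \<forall>U. torsion U \<and> T i \<subseteq> U \<and> U \<subseteq> T (Suc i) \<longrightarrow> U = T i \<or> U = T (Suc i))"

lemma max_chainD:
  assumes "max_chain T r"
  shows "i \<le> r \<Longrightarrow> torsion (T i)" "T 0 = {M \<in> Ob. d M = 0}" "T r = Ob" "i < r \<Longrightarrow> T i \<subset> T (Suc i)"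
    "i < r \<Longrightarrow> torsion U \<Longrightarrow> T i \<subseteq> U \<Longrightarrow> U \<subseteq> T (Suc i) \<Longrightarrow> U = T i \<or> U = T (Suc i)"
proof -
  note c = assms[unfolded max_chain_def]
  note c1 = c[THEN conjunct1] and c2 = c[THEN conjunct2, THEN conjunct1]
  note c3 = c[THEN conjunct2, THEN conjunct2, THEN conjunct1]
  note c4 = c[THEN conjunct2, THEN conjunct2, THEN conjunct2, THEN conjunct1]
  note c5 = c[THEN conjunct2, THEN conjunct2, THEN conjunct2, THEN conjunct2]
  show "i \<le> r \<Longrightarrow> torsion (T i)" using c1 by simp
  show "T 0 = {M \<in> Ob. d M = 0}" by (rule c2)
  show "T r = Ob" by (rule c3)
  show "i < r \<Longrightarrow> T i \<subset> T (Suc i)" using c4 by simp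
  show "i < r \<Longrightarrow> torsion U \<Longrightarrow> T i \<subseteq> U \<Longrightarrow> U \<subseteq> T (Suc i) \<Longrightarrow> U = T i \<or> U = T (Suc i)"
    by (rule c5[rule_format]) simp_all
qed

lemma chain_mono: assumes "max_chain T r" "i \<le> j" "j \<le> r" shows "T i \<subseteq> T j"
  using assms(2,3)
proof (induction j rule: dec_induct)
  case (step n)
  then have "T n \<subset> T (Suc n)" using max_chainD(4)[OF assms(1)] by simp
  then show ?case using step by auto
qed simp

text \<open>\<open>B (Suc i)\<close> belongs to the step from \<open>T i\<close> to
  \<open>T (Suc i)\<close>, so bricks are numbered from 1 and \<open>B 0\<close> has no
  meaning.\<close>

definition bricks :: "(nat \<Rightarrow> 'o set) \<Rightarrow> nat \<Rightarrow> (nat \<Rightarrow> 'o) \<Rightarrow> bool" where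
  "bricks T r B \<longleftrightarrow> (\<forall>i<r. B (Suc i) \<in> T (Suc i) \<and> B (Suc i) \<in> free (T i) \<and> d (B (Suc i)) \<noteq> 0 \<and>
     (\<forall>E \<in> T (Suc i) \<inter> free (T i). d E \<noteq> 0 \<longrightarrow> (\<exists>m\<ge>1. dv E = real m *\<^sub>R dv (B (Suc i)))))"

text \<open>Cutting \<open>E\<close> along \<open>T n\<close> leaves a torsion part that is still
  torsion-free for \<open>T k\<close>, and a quotient in \<open>T (Suc n)\<close> and
  \<open>free (T n)\<close> whose class is a multiple of that of a brick.\<close>

lemma brick_sign:
  assumes c: "max_chain T r" and B: "bricks T r B" and kl: "k \<le> l" "l \<le> r"
    and \<theta>: "\<And>j. k < j \<Longrightarrow> j \<le> l \<Longrightarrow> inner \<theta> (dv (B j)) > 0"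
    and E: "E \<in> T l" "E \<in> free (T k)" "d E \<noteq> 0"
  shows "inner \<theta> (dv E) > 0"
  using kl \<theta> E
proof (induction l arbitrary: E rule: dec_induct)
  case base
  interpret torsion_pair Ob S iso d "T k" "free (T k)"
    by (rule torsion_pair_free, rule max_chainD(1)[OF c]) (use kl in simp)
  show ?case using base.prems(3-5) TF[of E] by simp
next
  case (step n)
  have n: "n < r" using step by simp
  interpret n: torsion_pair Ob S iso d "T n" "free (T n)"
    by (rule torsion_pair_free, rule max_chainD(1)[OF c]) (use n in simp)
  interpret k: torsion_pair Ob S iso d "T k" "free (T k)"
    by (rule torsion_pair_free, rule max_chainD(1)[OF c]) (use kl in simp)
  have tn: "torsion (T (Suc n))" using max_chainD(1)[OF c] n by simp
  have EOb: "E \<in> Ob" using torsionD(1)[OF tn] step.prems by blast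
  obtain X Y where XY: "S X E Y" "X \<in> T n" "Y \<in> free (T n)" using n.decomp EOb by blast
  have X: "inner \<theta> (dv X) \<ge> 0 \<and> (d X \<noteq> 0 \<longrightarrow> inner \<theta> (dv X) > 0)"
  proof (cases "d X = 0")
    case True
    then show ?thesis using dv0 S_Ob[OF XY(1)] by simp
  next
    case False
    have "X \<in> free (T k)" by (rule k.F_sub[OF XY(1) step.prems(4)])
    then have "inner \<theta> (dv X) > 0" by (intro step.IH[OF _ _ XY(2) _ False]) (use step.prems(2) n in auto)
    then show ?thesis by simp
  qed
  have Y: "inner \<theta> (dv Y) \<ge> 0 \<and> (d Y \<noteq> 0 \<longrightarrow> inner \<theta> (dv Y) > 0)"
  proof (cases "d Y = 0")
    case True
    then show ?thesis using dv0 S_Ob[OF XY(1)] by simp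
  next
    case False
    have "Y \<in> T (Suc n)" by (rule torsionD(3)[OF tn XY(1) step.prems(3)])
    then obtain m where m: "m \<ge> 1" "dv Y = real m *\<^sub>R dv (B (Suc n))"
      using B XY False n unfolding bricks_def by blast
    moreover have "inner \<theta> (dv (B (Suc n))) > 0" using step.prems(2) step.hyps by simp
    ultimately show ?thesis by simp
  qed
  have "d X \<noteq> 0 \<or> d Y \<noteq> 0" using d_add[OF XY(1)] step.prems by simp
  then show ?case using X Y dv_add[OF XY(1)] by (auto simp: inner_add_right)
qed

lemma sign_T:
  assumes c: "max_chain T r" and B: "bricks T r B" and k: "k \<le> r"
    and \<theta>: "\<And>j. 0 < j \<Longrightarrow> j \<le> k \<Longrightarrow> inner \<theta> (dv (B j)) > 0" and X: "X \<in> T k" "d X \<noteq> 0"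
  shows "inner \<theta> (dv X) > 0"
proof (rule brick_sign[OF c B _ k \<theta> X(1) _ X(2)])
  have "X \<in> Ob" using X torsionD(1)[OF max_chainD(1)[OF c k]] by blast
  then show "X \<in> free (T 0)" unfolding free_def max_chainD(2)[OF c] by simp
qed auto

lemma sign_F:
  assumes c: "max_chain T r" and B: "bricks T r B" and k: "k \<le> r"
    and \<theta>: "\<And>j. k < j \<Longrightarrow> j \<le> r \<Longrightarrow> inner \<theta> (dv (B j)) < 0" and Y: "Y \<in> free (T k)" "d Y \<noteq> 0"
  shows "inner \<theta> (dv Y) < 0"
proof -
  have "Y \<in> T r" using Y(1) unfolding max_chainD(3)[OF c] free_def by simp
  then have "inner (- \<theta>) (dv Y) > 0"
    by (intro brick_sign[OF c B k order_refl _ _ Y]) (use \<theta> in simp_all)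
  then show ?thesis by simp
qed

text \<open>The induction runs over integer-valued additive functions, since integrality gives a
  uniform gap of 1 between zero and negative values; \<open>linear\<close> converts them to vectors
  where \<open>brick_sign\<close> needs one and again at the end.\<close>

lemma ex_bricks_chambers:
  assumes c: "max_chain T r"
  obtains B \<theta> where "bricks T r B"
    "\<And>k j. k \<le> r \<Longrightarrow> 0 < j \<Longrightarrow> j \<le> k \<Longrightarrow> inner (\<theta> k) (dv (B j)) > 0"
    "\<And>k j. k \<le> r \<Longrightarrow> k < j \<Longrightarrow> j \<le> r \<Longrightarrow> inner (\<theta> k) (dv (B j)) < 0"
proof -
  have tors: "torsion (T i)" if "i \<le> r" for i by (rule max_chainD(1)[OF c that])
  have "\<exists>B. i < r \<longrightarrow> B \<in> T (Suc i) \<and> B \<in> free (T i) \<and> d B \<noteq> 0 \<and>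
     (\<forall>E \<in> T (Suc i) \<inter> free (T i). d E \<noteq> 0 \<longrightarrow> (\<exists>m\<ge>1. dv E = real m *\<^sub>R dv B)) \<and>
     (\<forall>M N. S B M N \<and> M \<in> free (T i) \<and> N \<in> T i \<longrightarrow> d N = 0) \<and>
     (\<forall>L N. S L B N \<and> N \<in> free (T i) \<longrightarrow> d L = 0 \<or> d N = 0)" for i
  proof (cases "i < r")
    case True
    show ?thesis
    proof (rule ex_brick[of "T i" "T (Suc i)"])
      show "torsion (T i)" "torsion (T (Suc i))" using tors True by simp_all
      show "T i \<subset> T (Suc i)" by (rule max_chainD(4)[OF c True])
      show "U = T i \<or> U = T (Suc i)" if "torsion U" "T i \<subseteq> U" "U \<subseteq> T (Suc i)" for U
        by (rule max_chainD(5)[OF c True that])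
      fix B assume a: "B \<in> T (Suc i)" "B \<in> free (T i)" "d B \<noteq> 0"
        "\<And>M N. S B M N \<Longrightarrow> M \<in> free (T i) \<Longrightarrow> N \<in> T i \<Longrightarrow> d N = 0"
        "\<And>L N. S L B N \<Longrightarrow> N \<in> free (T i) \<Longrightarrow> d L = 0 \<or> d N = 0"
        "\<And>E. E \<in> T (Suc i) \<Longrightarrow> E \<in> free (T i) \<Longrightarrow> d E \<noteq> 0 \<Longrightarrow> \<exists>m\<ge>1. dv E = real m *\<^sub>R dv B"
      show ?thesis
        by (intro exI[of _ B] impI conjI allI ballI; (elim conjE IntE)?; (rule a; assumption)?)
    qed
  qed blast
  then obtain B' where B': "\<And>i. i < r \<Longrightarrow> B' i \<in> T (Suc i) \<and> B' i \<in> free (T i) \<and> d (B' i) \<noteq> 0 \<and>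
     (\<forall>E \<in> T (Suc i) \<inter> free (T i). d E \<noteq> 0 \<longrightarrow> (\<exists>m\<ge>1. dv E = real m *\<^sub>R dv (B' i))) \<and>
     (\<forall>M N. S (B' i) M N \<and> M \<in> free (T i) \<and> N \<in> T i \<longrightarrow> d N = 0) \<and>
     (\<forall>L N. S L (B' i) N \<and> N \<in> free (T i) \<longrightarrow> d L = 0 \<or> d N = 0)"
    by metis
  define B where "B j = B' (j - 1)" for j
  have B: "bricks T r B" using B' unfolding bricks_def B_def by simp
  have BOb: "B j \<in> Ob" "B j \<in> T j" "B j \<in> free (T (j - 1))" "d (B j) \<noteq> 0" if "0 < j" "j \<le> r" for j
    using B'[of "j - 1"] that torsionD(1)[OF tors[OF that(2)]] unfolding B_def by auto
  have ch: "\<exists>w::'o \<Rightarrow> int. (\<forall>L M N. S L M N \<longrightarrow> w M = w L + w N) \<and>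
     (\<forall>j. 0 < j \<and> j \<le> k \<longrightarrow> w (B j) > 0) \<and> (\<forall>j. k < j \<and> j \<le> r \<longrightarrow> w (B j) < 0)" if "k \<le> r" for k
    using that
  proof (induction k)
    \<comment> \<open>\<open>T 0\<close> has only zero objects, so all bricks must be negative, and
      minus the dimension achieves this.\<close>
    case 0
    show ?case
      by (intro exI[of _ "\<lambda>M. - int (d M)"]) (use d_add BOb(4) in auto)
  next
    case (Suc k)
    then obtain w :: "'o \<Rightarrow> int" where w: "\<And>L M N. S L M N \<Longrightarrow> w M = w L + w N"
      "\<And>j. 0 < j \<Longrightarrow> j \<le> k \<Longrightarrow> w (B j) > 0" "\<And>j. k < j \<Longrightarrow> j \<le> r \<Longrightarrow> w (B j) < 0" by force
    obtain \<theta> where \<theta>: "\<And>M. M \<in> Ob \<Longrightarrow> real_of_int (w M) = inner \<theta> (dv M)" using linear[of w, OF w(1)] by blast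
    have k: "k < r" using Suc by simp
    have s1: "inner \<theta> (dv (B j)) > 0" if "0 < j" "j \<le> k" for j
      using w(2)[OF that] \<theta>[OF BOb(1)] that k by (metis le_trans less_imp_le of_int_0_less_iff)
    have s2: "inner \<theta> (dv (B j)) < 0" if "k < j" "j \<le> r" for j
      using w(3)[OF that] \<theta>[OF BOb(1)] that by (metis less_nat_zero_code neq0_conv of_int_less_0_iff)
    interpret torsion_pair Ob S iso d "T k" "free (T k)"
      by (rule torsion_pair_free) (use tors k in auto)
    interpret finite_heart Ob S iso d "T k" "free (T k)" w
    proof
      show "w M = w L + w N" if "S L M N" for L M N by (rule w(1)[OF that])
      show "0 < w M" if "M \<in> T k" "d M \<noteq> 0" for M
      proof -
        have "inner \<theta> (dv M) > 0"
          by (rule sign_T[OF c B _ s1 that]) (use k in auto)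
        then show ?thesis using \<theta>[of M] T_Ob that by fastforce
      qed
      show "w M < 0" if "M \<in> free (T k)" "d M \<noteq> 0" for M
      proof -
        have "inner \<theta> (dv M) < 0"
          by (rule sign_F[OF c B _ s2 that]) (use k in auto)
        then show ?thesis using \<theta>[of M] F_Ob that by fastforce
      qed
    qed
    have Bk: "B (Suc k) = B' k" unfolding B_def by simp
    note TS = tors[of "Suc k"]
    obtain \<psi> :: "'o \<Rightarrow> int" where \<psi>: "\<And>L M N. S L M N \<Longrightarrow> \<psi> M = \<psi> L + \<psi> N" "\<psi> (B' k) = 0"
      "\<And>X. X \<in> T k \<Longrightarrow> d X \<noteq> 0 \<Longrightarrow> \<psi> X > 0" "\<And>Y. Y \<in> free (T k) \<Longrightarrow> \<psi> Y \<le> 0"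
      "\<And>Y. Y \<in> free (T k) \<Longrightarrow> d Y \<noteq> 0 \<Longrightarrow> \<psi> Y = 0 \<Longrightarrow> Y \<in> T (Suc k)"
    proof (rule ex_facet_functional[of "B' k" "T (Suc k)"])
      show "B' k \<in> free (T k)" "d (B' k) \<noteq> 0" "B' k \<in> T (Suc k)" using B'[OF k] by blast+
      show "\<And>M N. S (B' k) M N \<Longrightarrow> M \<in> free (T k) \<Longrightarrow> N \<in> T k \<Longrightarrow> d N = 0" using B'[OF k] by metis
      show "\<And>L N. S L (B' k) N \<Longrightarrow> N \<in> free (T k) \<Longrightarrow> d L = 0 \<or> d N = 0" using B'[OF k] by metis
      show "\<And>L M N. S L M N \<Longrightarrow> L \<in> T (Suc k) \<Longrightarrow> N \<in> T (Suc k) \<Longrightarrow> M \<in> T (Suc k)"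
        using torsionD(4)[OF TS] k by auto
      show "\<And>M N. M \<in> T (Suc k) \<Longrightarrow> iso M N \<Longrightarrow> N \<in> T (Suc k)"
        using torsion_pair.T_iso[OF torsion_pair_free[OF TS]] k by auto
    qed blast
    \<comment> \<open>Larger than the dimension of every brick, so that the summand \<open>d\<close>
      in \<open>w'\<close> decides the sign only where \<open>\<psi>\<close> vanishes.\<close>
    define n where "n = 1 + (\<Sum>j\<le>r. int (d (B j)))"
    have n: "int (d (B j)) < n" if "j \<le> r" for j
      using member_le_sum[of j "{..r}" "\<lambda>j. int (d (B j))"] that unfolding n_def by simp
    have n0: "n > 0" unfolding n_def by (simp add: add_pos_nonneg sum_nonneg)
    define w' where "w' M = n * \<psi> M + int (d M)" for M
    have "w' M = w' L + w' N" if "S L M N" for L M N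
      using \<psi>(1)[OF that] d_add[OF that] by (simp add: w'_def algebra_simps)
    moreover have "w' (B j) > 0" if j: "0 < j" "j \<le> Suc k" for j
    proof (cases "j = Suc k")
      case True
      then show ?thesis using \<psi>(2) B'[OF k] Bk by (simp add: w'_def)
    next
      case False
      then have "B j \<in> T k" using BOb(2)[of j] chain_mono[OF c, of j k] j k by auto
      then have "\<psi> (B j) > 0" using \<psi>(3) BOb(4)[of j] j k by auto
      then show ?thesis using n0 by (simp add: w'_def add_pos_nonneg)
    qed
    moreover have "w' (B j) < 0" if j: "Suc k < j" "j \<le> r" for j
    proof -
      have Bj: "B j \<in> free (T (j - 1))" "d (B j) \<noteq> 0" using BOb[of j] j by auto
      have jk: "k \<le> j - 1" "Suc k \<le> j - 1" "j - 1 \<le> r" using j by linarith+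
      have "B j \<in> free (T k)" using Bj(1) free_antimono[OF chain_mono[OF c jk(1,3)]] by blast
      \<comment> \<open>\<open>B j\<close> is torsion-free for \<open>T (j - 1)\<close>, which
        contains \<open>T (Suc k)\<close>, and it is nonzero. Hence \<open>\<psi>\<close> cannot
        vanish on it, and being an integer is at most \<open>-1\<close>.\<close>
      moreover have "B j \<notin> T (Suc k)"
      proof
        assume "B j \<in> T (Suc k)"
        then have "B j \<in> T (j - 1)" using chain_mono[OF c jk(2,3)] by blast
        moreover have "torsion (T (j - 1))" using tors j by simp
        ultimately show False using torsion_pair.TF[OF torsion_pair_free, of "T (j - 1)" "B j"] Bj by simp
      qed
      ultimately have "\<psi> (B j) \<le> -1" using \<psi>(4)[of "B j"] \<psi>(5)[of "B j"] Bj by linarith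
      then have "n * \<psi> (B j) \<le> n * (-1)" using n0 by (intro mult_left_mono) auto
      then show ?thesis using n[OF j(2)] by (simp add: w'_def)
    qed
    ultimately show ?case by (intro exI[of _ w'] conjI allI impI) simp_all
  qed
  have "\<exists>\<theta>. k \<le> r \<longrightarrow> (\<forall>j. 0 < j \<and> j \<le> k \<longrightarrow> inner \<theta> (dv (B j)) > 0) \<and>
     (\<forall>j. k < j \<and> j \<le> r \<longrightarrow> inner \<theta> (dv (B j)) < 0)" for k
  proof (cases "k \<le> r")
    case True
    then obtain w :: "'o \<Rightarrow> int" where w: "\<And>L M N. S L M N \<Longrightarrow> w M = w L + w N"
      "\<And>j. 0 < j \<Longrightarrow> j \<le> k \<Longrightarrow> w (B j) > 0" "\<And>j. k < j \<Longrightarrow> j \<le> r \<Longrightarrow> w (B j) < 0"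
      using ch[OF True] by force
    obtain \<theta> where \<theta>: "\<And>M. M \<in> Ob \<Longrightarrow> real_of_int (w M) = inner \<theta> (dv M)" using linear[of w, OF w(1)] by blast
    have "inner \<theta> (dv (B j)) > 0" if "0 < j" "j \<le> k" for j
      using w(2)[OF that] \<theta>[OF BOb(1)[of j]] that True by auto
    moreover have "inner \<theta> (dv (B j)) < 0" if "k < j" "j \<le> r" for j
      using w(3)[OF that] \<theta>[OF BOb(1)[of j]] that by auto
    ultimately show ?thesis by (intro exI[of _ \<theta>]) simp
  qed simp
  then obtain \<theta> where \<theta>: "\<And>k. k \<le> r \<longrightarrow> (\<forall>j. 0 < j \<and> j \<le> k \<longrightarrow> inner (\<theta> k) (dv (B j)) > 0) \<and>
     (\<forall>j. k < j \<and> j \<le> r \<longrightarrow> inner (\<theta> k) (dv (B j)) < 0)"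
    using choice[of "\<lambda>k \<theta>. k \<le> r \<longrightarrow> (\<forall>j. 0 < j \<and> j \<le> k \<longrightarrow> inner \<theta> (dv (B j)) > 0) \<and>
     (\<forall>j. k < j \<and> j \<le> r \<longrightarrow> inner \<theta> (dv (B j)) < 0)"] by blast
  show ?thesis by (rule that[OF B, of \<theta>]) (use \<theta> in simp_all)
qed

end

subsection \<open>Short exact sequences of left modules\<close>

abbreviation rhom :: "'r ring \<Rightarrow> ('r, 'm) module \<Rightarrow> ('r, 'n) module \<Rightarrow> ('m \<Rightarrow> 'n) set" where
  "rhom \<equiv> LinearCombinations.module_hom"

section \<open>Arithmetic in left modules and submodules\<close>

context left_module begin

lemma smult_zero: assumes "x \<in> carrier M" shows "\<zero>\<^bsub>R\<^esub> \<odot>\<^bsub>M\<^esub> x = \<zero>\<^bsub>M\<^esub>"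
proof -
  have "\<zero>\<^bsub>R\<^esub> \<odot>\<^bsub>M\<^esub> x \<oplus>\<^bsub>M\<^esub> \<zero>\<^bsub>R\<^esub> \<odot>\<^bsub>M\<^esub> x = \<zero>\<^bsub>R\<^esub> \<odot>\<^bsub>M\<^esub> x"
    using lsmult_l_distr[of "\<zero>\<^bsub>R\<^esub>" "\<zero>\<^bsub>R\<^esub>" x] assms by simp
  then show ?thesis using M.add.l_cancel_one[of "\<zero>\<^bsub>R\<^esub> \<odot>\<^bsub>M\<^esub> x" "\<zero>\<^bsub>R\<^esub> \<odot>\<^bsub>M\<^esub> x"] assms lsmult_closed by simp
qed

lemma zero_smult: assumes "a \<in> carrier R" shows "a \<odot>\<^bsub>M\<^esub> \<zero>\<^bsub>M\<^esub> = \<zero>\<^bsub>M\<^esub>"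
proof -
  have "a \<odot>\<^bsub>M\<^esub> \<zero>\<^bsub>M\<^esub> \<oplus>\<^bsub>M\<^esub> a \<odot>\<^bsub>M\<^esub> \<zero>\<^bsub>M\<^esub> = a \<odot>\<^bsub>M\<^esub> \<zero>\<^bsub>M\<^esub>"
    using lsmult_r_distr[of a "\<zero>\<^bsub>M\<^esub>" "\<zero>\<^bsub>M\<^esub>"] assms by simp
  then show ?thesis using M.add.l_cancel_one[of "a \<odot>\<^bsub>M\<^esub> \<zero>\<^bsub>M\<^esub>" "a \<odot>\<^bsub>M\<^esub> \<zero>\<^bsub>M\<^esub>"] assms lsmult_closed by simp
qed

lemma minus_smult: assumes "x \<in> carrier M" shows "(\<ominus>\<^bsub>R\<^esub> \<one>\<^bsub>R\<^esub>) \<odot>\<^bsub>M\<^esub> x = \<ominus>\<^bsub>M\<^esub> x"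
proof -
  have "(\<ominus>\<^bsub>R\<^esub> \<one>\<^bsub>R\<^esub>) \<odot>\<^bsub>M\<^esub> x \<oplus>\<^bsub>M\<^esub> x = \<zero>\<^bsub>M\<^esub>"
    using lsmult_l_distr[of "\<ominus>\<^bsub>R\<^esub> \<one>\<^bsub>R\<^esub>" "\<one>\<^bsub>R\<^esub>" x] assms smult_zero lsmult_one R.l_neg by simp
  then show ?thesis using M.minus_equality assms lsmult_closed by (metis R.a_inv_closed R.one_closed)
qed

lemma smult_minus: assumes "x \<in> carrier M" "a \<in> carrier R" shows "a \<odot>\<^bsub>M\<^esub> (\<ominus>\<^bsub>M\<^esub> x) = \<ominus>\<^bsub>M\<^esub> (a \<odot>\<^bsub>M\<^esub> x)"
proof -
  have "a \<odot>\<^bsub>M\<^esub> (\<ominus>\<^bsub>M\<^esub> x) \<oplus>\<^bsub>M\<^esub> a \<odot>\<^bsub>M\<^esub> x = \<zero>\<^bsub>M\<^esub>"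
    using lsmult_r_distr[of a "\<ominus>\<^bsub>M\<^esub> x" x] assms zero_smult M.l_neg by simp
  then show ?thesis using M.minus_equality assms lsmult_closed by (metis M.a_inv_closed)
qed

end

lemma (in abelian_group) minus_eq_zero:
  assumes "x \<in> carrier G" "y \<in> carrier G" "x \<ominus> y = \<zero>" shows "x = y"
  using assms minus_equality[of x "\<ominus> y"] minus_minus[of y] by (simp add: a_minus_def)

lemma left_moduleI:
  assumes "ring R" and "\<zero>\<^bsub>M\<^esub> \<in> carrier M"
    and "\<And>x y. x \<in> carrier M \<Longrightarrow> y \<in> carrier M \<Longrightarrow> x \<oplus>\<^bsub>M\<^esub> y \<in> carrier M"
    and "\<And>x y z. x \<in> carrier M \<Longrightarrow> y \<in> carrier M \<Longrightarrow> z \<in> carrier M \<Longrightarrow> (x \<oplus>\<^bsub>M\<^esub> y) \<oplus>\<^bsub>M\<^esub> z = x \<oplus>\<^bsub>M\<^esub> (y \<oplus>\<^bsub>M\<^esub> z)"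
    and "\<And>x y. x \<in> carrier M \<Longrightarrow> y \<in> carrier M \<Longrightarrow> x \<oplus>\<^bsub>M\<^esub> y = y \<oplus>\<^bsub>M\<^esub> x"
    and "\<And>x. x \<in> carrier M \<Longrightarrow> \<zero>\<^bsub>M\<^esub> \<oplus>\<^bsub>M\<^esub> x = x"
    and inv: "\<And>x. x \<in> carrier M \<Longrightarrow> \<exists>y\<in>carrier M. y \<oplus>\<^bsub>M\<^esub> x = \<zero>\<^bsub>M\<^esub>"
    and s: "\<And>a x. a \<in> carrier R \<Longrightarrow> x \<in> carrier M \<Longrightarrow> a \<odot>\<^bsub>M\<^esub> x \<in> carrier M"
    "\<And>a b x. a \<in> carrier R \<Longrightarrow> b \<in> carrier R \<Longrightarrow> x \<in> carrier M \<Longrightarrow>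
      (a \<oplus>\<^bsub>R\<^esub> b) \<odot>\<^bsub>M\<^esub> x = a \<odot>\<^bsub>M\<^esub> x \<oplus>\<^bsub>M\<^esub> b \<odot>\<^bsub>M\<^esub> x"
    "\<And>a x y. a \<in> carrier R \<Longrightarrow> x \<in> carrier M \<Longrightarrow> y \<in> carrier M \<Longrightarrow>
      a \<odot>\<^bsub>M\<^esub> (x \<oplus>\<^bsub>M\<^esub> y) = a \<odot>\<^bsub>M\<^esub> x \<oplus>\<^bsub>M\<^esub> a \<odot>\<^bsub>M\<^esub> y"
    "\<And>a b x. a \<in> carrier R \<Longrightarrow> b \<in> carrier R \<Longrightarrow> x \<in> carrier M \<Longrightarrow>
      (a \<otimes>\<^bsub>R\<^esub> b) \<odot>\<^bsub>M\<^esub> x = a \<odot>\<^bsub>M\<^esub> (b \<odot>\<^bsub>M\<^esub> x)"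
    "\<And>x. x \<in> carrier M \<Longrightarrow> \<one>\<^bsub>R\<^esub> \<odot>\<^bsub>M\<^esub> x = x"
  shows "left_module R M"
proof (intro left_module.intro left_module_axioms.intro)
  show "abelian_group M"
    by (rule abelian_groupI) (use assms in auto)
qed (use assms in auto)

text \<open>No condition on negatives is needed on the right-hand side, as \<open>- x\<close> is the
  product of \<open>-1\<close> and \<open>x\<close>.\<close>

lemma left_submodule_iff:
  assumes "left_module R M"
  shows "left_submodule R L M \<longleftrightarrow> L \<subseteq> carrier M \<and> \<zero>\<^bsub>M\<^esub> \<in> L \<and>
    (\<forall>x\<in>L. \<forall>y\<in>L. x \<oplus>\<^bsub>M\<^esub> y \<in> L) \<and> (\<forall>a\<in>carrier R. \<forall>x\<in>L. a \<odot>\<^bsub>M\<^esub> x \<in> L)" (is "_ \<longleftrightarrow> ?rhs")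
proof -
  interpret M: left_module R M by fact
  show ?thesis
  proof
    assume L: "left_submodule R L M"
    then have LM: "L \<subseteq> carrier M" by (simp add: left_submodule_def)
    from L interpret L: left_module R "M\<lparr>carrier := L\<rparr>" by (simp add: left_submodule_def)
    show ?rhs using LM L.M.zero_closed L.M.add.m_closed L.lsmult_closed by auto
  next
    assume L: ?rhs
    then have LM: "\<And>x. x \<in> L \<Longrightarrow> x \<in> carrier M" by blast
    have "left_module R (M\<lparr>carrier := L\<rparr>)"
    proof (rule left_moduleI)
      show "ring R" by (rule M.R.ring_axioms)
      fix x assume "x \<in> carrier (M\<lparr>carrier := L\<rparr>)"
      then have x: "x \<in> L" by simp
      have "(\<ominus>\<^bsub>R\<^esub> \<one>\<^bsub>R\<^esub>) \<odot>\<^bsub>M\<^esub> x \<in> L" using L x by auto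
      then have "\<ominus>\<^bsub>M\<^esub> x \<in> L" using M.minus_smult[OF LM[OF x]] by simp
      then show "\<exists>y\<in>carrier (M\<lparr>carrier := L\<rparr>). y \<oplus>\<^bsub>M\<lparr>carrier := L\<rparr>\<^esub> x = \<zero>\<^bsub>M\<lparr>carrier := L\<rparr>\<^esub>"
        using M.M.l_neg[OF LM[OF x]] by auto
    qed (use L LM in \<open>auto simp: M.M.a_ac M.M.l_zero M.lsmult_l_distr M.lsmult_r_distr M.lsmult_assoc M.lsmult_one\<close>)
    then show "left_submodule R L M" using L by (simp add: left_submodule_def)
  qed
qed

lemma left_submoduleD:
  assumes "left_module R M" "left_submodule R L M"
  shows "L \<subseteq> carrier M" "\<zero>\<^bsub>M\<^esub> \<in> L" "x \<in> L \<Longrightarrow> y \<in> L \<Longrightarrow> x \<oplus>\<^bsub>M\<^esub> y \<in> L" "a \<in> carrier R \<Longrightarrow> x \<in> L \<Longrightarrow> a \<odot>\<^bsub>M\<^esub> x \<in> L"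
    "x \<in> L \<Longrightarrow> \<ominus>\<^bsub>M\<^esub> x \<in> L" "x \<in> L \<Longrightarrow> y \<in> L \<Longrightarrow> x \<ominus>\<^bsub>M\<^esub> y \<in> L" "left_module R (M\<lparr>carrier := L\<rparr>)"
proof -
  interpret M: left_module R M by fact
  note L = assms(2)[unfolded left_submodule_iff[OF assms(1)]]
  show "L \<subseteq> carrier M" "\<zero>\<^bsub>M\<^esub> \<in> L" "x \<in> L \<Longrightarrow> y \<in> L \<Longrightarrow> x \<oplus>\<^bsub>M\<^esub> y \<in> L" "a \<in> carrier R \<Longrightarrow> x \<in> L \<Longrightarrow> a \<odot>\<^bsub>M\<^esub> x \<in> L"
    using L by auto
  show neg: "x \<in> L \<Longrightarrow> \<ominus>\<^bsub>M\<^esub> x \<in> L" for x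
    using L M.minus_smult[of x] M.R.a_inv_closed[OF M.R.one_closed] by (metis subsetD)
  show "x \<in> L \<Longrightarrow> y \<in> L \<Longrightarrow> x \<ominus>\<^bsub>M\<^esub> y \<in> L" using L neg by (auto simp: a_minus_def)
  show "left_module R (M\<lparr>carrier := L\<rparr>)" using assms(2) by (simp add: left_submodule_def)
qed

section \<open>Homomorphisms of left modules\<close>

lemma rhomI:
  assumes "\<And>x. x \<in> carrier M \<Longrightarrow> f x \<in> carrier N"
    "\<And>x y. x \<in> carrier M \<Longrightarrow> y \<in> carrier M \<Longrightarrow> f (x \<oplus>\<^bsub>M\<^esub> y) = f x \<oplus>\<^bsub>N\<^esub> f y"
    "\<And>a x. a \<in> carrier R \<Longrightarrow> x \<in> carrier M \<Longrightarrow> f (a \<odot>\<^bsub>M\<^esub> x) = a \<odot>\<^bsub>N\<^esub> f x"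
  shows "f \<in> rhom R M N"
  using assms unfolding LinearCombinations.module_hom_def by auto

lemma rhomD:
  assumes "f \<in> rhom R M N"
  shows "x \<in> carrier M \<Longrightarrow> f x \<in> carrier N"
    "x \<in> carrier M \<Longrightarrow> y \<in> carrier M \<Longrightarrow> f (x \<oplus>\<^bsub>M\<^esub> y) = f x \<oplus>\<^bsub>N\<^esub> f y"
    "a \<in> carrier R \<Longrightarrow> x \<in> carrier M \<Longrightarrow> f (a \<odot>\<^bsub>M\<^esub> x) = a \<odot>\<^bsub>N\<^esub> f x"
  using assms unfolding LinearCombinations.module_hom_def by auto

lemma rhom_zero:
  assumes "f \<in> rhom R M N" "left_module R M" "left_module R N"
  shows "f \<zero>\<^bsub>M\<^esub> = \<zero>\<^bsub>N\<^esub>"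
proof -
  interpret M: left_module R M by fact
  interpret N: left_module R N by fact
  have "f \<zero>\<^bsub>M\<^esub> \<oplus>\<^bsub>N\<^esub> f \<zero>\<^bsub>M\<^esub> = f \<zero>\<^bsub>M\<^esub>"
    using rhomD(2)[OF assms(1), of "\<zero>\<^bsub>M\<^esub>" "\<zero>\<^bsub>M\<^esub>"] by simp
  then show ?thesis using N.M.add.l_cancel_one[of "f \<zero>\<^bsub>M\<^esub>" "f \<zero>\<^bsub>M\<^esub>"] rhomD(1)[OF assms(1)] by simp
qed

lemma rhom_neg:
  assumes "f \<in> rhom R M N" "left_module R M" "left_module R N" "x \<in> carrier M"
  shows "f (\<ominus>\<^bsub>M\<^esub> x) = \<ominus>\<^bsub>N\<^esub> f x"
proof -
  interpret M: left_module R M by fact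
  interpret N: left_module R N by fact
  show ?thesis using rhomD[OF assms(1)] M.minus_smult[of x] N.minus_smult[of "f x"] assms(4)
    by (metis M.R.a_inv_closed M.R.one_closed)
qed

lemma rhom_minus:
  assumes "f \<in> rhom R M N" "left_module R M" "left_module R N" "x \<in> carrier M" "y \<in> carrier M"
  shows "f (x \<ominus>\<^bsub>M\<^esub> y) = f x \<ominus>\<^bsub>N\<^esub> f y"
proof -
  interpret M: left_module R M by fact
  show ?thesis using rhomD(2)[OF assms(1)] rhom_neg[OF assms(1-3)] assms(4,5) by (simp add: a_minus_def)
qed

lemma rhom_inj_iff:
  assumes "f \<in> rhom R M N" "left_module R M" "left_module R N"
  shows "inj_on f (carrier M) \<longleftrightarrow> (\<forall>x\<in>carrier M. f x = \<zero>\<^bsub>N\<^esub> \<longrightarrow> x = \<zero>\<^bsub>M\<^esub>)"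
proof -
  interpret M: left_module R M by fact
  interpret N: left_module R N by fact
  show ?thesis
  proof
    assume "inj_on f (carrier M)"
    then show "\<forall>x\<in>carrier M. f x = \<zero>\<^bsub>N\<^esub> \<longrightarrow> x = \<zero>\<^bsub>M\<^esub>"
      using rhom_zero[OF assms] M.M.zero_closed by (metis inj_onD)
  next
    assume *: "\<forall>x\<in>carrier M. f x = \<zero>\<^bsub>N\<^esub> \<longrightarrow> x = \<zero>\<^bsub>M\<^esub>"
    show "inj_on f (carrier M)"
    proof (rule inj_onI)
      fix x y assume xy: "x \<in> carrier M" "y \<in> carrier M" "f x = f y"
      have "f (x \<ominus>\<^bsub>M\<^esub> y) = \<zero>\<^bsub>N\<^esub>"
        using rhom_minus[OF assms xy(1,2)] xy rhomD(1)[OF assms(1)] by (simp add: N.M.r_neg a_minus_def)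
      then have "x \<ominus>\<^bsub>M\<^esub> y = \<zero>\<^bsub>M\<^esub>" using * xy by simp
      then show "x = y" using xy M.M.minus_eq_zero by blast
    qed
  qed
qed

lemma rhom_comp: "f \<in> rhom R L M \<Longrightarrow> g \<in> rhom R M N \<Longrightarrow> (\<lambda>x. g (f x)) \<in> rhom R L N"
  by (rule rhomI) (auto simp: rhomD)

lemma rhom_sub_dom: "f \<in> rhom R M N \<Longrightarrow> L \<subseteq> carrier M \<Longrightarrow> f \<in> rhom R (M\<lparr>carrier := L\<rparr>) N"
  by (rule rhomI) (auto simp: rhomD subset_eq)

lemma rhom_sub_cod: "f \<in> rhom R M N \<Longrightarrow> f ` carrier M \<subseteq> L \<Longrightarrow> f \<in> rhom R M (N\<lparr>carrier := L\<rparr>)"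
  by (rule rhomI) (auto simp: rhomD image_subset_iff)

lemma rhom_id: "L \<subseteq> carrier M \<Longrightarrow> (\<lambda>x. x) \<in> rhom R (M\<lparr>carrier := L\<rparr>) M"
  by (rule rhomI) auto

lemma rhom_inv:
  assumes f: "f \<in> rhom R M N" "inj_on f (carrier M)" and L: "f ` carrier M = L" and M: "left_module R M"
  shows "inv_into (carrier M) f \<in> rhom R (N\<lparr>carrier := L\<rparr>) M"
proof (rule rhomI)
  interpret M: left_module R M by fact
  have i: "inv_into (carrier M) f (f x) = x" if "x \<in> carrier M" for x using f that by simp
  fix x assume "x \<in> carrier (N\<lparr>carrier := L\<rparr>)"
  then obtain x' where x: "x = f x'" "x' \<in> carrier M" using L by auto
  show "inv_into (carrier M) f x \<in> carrier M" using x i by simp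
  show "inv_into (carrier M) f (a \<odot>\<^bsub>N\<lparr>carrier := L\<rparr>\<^esub> x) = a \<odot>\<^bsub>M\<^esub> inv_into (carrier M) f x" if "a \<in> carrier R" for a
    using x i that rhomD(3)[OF f(1) that x(2)] i[OF M.lsmult_closed[OF that x(2)]] by simp
  fix y assume "y \<in> carrier (N\<lparr>carrier := L\<rparr>)"
  then obtain y' where y: "y = f y'" "y' \<in> carrier M" using L by auto
  show "inv_into (carrier M) f (x \<oplus>\<^bsub>N\<lparr>carrier := L\<rparr>\<^esub> y) = inv_into (carrier M) f x \<oplus>\<^bsub>M\<^esub> inv_into (carrier M) f y"
    using x y i rhomD(2)[OF f(1) x(2) y(2)] i[of "x' \<oplus>\<^bsub>M\<^esub> y'"] by simp
qed

lemma image_submodule: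
  assumes "f \<in> rhom R M N" "left_module R M" "left_module R N" "left_submodule R L M"
  shows "left_submodule R (f ` L) N"
proof -
  note L = left_submoduleD[OF assms(2,4)]
  note f = rhomD[OF assms(1)]
  show ?thesis unfolding left_submodule_iff[OF assms(3)]
  proof (intro conjI ballI)
    show "f ` L \<subseteq> carrier N" using f(1) L(1) by blast
    show "\<zero>\<^bsub>N\<^esub> \<in> f ` L" using rhom_zero[OF assms(1-3)] L(2) by (metis imageI)
    show "x \<oplus>\<^bsub>N\<^esub> y \<in> f ` L" if xy: "x \<in> f ` L" "y \<in> f ` L" for x y
    proof -
      obtain x' y' where "x = f x'" "y = f y'" "x' \<in> L" "y' \<in> L" using xy by blast
      then show ?thesis using f(2)[of x' y'] L(1,3) by (metis imageI subsetD)
    qed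
    show "a \<odot>\<^bsub>N\<^esub> x \<in> f ` L" if a: "a \<in> carrier R" and x: "x \<in> f ` L" for a x
    proof -
      obtain x' where "x = f x'" "x' \<in> L" using x by blast
      then show ?thesis using f(3)[OF a, of x'] L(1) L(4)[OF a] by (metis imageI subsetD)
    qed
  qed
qed

lemma whole_submodule: "left_module R M \<Longrightarrow> left_submodule R (carrier M) M"
  by (simp add: left_submodule_def)

lemma vimage_submodule:
  assumes "f \<in> rhom R M N" "left_module R M" "left_module R N" "left_submodule R L N"
  shows "left_submodule R {x \<in> carrier M. f x \<in> L} M"
proof -
  interpret M: left_module R M by fact
  note L = left_submoduleD[OF assms(3,4)]
  note f = rhomD[OF assms(1)]
  show ?thesis unfolding left_submodule_iff[OF assms(2)]
    using L(2,3,4) f rhom_zero[OF assms(1-3)] M.lsmult_closed by auto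
qed

lemma zero_submodule: assumes "left_module R M" shows "left_submodule R {\<zero>\<^bsub>M\<^esub>} M"
proof -
  interpret M: left_module R M by fact
  show ?thesis unfolding left_submodule_iff[OF assms] by (auto simp: M.zero_smult)
qed

lemma kernel_submodule:
  assumes "f \<in> rhom R M N" "left_module R M" "left_module R N"
  shows "left_submodule R {x \<in> carrier M. f x = \<zero>\<^bsub>N\<^esub>} M"
  using vimage_submodule[OF assms zero_submodule[OF assms(3)]] by simp

text \<open>The universal property of a quotient: define \<open>v\<close> by any choice of preimages
  under \<open>p\<close>; two choices differ by an element of the kernel of \<open>p\<close>, which
  \<open>g\<close> kills.\<close>

lemma rhom_factor:
  assumes p: "p \<in> rhom R M Z" "p ` carrier M = carrier Z" and g: "g \<in> rhom R M N"
    and k: "\<And>x. x \<in> carrier M \<Longrightarrow> p x = \<zero>\<^bsub>Z\<^esub> \<Longrightarrow> g x = \<zero>\<^bsub>N\<^esub>"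
    and m: "left_module R M" "left_module R Z" "left_module R N"
  obtains v where "v \<in> rhom R Z N" "\<And>x. x \<in> carrier M \<Longrightarrow> v (p x) = g x"
proof
  interpret M: left_module R M by fact
  interpret Z: left_module R Z by fact
  interpret N: left_module R N by fact
  define v where "v z = g (inv_into (carrier M) p z)" for z
  show v: "v (p x) = g x" if x: "x \<in> carrier M" for x
  proof -
    define y where "y = inv_into (carrier M) p (p x)"
    have y: "y \<in> carrier M" "p y = p x" unfolding y_def using x by (auto intro: inv_into_into f_inv_into_f)
    have "p (y \<ominus>\<^bsub>M\<^esub> x) = \<zero>\<^bsub>Z\<^esub>"
      using rhom_minus[OF p(1) m(1,2) y(1) x] y(2) rhomD(1)[OF p(1) x] by (simp add: Z.M.r_neg a_minus_def)
    then have "g (y \<ominus>\<^bsub>M\<^esub> x) = \<zero>\<^bsub>N\<^esub>" using k x y by simp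
    then have "g y \<ominus>\<^bsub>N\<^esub> g x = \<zero>\<^bsub>N\<^esub>" using rhom_minus[OF g m(1,3) y(1) x] by simp
    then show ?thesis using rhomD(1)[OF g] x y N.M.minus_eq_zero[of "g y" "g x"] by (simp add: v_def y_def)
  qed
  show "v \<in> rhom R Z N"
  proof (rule rhomI)
    fix x assume "x \<in> carrier Z"
    then obtain x' where x: "x = p x'" "x' \<in> carrier M" using p(2) by blast
    show "v x \<in> carrier N" using x v rhomD(1)[OF g] by simp
    show "v (a \<odot>\<^bsub>Z\<^esub> x) = a \<odot>\<^bsub>N\<^esub> v x" if "a \<in> carrier R" for a
      using x v[OF x(2)] v[OF M.lsmult_closed[OF that x(2)]] rhomD(3)[OF g that x(2)] rhomD(3)[OF p(1) that x(2)] by simp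
    fix y assume "y \<in> carrier Z"
    then obtain y' where y: "y = p y'" "y' \<in> carrier M" using p(2) by blast
    show "v (x \<oplus>\<^bsub>Z\<^esub> y) = v x \<oplus>\<^bsub>N\<^esub> v y"
      using x y v[of x'] v[of y'] v[of "x' \<oplus>\<^bsub>M\<^esub> y'"] rhomD(2)[OF g x(2) y(2)] rhomD(2)[OF p(1) x(2) y(2)] by simp
  qed
qed

text \<open>The quotient is carried by representatives, transported along an injection, so that it may live on
  any sufficiently large type.\<close>

lemma ex_quotient:
  fixes E :: "('r, 'e) module" and i :: "'e \<Rightarrow> 'm"
  assumes E: "left_module R E" and W: "left_submodule R W E" and i: "inj i"
  obtains Z :: "('r, 'm) module" and p where "left_module R Z" "p \<in> rhom R E Z" "p ` carrier E = carrier Z"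
    "\<And>x. x \<in> carrier E \<Longrightarrow> p x = \<zero>\<^bsub>Z\<^esub> \<longleftrightarrow> x \<in> W"
proof -
  interpret E: left_module R E by fact
  note W' = left_submoduleD[OF E W]
  have sub_sub: "(x \<ominus>\<^bsub>E\<^esub> z) \<ominus>\<^bsub>E\<^esub> (y \<ominus>\<^bsub>E\<^esub> z) = x \<ominus>\<^bsub>E\<^esub> y"
    if "x \<in> carrier E" "y \<in> carrier E" "z \<in> carrier E" for x y z
  proof -
    have "(x \<ominus>\<^bsub>E\<^esub> z) \<ominus>\<^bsub>E\<^esub> (y \<ominus>\<^bsub>E\<^esub> z) = x \<oplus>\<^bsub>E\<^esub> (\<ominus>\<^bsub>E\<^esub> z \<oplus>\<^bsub>E\<^esub> (z \<oplus>\<^bsub>E\<^esub> \<ominus>\<^bsub>E\<^esub> y))"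
      using that by (simp add: a_minus_def E.M.minus_add E.M.minus_minus E.M.a_assoc E.M.a_comm[of "\<ominus>\<^bsub>E\<^esub> y"])
    also have "\<ominus>\<^bsub>E\<^esub> z \<oplus>\<^bsub>E\<^esub> (z \<oplus>\<^bsub>E\<^esub> \<ominus>\<^bsub>E\<^esub> y) = \<ominus>\<^bsub>E\<^esub> y" using that by (simp add: E.M.r_neg1)
    finally show ?thesis by (simp add: a_minus_def)
  qed
  \<comment> \<open>The choice is made from a predicate that is the same for congruent elements, so
    congruent elements get equal, not merely congruent, representatives.\<close>
  define rep where "rep x = (SOME y. y \<in> carrier E \<and> x \<ominus>\<^bsub>E\<^esub> y \<in> W)" for x
  have rep: "rep x \<in> carrier E \<and> x \<ominus>\<^bsub>E\<^esub> rep x \<in> W" if "x \<in> carrier E" for x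
    unfolding rep_def by (rule someI[of _ x]) (use that W'(2) in \<open>simp add: E.M.r_neg a_minus_def\<close>)
  have rep_eq: "rep x = rep y \<longleftrightarrow> x \<ominus>\<^bsub>E\<^esub> y \<in> W" if x: "x \<in> carrier E" and y: "y \<in> carrier E" for x y
  proof
    assume e: "rep x = rep y"
    have "(x \<ominus>\<^bsub>E\<^esub> rep x) \<ominus>\<^bsub>E\<^esub> (y \<ominus>\<^bsub>E\<^esub> rep y) \<in> W" using rep x y W'(6) by blast
    moreover have "(x \<ominus>\<^bsub>E\<^esub> rep x) \<ominus>\<^bsub>E\<^esub> (y \<ominus>\<^bsub>E\<^esub> rep y) = x \<ominus>\<^bsub>E\<^esub> y"
      using rep[OF x] rep[OF y] x y e sub_sub[of x y "rep y"] by simp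
    ultimately show "x \<ominus>\<^bsub>E\<^esub> y \<in> W" by simp
  next
    assume w: "x \<ominus>\<^bsub>E\<^esub> y \<in> W"
    have "x \<ominus>\<^bsub>E\<^esub> z \<in> W \<longleftrightarrow> y \<ominus>\<^bsub>E\<^esub> z \<in> W" if z: "z \<in> carrier E" for z
    proof
      assume "x \<ominus>\<^bsub>E\<^esub> z \<in> W"
      then have "(x \<ominus>\<^bsub>E\<^esub> z) \<ominus>\<^bsub>E\<^esub> (x \<ominus>\<^bsub>E\<^esub> y) \<in> W" using w W'(6) by blast
      moreover have "(x \<ominus>\<^bsub>E\<^esub> z) \<ominus>\<^bsub>E\<^esub> (x \<ominus>\<^bsub>E\<^esub> y) = y \<ominus>\<^bsub>E\<^esub> z"
        using x y z sub_sub[of "\<ominus>\<^bsub>E\<^esub> z" "\<ominus>\<^bsub>E\<^esub> y" "\<ominus>\<^bsub>E\<^esub> x"]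
        by (simp add: a_minus_def E.M.minus_minus E.M.a_comm)
      ultimately show "y \<ominus>\<^bsub>E\<^esub> z \<in> W" by simp
    next
      assume "y \<ominus>\<^bsub>E\<^esub> z \<in> W"
      then have "(y \<ominus>\<^bsub>E\<^esub> z) \<oplus>\<^bsub>E\<^esub> (x \<ominus>\<^bsub>E\<^esub> y) \<in> W" using w W'(3) by blast
      moreover have "(y \<ominus>\<^bsub>E\<^esub> z) \<oplus>\<^bsub>E\<^esub> (x \<ominus>\<^bsub>E\<^esub> y) = x \<ominus>\<^bsub>E\<^esub> z"
        using x y z sub_sub[of x z y] by (simp add: a_minus_def E.M.minus_add E.M.minus_minus E.M.a_ac)
      ultimately show "x \<ominus>\<^bsub>E\<^esub> z \<in> W" by simp
    qed
    then show "rep x = rep y" unfolding rep_def by (metis (no_types, lifting))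
  qed
  define p where "p x = i (rep x)" for x
  have p_eq: "p x = p y \<longleftrightarrow> x \<ominus>\<^bsub>E\<^esub> y \<in> W" if "x \<in> carrier E" "y \<in> carrier E" for x y
    using rep_eq[OF that] i unfolding p_def by (auto dest: injD)
  define s where "s = inv_into (carrier E) p"
  have s: "s (p x) \<in> carrier E" "p (s (p x)) = p x" if "x \<in> carrier E" for x
    unfolding s_def using that by (auto intro: inv_into_into f_inv_into_f)
  define Z :: "('r, 'm) module" where "Z = \<lparr>carrier = p ` carrier E, mult = (\<lambda>x y. x), one = p \<zero>\<^bsub>E\<^esub>,
    zero = p \<zero>\<^bsub>E\<^esub>, add = (\<lambda>u v. p (s u \<oplus>\<^bsub>E\<^esub> s v)), smult = (\<lambda>a u. p (a \<odot>\<^bsub>E\<^esub> s u))\<rparr>"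
  have Zs: "carrier Z = p ` carrier E" "\<zero>\<^bsub>Z\<^esub> = p \<zero>\<^bsub>E\<^esub>" by (simp_all add: Z_def)
  have add: "p x \<oplus>\<^bsub>Z\<^esub> p y = p (x \<oplus>\<^bsub>E\<^esub> y)" if x: "x \<in> carrier E" and y: "y \<in> carrier E" for x y
  proof -
    have "s (p x) \<ominus>\<^bsub>E\<^esub> x \<in> W" "s (p y) \<ominus>\<^bsub>E\<^esub> y \<in> W" using p_eq s x y by blast+
    then have "(s (p x) \<ominus>\<^bsub>E\<^esub> x) \<oplus>\<^bsub>E\<^esub> (s (p y) \<ominus>\<^bsub>E\<^esub> y) \<in> W" using W'(3) by blast
    moreover have "(s (p x) \<ominus>\<^bsub>E\<^esub> x) \<oplus>\<^bsub>E\<^esub> (s (p y) \<ominus>\<^bsub>E\<^esub> y) = (s (p x) \<oplus>\<^bsub>E\<^esub> s (p y)) \<ominus>\<^bsub>E\<^esub> (x \<oplus>\<^bsub>E\<^esub> y)"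
      using s(1)[OF x] s(1)[OF y] x y by (simp add: a_minus_def E.M.minus_add E.M.a_ac)
    ultimately show ?thesis using p_eq s x y by (simp add: Z_def)
  qed
  have smult: "a \<odot>\<^bsub>Z\<^esub> p x = p (a \<odot>\<^bsub>E\<^esub> x)" if a: "a \<in> carrier R" and x: "x \<in> carrier E" for a x
  proof -
    have "s (p x) \<ominus>\<^bsub>E\<^esub> x \<in> W" using p_eq s x by blast
    then have "a \<odot>\<^bsub>E\<^esub> (s (p x) \<ominus>\<^bsub>E\<^esub> x) \<in> W" using W'(4) a by blast
    moreover have "a \<odot>\<^bsub>E\<^esub> (s (p x) \<ominus>\<^bsub>E\<^esub> x) = a \<odot>\<^bsub>E\<^esub> s (p x) \<ominus>\<^bsub>E\<^esub> a \<odot>\<^bsub>E\<^esub> x"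
      using s(1)[OF x] x a E.lsmult_r_distr[OF a s(1)[OF x], of "\<ominus>\<^bsub>E\<^esub> x"] by (simp add: a_minus_def E.smult_minus)
    ultimately show ?thesis using p_eq s x a E.lsmult_closed by (simp add: Z_def)
  qed
  have "left_module R Z"
  proof (rule left_moduleI)
    show "ring R" by (rule E.R.ring_axioms)
    fix x assume "x \<in> carrier Z"
    then obtain x' where x: "x = p x'" "x' \<in> carrier E" using Zs by auto
    have "p (\<ominus>\<^bsub>E\<^esub> x') \<oplus>\<^bsub>Z\<^esub> x = \<zero>\<^bsub>Z\<^esub>" using x add[of "\<ominus>\<^bsub>E\<^esub> x'" x'] by (simp add: Zs E.M.l_neg)
    then show "\<exists>y\<in>carrier Z. y \<oplus>\<^bsub>Z\<^esub> x = \<zero>\<^bsub>Z\<^esub>" using x by (auto simp: Zs)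
  qed (auto simp: Zs add smult E.lsmult_closed E.M.a_ac E.lsmult_l_distr E.lsmult_r_distr
      E.lsmult_assoc E.lsmult_one)
  moreover have "p \<in> rhom R E Z" by (rule rhomI) (auto simp: Zs add smult)
  moreover have "p x = \<zero>\<^bsub>Z\<^esub> \<longleftrightarrow> x \<in> W" if "x \<in> carrier E" for x
  proof -
    have m0: "\<ominus>\<^bsub>E\<^esub> \<zero>\<^bsub>E\<^esub> = \<zero>\<^bsub>E\<^esub>" by (rule E.M.minus_equality) auto
    have "x \<ominus>\<^bsub>E\<^esub> \<zero>\<^bsub>E\<^esub> = x" unfolding a_minus_def m0 using that by (rule E.M.r_zero)
    then show ?thesis using p_eq[OF that E.M.zero_closed] by (simp only: Zs)
  qed
  ultimately show ?thesis using that Zs(1) by blast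
qed

section \<open>Exact sequences with given maps, and finite generation\<close>

definition exact_at :: "'r ring \<Rightarrow> ('l \<Rightarrow> 'm) \<Rightarrow> ('m \<Rightarrow> 'n) \<Rightarrow> ('r, 'l) module \<Rightarrow> ('r, 'm) module \<Rightarrow> ('r, 'n) module \<Rightarrow> bool" where
  "exact_at R f g X Y Z \<longleftrightarrow> f \<in> rhom R X Y \<and> g \<in> rhom R Y Z \<and> inj_on f (carrier X) \<and>
    g ` carrier Y = carrier Z \<and> f ` carrier X = {y \<in> carrier Y. g y = \<zero>\<^bsub>Z\<^esub>}"

lemma short_exact_iff: "short_exact R X Y Z \<longleftrightarrow> (\<exists>f g. exact_at R f g X Y Z)"
  unfolding short_exact_def exact_at_def by blast

lemma exactI:
  assumes "left_module R X" "left_module R Y" "f \<in> rhom R X Y" "g \<in> rhom R Y Z"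
    and "\<And>x. x \<in> carrier X \<Longrightarrow> f x = \<zero>\<^bsub>Y\<^esub> \<Longrightarrow> x = \<zero>\<^bsub>X\<^esub>"
    and "\<And>z. z \<in> carrier Z \<Longrightarrow> \<exists>y\<in>carrier Y. g y = z"
    and "\<And>x. x \<in> carrier X \<Longrightarrow> g (f x) = \<zero>\<^bsub>Z\<^esub>"
    and "\<And>y. y \<in> carrier Y \<Longrightarrow> g y = \<zero>\<^bsub>Z\<^esub> \<Longrightarrow> \<exists>x\<in>carrier X. y = f x"
  shows "exact_at R f g X Y Z"
  unfolding exact_at_def rhom_inj_iff[OF assms(3,1,2)]
proof (intro conjI ballI impI)
  show "g ` carrier Y = carrier Z"
  proof
    show "g ` carrier Y \<subseteq> carrier Z" using rhomD(1)[OF assms(4)] by blast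
    show "carrier Z \<subseteq> g ` carrier Y" using assms(6) by (metis imageI subsetI)
  qed
  show "f ` carrier X = {y \<in> carrier Y. g y = \<zero>\<^bsub>Z\<^esub>}"
    using assms(7,8) rhomD(1)[OF assms(3)] by blast
qed (use assms in auto)

lemma exactD:
  assumes "exact_at R f g X Y Z"
  shows "f \<in> rhom R X Y" "g \<in> rhom R Y Z" "inj_on f (carrier X)" "g ` carrier Y = carrier Z"
    "f ` carrier X = {y \<in> carrier Y. g y = \<zero>\<^bsub>Z\<^esub>}" "x \<in> carrier X \<Longrightarrow> f x \<in> carrier Y"
    "y \<in> carrier Y \<Longrightarrow> g y \<in> carrier Z" "x \<in> carrier X \<Longrightarrow> g (f x) = \<zero>\<^bsub>Z\<^esub>"
    "y \<in> carrier Y \<Longrightarrow> g y = \<zero>\<^bsub>Z\<^esub> \<Longrightarrow> \<exists>x\<in>carrier X. y = f x"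
    "z \<in> carrier Z \<Longrightarrow> \<exists>y\<in>carrier Y. z = g y"
  using assms rhomD(1)[of f R X Y] rhomD(1)[of g R Y Z] unfolding exact_at_def by (auto 0 3)

lemma exact_inj:
  assumes "exact_at R f g X Y Z" "left_module R X" "left_module R Y" "x \<in> carrier X" "f x = \<zero>\<^bsub>Y\<^esub>"
  shows "x = \<zero>\<^bsub>X\<^esub>"
  using exactD(1,3)[OF assms(1)] rhom_inj_iff[of f R X Y] assms(2-5) by blast

lemma exact_kernel:
  assumes "g \<in> rhom R Y Z" "g ` carrier Y = carrier Z" "left_module R Y" "left_module R Z"
  shows "exact_at R (\<lambda>x. x) g (Y\<lparr>carrier := {y \<in> carrier Y. g y = \<zero>\<^bsub>Z\<^esub>}\<rparr>) Y Z"
  using assms unfolding exact_at_def by (auto intro!: rhom_id)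

lemma fin_genI:
  assumes "finite S" "S \<subseteq> carrier M" "\<And>L. left_submodule R L M \<Longrightarrow> S \<subseteq> L \<Longrightarrow> L = carrier M"
  shows "fin_gen R M"
  unfolding fin_gen_def by (intro exI[of _ S] conjI allI impI assms) simp_all

lemma fin_gen_image:
  assumes "fin_gen R M" "g \<in> rhom R M N" "g ` carrier M = carrier N" "left_module R M" "left_module R N"
  shows "fin_gen R N"
proof -
  obtain S where S: "finite S" "S \<subseteq> carrier M" "\<And>L. left_submodule R L M \<Longrightarrow> S \<subseteq> L \<Longrightarrow> L = carrier M"
    using assms(1) unfolding fin_gen_def by blast
  have "L = carrier N" if L: "left_submodule R L N" "g ` S \<subseteq> L" for L
  proof -
    have "{x \<in> carrier M. g x \<in> L} = carrier M"
      by (rule S(3)[OF vimage_submodule[OF assms(2,4,5) L(1)]]) (use S(2) L(2) in blast)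
    then have "g ` carrier M \<subseteq> L" by blast
    then show ?thesis using assms(3) left_submoduleD(1)[OF assms(5) L(1)] by simp
  qed
  moreover have "g ` S \<subseteq> carrier N" using S(2) assms(3) by blast
  ultimately show ?thesis by (intro fin_genI[OF finite_imageI[OF S(1)]])
qed

text \<open>\<open>Y\<close> is generated by the images of generators of \<open>X\<close> together
  with lifts of generators of \<open>Z\<close>.\<close>

lemma fin_gen_extension:
  assumes e: "exact_at R f g X Y Z" and m: "left_module R X" "left_module R Y" "left_module R Z"
    and fg: "fin_gen R X" "fin_gen R Z"
  shows "fin_gen R Y"
proof -
  interpret Y: left_module R Y by (rule m)
  interpret Z: left_module R Z by (rule m)
  note e' = exactD[OF e]
  obtain S where S: "finite S" "S \<subseteq> carrier X" "\<And>L. left_submodule R L X \<Longrightarrow> S \<subseteq> L \<Longrightarrow> L = carrier X"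
    using fg(1) unfolding fin_gen_def by blast
  obtain S' where S': "finite S'" "S' \<subseteq> carrier Z" "\<And>L. left_submodule R L Z \<Longrightarrow> S' \<subseteq> L \<Longrightarrow> L = carrier Z"
    using fg(2) unfolding fin_gen_def by blast
  obtain S'' where S'': "S'' \<subseteq> carrier Y" "finite S''" "S' = g ` S''"
    using finite_subset_image[OF S'(1)] S'(2) e'(4) by metis
  have "L = carrier Y" if L: "left_submodule R L Y" "f ` S \<union> S'' \<subseteq> L" for L
  proof -
    note LD = left_submoduleD[OF m(2) L(1)]
    have 1: "{x \<in> carrier X. f x \<in> L} = carrier X"
      by (rule S(3)[OF vimage_submodule[OF e'(1) m(1,2) L(1)]]) (use S(2) L(2) in blast)
    have 2: "g ` L = carrier Z"
      by (rule S'(3)[OF image_submodule[OF e'(2) m(2,3) L(1)]]) (use S''(3) L(2) in blast)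
    have "y \<in> L" if y: "y \<in> carrier Y" for y
    proof -
      obtain l where l: "l \<in> L" "g y = g l" using 2 e'(7)[OF y] by (metis imageE)
      then have lY: "l \<in> carrier Y" using LD(1) by blast
      have "g (y \<ominus>\<^bsub>Y\<^esub> l) = \<zero>\<^bsub>Z\<^esub>"
        using rhom_minus[OF e'(2) m(2,3) y lY] l(2) e'(7)[OF lY] by (simp add: Z.M.r_neg a_minus_def)
      then obtain x where "x \<in> carrier X" "y \<ominus>\<^bsub>Y\<^esub> l = f x" using e'(9) y lY by blast
      then have "y \<ominus>\<^bsub>Y\<^esub> l \<in> L" using 1 by auto
      then have "(y \<ominus>\<^bsub>Y\<^esub> l) \<oplus>\<^bsub>Y\<^esub> l \<in> L" using LD(3) l by blast
      then show ?thesis using y lY by (simp add: a_minus_def Y.M.a_assoc Y.M.l_neg)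
    qed
    then show ?thesis using LD(1) by blast
  qed
  moreover have "f ` S \<union> S'' \<subseteq> carrier Y" using S(2) S''(1) e'(6) by blast
  moreover have "finite (f ` S \<union> S'')" using S(1) S''(2) by simp
  ultimately show ?thesis by (intro fin_genI[of "f ` S \<union> S''"])
qed

section \<open>Products of two modules\<close>

definition prod_module :: "('r, 'm) module \<Rightarrow> ('r, 'm) module \<Rightarrow> ('r, 'm \<times> 'm) module" where
  "prod_module X Y = \<lparr>carrier = carrier X \<times> carrier Y, mult = (\<lambda>u v. u), one = (\<zero>\<^bsub>X\<^esub>, \<zero>\<^bsub>Y\<^esub>),
    zero = (\<zero>\<^bsub>X\<^esub>, \<zero>\<^bsub>Y\<^esub>), add = (\<lambda>u v. (fst u \<oplus>\<^bsub>X\<^esub> fst v, snd u \<oplus>\<^bsub>Y\<^esub> snd v)),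
    smult = (\<lambda>a u. (a \<odot>\<^bsub>X\<^esub> fst u, a \<odot>\<^bsub>Y\<^esub> snd u))\<rparr>"

lemma prod_module_simps [simp]:
  "carrier (prod_module X Y) = carrier X \<times> carrier Y" "\<zero>\<^bsub>prod_module X Y\<^esub> = (\<zero>\<^bsub>X\<^esub>, \<zero>\<^bsub>Y\<^esub>)"
  "u \<oplus>\<^bsub>prod_module X Y\<^esub> v = (fst u \<oplus>\<^bsub>X\<^esub> fst v, snd u \<oplus>\<^bsub>Y\<^esub> snd v)"
  "a \<odot>\<^bsub>prod_module X Y\<^esub> u = (a \<odot>\<^bsub>X\<^esub> fst u, a \<odot>\<^bsub>Y\<^esub> snd u)"
  by (simp_all add: prod_module_def)

lemma prod_left_module:
  assumes "left_module R X" "left_module R Y" shows "left_module R (prod_module X Y)"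
proof -
  interpret X: left_module R X by fact
  interpret Y: left_module R Y by fact
  show ?thesis
  proof (rule left_moduleI)
    fix u assume u: "u \<in> carrier (prod_module X Y)"
    show "\<exists>v\<in>carrier (prod_module X Y). v \<oplus>\<^bsub>prod_module X Y\<^esub> u = \<zero>\<^bsub>prod_module X Y\<^esub>"
      by (rule bexI[of _ "(\<ominus>\<^bsub>X\<^esub> fst u, \<ominus>\<^bsub>Y\<^esub> snd u)"]) (use u in \<open>auto simp: X.M.l_neg Y.M.l_neg\<close>)
  qed (auto simp: X.R.ring_axioms X.M.a_ac Y.M.a_ac X.lsmult_closed Y.lsmult_closed X.lsmult_l_distr
    Y.lsmult_l_distr X.lsmult_r_distr Y.lsmult_r_distr X.lsmult_assoc Y.lsmult_assoc X.lsmult_one Y.lsmult_one)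
qed

lemma fgD: "M \<in> fg_modules R \<Longrightarrow> left_module R M" "M \<in> fg_modules R \<Longrightarrow> fin_gen R M"
  by (simp_all add: fg_modules_def)

lemma fg_image:
  assumes "M \<in> fg_modules R" "g \<in> rhom R M N" "g ` carrier M = carrier N" "left_module R N"
  shows "N \<in> fg_modules R"
  using fin_gen_image[OF fgD(2)[OF assms(1)] assms(2,3) fgD(1)[OF assms(1)] assms(4)] assms(4)
  by (simp add: fg_modules_def)

lemma fg_ext:
  assumes "exact_at R f g X Y Z" "X \<in> fg_modules R" "Z \<in> fg_modules R" "left_module R Y"
  shows "Y \<in> fg_modules R"
  using fin_gen_extension[OF assms(1) _ assms(4)] assms(2-4) by (simp add: fg_modules_def)

text \<open>What the abstract axioms require of a module category: closure under submodules, an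
  additive dimension that detects zero, and a coding of pairs, because all objects live on one
  carrier type while fibre products and amalgamated sums consist of pairs.\<close>

locale noetherian_modules =
  fixes R :: "'r ring" and pr :: "'m \<times> 'm \<Rightarrow> 'm" and d :: "('r, 'm) module \<Rightarrow> nat"
  assumes inj_pr: "inj pr"
    and sub_fg: "M \<in> fg_modules R \<Longrightarrow> left_submodule R L M \<Longrightarrow> M\<lparr>carrier := L\<rparr> \<in> fg_modules R"
    and d_exact: "short_exact R X Y Z \<Longrightarrow> X \<in> fg_modules R \<Longrightarrow> Y \<in> fg_modules R \<Longrightarrow> Z \<in> fg_modules R \<Longrightarrow>
      d Y = d X + d Z"
    and d_zero: "M \<in> fg_modules R \<Longrightarrow> d M = 0 \<Longrightarrow> carrier M = {\<zero>\<^bsub>M\<^esub>}"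
begin

abbreviation Ob :: "('r, 'm) module set" where "Ob \<equiv> fg_modules R"

definition S :: "('r, 'm) module \<Rightarrow> ('r, 'm) module \<Rightarrow> ('r, 'm) module \<Rightarrow> bool" where
  "S X Y Z \<longleftrightarrow> X \<in> Ob \<and> Y \<in> Ob \<and> Z \<in> Ob \<and> (\<exists>f g. exact_at R f g X Y Z)"

definition isom :: "('r, 'm) module \<Rightarrow> ('r, 'm) module \<Rightarrow> bool" where
  "isom M N \<longleftrightarrow> M \<in> Ob \<and> N \<in> Ob \<and> (\<exists>h \<in> rhom R M N. bij_betw h (carrier M) (carrier N))"

lemma SI: "exact_at R f g X Y Z \<Longrightarrow> X \<in> Ob \<Longrightarrow> Y \<in> Ob \<Longrightarrow> Z \<in> Ob \<Longrightarrow> S X Y Z"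
  unfolding S_def by blast

lemma SE: assumes "S X Y Z" obtains f g where "exact_at R f g X Y Z" "X \<in> Ob" "Y \<in> Ob" "Z \<in> Ob"
  using assms unfolding S_def by blast

lemma quotient:
  assumes "M \<in> Ob" "left_submodule R W M"
  obtains Z p where "Z \<in> Ob" "p \<in> rhom R M Z" "p ` carrier M = carrier Z"
    "\<And>x. x \<in> carrier M \<Longrightarrow> p x = \<zero>\<^bsub>Z\<^esub> \<longleftrightarrow> x \<in> W"
proof -
  obtain Z :: "('r, 'm) module" and p where *: "left_module R Z" "p \<in> rhom R M Z" "p ` carrier M = carrier Z"
    "\<And>x. x \<in> carrier M \<Longrightarrow> p x = \<zero>\<^bsub>Z\<^esub> \<longleftrightarrow> x \<in> W"
    using ex_quotient[OF fgD(1)[OF assms(1)] assms(2) inj_on_id] by metis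
  then show ?thesis using that[of Z p] fg_image[OF assms(1) *(2,3,1)] by blast
qed

lemma S_sub:
  assumes "M \<in> Ob" "left_submodule R L M"
  obtains Z where "S (M\<lparr>carrier := L\<rparr>) M Z"
proof -
  obtain Z p where *: "Z \<in> Ob" "p \<in> rhom R M Z" "p ` carrier M = carrier Z"
    "\<And>x. x \<in> carrier M \<Longrightarrow> p x = \<zero>\<^bsub>Z\<^esub> \<longleftrightarrow> x \<in> L" using quotient[OF assms] by metis
  have "{y \<in> carrier M. p y = \<zero>\<^bsub>Z\<^esub>} = L" using *(4) left_submoduleD(1)[OF fgD(1)[OF assms(1)] assms(2)] by auto
  then have "exact_at R (\<lambda>x. x) p (M\<lparr>carrier := L\<rparr>) M Z"
    using exact_kernel[OF *(2,3) fgD(1)[OF assms(1)] fgD(1)[OF *(1)]] by simp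
  then show ?thesis using that SI sub_fg[OF assms] assms *(1) by blast
qed

lemma S_quot:
  assumes "M \<in> Ob" "Z \<in> Ob" "g \<in> rhom R M Z" "g ` carrier M = carrier Z"
  shows "S (M\<lparr>carrier := {y \<in> carrier M. g y = \<zero>\<^bsub>Z\<^esub>}\<rparr>) M Z"
  using SI[OF exact_kernel[OF assms(3,4) fgD(1)[OF assms(1)] fgD(1)[OF assms(2)]]]
    sub_fg[OF assms(1) kernel_submodule[OF assms(3) fgD(1)[OF assms(1)] fgD(1)[OF assms(2)]]] assms by blast

lemma isom_refl: "M \<in> Ob \<Longrightarrow> isom M M"
  unfolding isom_def by (intro conjI bexI[of _ "\<lambda>x. x"] rhomI) (auto simp: bij_betw_def)

lemma isomE:
  assumes "isom M N"
  obtains h h' where "h \<in> rhom R M N" "h' \<in> rhom R N M" "\<And>x. x \<in> carrier M \<Longrightarrow> h' (h x) = x"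
    "\<And>x. x \<in> carrier N \<Longrightarrow> h (h' x) = x" "M \<in> Ob" "N \<in> Ob"
proof -
  obtain h where h: "h \<in> rhom R M N" "bij_betw h (carrier M) (carrier N)" "M \<in> Ob" "N \<in> Ob"
    using assms unfolding isom_def by blast
  have "inv_into (carrier M) h \<in> rhom R (N\<lparr>carrier := carrier N\<rparr>) M"
    by (rule rhom_inv[OF h(1)]) (use h fgD in \<open>auto simp: bij_betw_def\<close>)
  then show ?thesis using that[of h "inv_into (carrier M) h"] h
    by (auto simp: bij_betw_def f_inv_into_f)
qed

lemma isomI:
  assumes "h \<in> rhom R M N" "h' \<in> rhom R N M" "\<And>x. x \<in> carrier M \<Longrightarrow> h' (h x) = x"
    "\<And>x. x \<in> carrier N \<Longrightarrow> h (h' x) = x" "M \<in> Ob" "N \<in> Ob"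
  shows "isom M N"
  unfolding isom_def
  by (intro conjI bexI[of _ h] bij_betw_byWitness[of _ h']) (use assms rhomD in auto)

lemma isom_sym: "isom M N \<Longrightarrow> isom N M"
  by (elim isomE, rule isomI)

lemma S_isom:
  assumes "S L M N" "isom L L'" "isom M M'" "isom N N'" shows "S L' M' N'"
proof -
  obtain f g where e: "exact_at R f g L M N" using assms SE by metis
  obtain a a' where a: "a \<in> rhom R L L'" "a' \<in> rhom R L' L" "\<And>x. x \<in> carrier L \<Longrightarrow> a' (a x) = x"
    "\<And>x. x \<in> carrier L' \<Longrightarrow> a (a' x) = x" "L \<in> Ob" "L' \<in> Ob" using isomE[OF assms(2)] by metis
  obtain b b' where b: "b \<in> rhom R M M'" "b' \<in> rhom R M' M" "\<And>x. x \<in> carrier M \<Longrightarrow> b' (b x) = x"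
    "\<And>x. x \<in> carrier M' \<Longrightarrow> b (b' x) = x" "M \<in> Ob" "M' \<in> Ob" using isomE[OF assms(3)] by metis
  obtain c c' where c: "c \<in> rhom R N N'" "c' \<in> rhom R N' N" "\<And>x. x \<in> carrier N \<Longrightarrow> c' (c x) = x"
    "\<And>x. x \<in> carrier N' \<Longrightarrow> c (c' x) = x" "N \<in> Ob" "N' \<in> Ob" using isomE[OF assms(4)] by metis
  note lm = fgD(1)[OF a(5)] fgD(1)[OF a(6)] fgD(1)[OF b(5)] fgD(1)[OF b(6)] fgD(1)[OF c(5)] fgD(1)[OF c(6)]
  note cl = rhomD(1)[OF a(1)] rhomD(1)[OF a(2)] rhomD(1)[OF b(1)] rhomD(1)[OF b(2)] rhomD(1)[OF c(1)] rhomD(1)[OF c(2)]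
  note e' = exactD[OF e]
  have "exact_at R (\<lambda>x. b (f (a' x))) (\<lambda>y. c (g (b' y))) L' M' N'"
  proof (rule exactI[OF lm(2,4)])
    show "(\<lambda>x. b (f (a' x))) \<in> rhom R L' M'" by (intro rhom_comp[OF _ b(1)] rhom_comp[OF a(2) e'(1)])
    show "(\<lambda>y. c (g (b' y))) \<in> rhom R M' N'" by (intro rhom_comp[OF _ c(1)] rhom_comp[OF b(2) e'(2)])
    fix x assume x: "x \<in> carrier L'"
    show "c (g (b' (b (f (a' x))))) = \<zero>\<^bsub>N'\<^esub>"
      using x cl e'(6,8) b(3) rhom_zero[OF c(1) lm(5,6)] by simp
    show "x = \<zero>\<^bsub>L'\<^esub>" if "b (f (a' x)) = \<zero>\<^bsub>M'\<^esub>"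
    proof -
      have "f (a' x) = \<zero>\<^bsub>M\<^esub>" using that b(3)[OF e'(6)[OF cl(2)[OF x]]] rhom_zero[OF b(2) lm(4,3)] by simp
      then have "a' x = \<zero>\<^bsub>L\<^esub>" using exact_inj[OF e lm(1,3) cl(2)[OF x]] by simp
      then show ?thesis using a(4)[OF x] rhom_zero[OF a(1) lm(1,2)] by simp
    qed
  next
    fix z assume z: "z \<in> carrier N'"
    obtain y where y: "y \<in> carrier M" "c' z = g y" using e'(10)[OF cl(6)[OF z]] by blast
    show "\<exists>y\<in>carrier M'. c (g (b' y)) = z"
      by (rule bexI[of _ "b y"]) (use y b(3) c(4)[OF z] cl in simp_all)
  next
    fix y assume y: "y \<in> carrier M'" "c (g (b' y)) = \<zero>\<^bsub>N'\<^esub>"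
    then have "g (b' y) = \<zero>\<^bsub>N\<^esub>" using c(3)[OF e'(7)[OF cl(4)[OF y(1)]]] rhom_zero[OF c(2) lm(6,5)] by simp
    then obtain x where x: "x \<in> carrier L" "b' y = f x" using e'(9)[OF cl(4)[OF y(1)]] by blast
    show "\<exists>x\<in>carrier L'. y = b (f (a' x))"
      by (rule bexI[of _ "a x"]) (use x y a(3) b(4) cl in \<open>metis\<close>)+
  qed
  then show ?thesis using SI a(6) b(6) c(6) by blast
qed

lemma S_zero_sub:
  assumes "S L M N" "d L = 0" shows "isom M N"
proof -
  obtain f g where e: "exact_at R f g L M N" and o: "L \<in> Ob" "M \<in> Ob" "N \<in> Ob" using assms SE by metis
  note lm = fgD(1)[OF o(1)] fgD(1)[OF o(2)] fgD(1)[OF o(3)]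
  have "inj_on g (carrier M)" unfolding rhom_inj_iff[OF exactD(2)[OF e] lm(2,3)]
    using exactD(9)[OF e] d_zero[OF o(1) assms(2)] rhom_zero[OF exactD(1)[OF e] lm(1,2)] by fastforce
  then show ?thesis unfolding isom_def using exactD(2,4)[OF e] o unfolding bij_betw_def by blast
qed

lemma S_zero_quot:
  assumes "S L M N" "d N = 0" shows "isom L M"
proof -
  obtain f g where e: "exact_at R f g L M N" and o: "L \<in> Ob" "M \<in> Ob" "N \<in> Ob" using assms SE by metis
  have "f ` carrier L = carrier M" using exactD(5,7)[OF e] d_zero[OF o(3) assms(2)] by auto
  then show ?thesis unfolding isom_def using exactD(1,3)[OF e] o unfolding bij_betw_def by blast
qed

lemma S_d: "S L M N \<Longrightarrow> d M = d L + d N"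
  unfolding S_def using d_exact short_exact_iff by metis

lemma S_zero_ex:
  assumes M: "M \<in> Ob"
  shows "\<exists>Z. S Z M M \<and> d Z = 0" "\<exists>Z. S M M Z \<and> d Z = 0"
proof -
  have id: "(\<lambda>x. x) \<in> rhom R M M" by (rule rhomI) auto
  have "S (M\<lparr>carrier := {y \<in> carrier M. y = \<zero>\<^bsub>M\<^esub>}\<rparr>) M M" by (rule S_quot[OF M M id]) simp
  then show "\<exists>Z. S Z M M \<and> d Z = 0" using S_d by fastforce
  obtain Z where "S (M\<lparr>carrier := carrier M\<rparr>) M Z" using S_sub[OF M whole_submodule[OF fgD(1)[OF M]]] by blast
  then show "\<exists>Z. S M M Z \<and> d Z = 0" using S_d by fastforce
qed

lemma S_preimage:
  assumes "S Y X' X" "S X1 X C" shows "\<exists>Z. S Y Z X1 \<and> S Z X' C"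
proof -
  obtain f g where e: "exact_at R f g Y X' X" and o: "Y \<in> Ob" "X' \<in> Ob" "X \<in> Ob" using assms SE by metis
  obtain h q where e2: "exact_at R h q X1 X C" and o2: "X1 \<in> Ob" "C \<in> Ob" using assms SE by metis
  note lm = fgD(1)[OF o(1)] fgD(1)[OF o(2)] fgD(1)[OF o(3)] fgD(1)[OF o2(1)] fgD(1)[OF o2(2)]
  interpret X: left_module R X by (rule lm)
  note E = exactD[OF e] and E2 = exactD[OF e2]
  \<comment> \<open>\<open>W\<close> is the preimage in \<open>X'\<close> of the image of
    \<open>X1\<close>. Its map to \<open>X1\<close> must undo the embedding \<open>h\<close>, which
    is the task of \<open>k\<close> below.\<close>
  define W where "W = {x \<in> carrier X'. g x \<in> h ` carrier X1}"
  have Ws: "left_submodule R W X'" unfolding W_def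
    by (rule vimage_submodule[OF E(2) lm(2,3) image_submodule[OF E2(1) lm(4,3) whole_submodule[OF lm(4)]]])
  define Z where "Z = X'\<lparr>carrier := W\<rparr>"
  have Z: "Z \<in> Ob" unfolding Z_def by (rule sub_fg[OF o(2) Ws])
  have WX: "W \<subseteq> carrier X'" unfolding W_def by blast
  have Zs: "carrier Z = W" "\<zero>\<^bsub>Z\<^esub> = \<zero>\<^bsub>X'\<^esub>" unfolding Z_def by simp_all
  define k where "k = inv_into (carrier X1) h"
  have k: "k (h x) = x" if "x \<in> carrier X1" for x unfolding k_def using E2(3) that by simp
  have khom: "k \<in> rhom R (X\<lparr>carrier := h ` carrier X1\<rparr>) X1"
    unfolding k_def by (rule rhom_inv[OF E2(1,3) refl lm(4)])
  have gZ: "g \<in> rhom R Z (X\<lparr>carrier := h ` carrier X1\<rparr>)"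
    unfolding Z_def by (rule rhom_sub_cod[OF rhom_sub_dom[OF E(2) WX]]) (auto simp: W_def)
  have h0: "h \<zero>\<^bsub>X1\<^esub> = \<zero>\<^bsub>X\<^esub>" by (rule rhom_zero[OF E2(1) lm(4,3)])
  have X10: "\<zero>\<^bsub>X1\<^esub> \<in> carrier X1" using left_submoduleD(2)[OF lm(4) whole_submodule[OF lm(4)]] .
  have k0: "k (\<zero>\<^bsub>X\<^esub>) = \<zero>\<^bsub>X1\<^esub>" using k[OF X10] h0 by simp
  have fW: "f y \<in> W" if "y \<in> carrier Y" for y
    using E(6,8)[OF that] h0 X10 unfolding W_def by (auto intro: rev_image_eqI)
  have "exact_at R f (\<lambda>z. k (g z)) Y Z X1"
  proof (rule exactI[OF lm(1) fgD(1)[OF Z]])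
    show "f \<in> rhom R Y Z" unfolding Z_def by (rule rhom_sub_cod[OF E(1)]) (use fW in blast)
    show "(\<lambda>z. k (g z)) \<in> rhom R Z X1" by (rule rhom_comp[OF gZ khom])
    show "y = \<zero>\<^bsub>Y\<^esub>" if "y \<in> carrier Y" "f y = \<zero>\<^bsub>Z\<^esub>" for y
      using exact_inj[OF e lm(1,2) that(1)] that(2) Zs by simp
    show "k (g (f y)) = \<zero>\<^bsub>X1\<^esub>" if "y \<in> carrier Y" for y using E(8)[OF that] k0 by simp
    show "\<exists>y\<in>carrier Z. k (g y) = x" if x: "x \<in> carrier X1" for x
    proof -
      obtain y where y: "y \<in> carrier X'" "h x = g y" using E(10)[OF E2(6)[OF x]] by blast
      have "g y \<in> h ` carrier X1" using imageI[OF x, of h] y(2) by simp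
      then have "y \<in> carrier Z" using y(1) Zs(1) unfolding W_def by simp
      moreover have "k (g y) = x" using k[OF x] y(2) by simp
      ultimately show ?thesis by blast
    qed
    show "\<exists>x\<in>carrier Y. z = f x" if z: "z \<in> carrier Z" "k (g z) = \<zero>\<^bsub>X1\<^esub>" for z
    proof -
      obtain x where x: "x \<in> carrier X1" "g z = h x" using z Zs unfolding W_def by blast
      then have "g z = \<zero>\<^bsub>X\<^esub>" using z(2) k[OF x(1)] h0 by simp
      then show ?thesis using E(9) z(1) Zs WX by blast
    qed
  qed
  moreover have "exact_at R (\<lambda>z. z) (\<lambda>x. q (g x)) Z X' C"
  proof (rule exactI[OF fgD(1)[OF Z] lm(2)])
    show "(\<lambda>z. z) \<in> rhom R Z X'" unfolding Z_def by (rule rhom_id[OF WX])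
    show "(\<lambda>x. q (g x)) \<in> rhom R X' C" by (rule rhom_comp[OF E(2) E2(2)])
    show "\<exists>y\<in>carrier X'. q (g y) = z" if "z \<in> carrier C" for z
      using E2(10)[OF that] E(10) by metis
    show "q (g z) = \<zero>\<^bsub>C\<^esub>" if "z \<in> carrier Z" for z
      using that E2(8) Zs unfolding W_def by auto
    show "\<exists>x\<in>carrier Z. y = x" if "y \<in> carrier X'" "q (g y) = \<zero>\<^bsub>C\<^esub>" for y
      using E2(9)[OF E(7)[OF that(1)] that(2)] that(1) Zs unfolding W_def by auto
  qed (simp add: Zs)
  ultimately show ?thesis using SI Z o o2 by blast
qed

text \<open>The third isomorphism theorem: \<open>Z\<close> is \<open>M\<close> modulo the image of
  \<open>K\<close>, and both maps of the second sequence are induced on quotients by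
  \<open>rhom_factor\<close>.\<close>

lemma S_quotient_sub:
  assumes "S A M N" "S K A P" shows "\<exists>Z. S K M Z \<and> S P Z N"
proof -
  obtain f g where e: "exact_at R f g A M N" and o: "A \<in> Ob" "M \<in> Ob" "N \<in> Ob" using assms SE by metis
  obtain h q where e2: "exact_at R h q K A P" and o2: "K \<in> Ob" "P \<in> Ob" using assms SE by metis
  note lm = fgD(1)[OF o(1)] fgD(1)[OF o(2)] fgD(1)[OF o(3)] fgD(1)[OF o2(1)] fgD(1)[OF o2(2)]
  note E = exactD[OF e] and E2 = exactD[OF e2]
  have fh: "(\<lambda>x. f (h x)) \<in> rhom R K M" by (rule rhom_comp[OF E2(1) E(1)])
  define W where "W = (\<lambda>x. f (h x)) ` carrier K"
  have W: "left_submodule R W M" unfolding W_def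
    by (rule image_submodule[OF fh lm(4,2) whole_submodule[OF lm(4)]])
  obtain Z p where Z: "Z \<in> Ob" and p: "p \<in> rhom R M Z" "p ` carrier M = carrier Z"
    "\<And>x. x \<in> carrier M \<Longrightarrow> p x = \<zero>\<^bsub>Z\<^esub> \<longleftrightarrow> x \<in> W" using quotient[OF o(2) W] by metis
  have "exact_at R (\<lambda>x. f (h x)) p K M Z"
  proof (rule exactI[OF lm(4,2) fh p(1)])
    show "x = \<zero>\<^bsub>K\<^esub>" if "x \<in> carrier K" "f (h x) = \<zero>\<^bsub>M\<^esub>" for x
      using exact_inj[OF e2 lm(4,1) that(1)] exact_inj[OF e lm(1,2) E2(6)[OF that(1)] that(2)] by simp
    show "\<exists>y\<in>carrier M. p y = z" if "z \<in> carrier Z" for z using that p(2) by (metis imageE)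
    show "p (f (h x)) = \<zero>\<^bsub>Z\<^esub>" if "x \<in> carrier K" for x
      using p(3)[OF E(6)[OF E2(6)[OF that]]] that unfolding W_def by blast
    show "\<exists>x\<in>carrier K. y = f (h x)" if "y \<in> carrier M" "p y = \<zero>\<^bsub>Z\<^esub>" for y
      using p(3)[OF that(1)] that unfolding W_def by blast
  qed
  moreover
  have pf: "(\<lambda>a. p (f a)) \<in> rhom R A Z" by (rule rhom_comp[OF E(1) p(1)])
  obtain u where u: "u \<in> rhom R P Z" "\<And>a. a \<in> carrier A \<Longrightarrow> u (q a) = p (f a)"
  proof (rule rhom_factor[OF E2(2,4) pf _ lm(1,5) fgD(1)[OF Z]])
    show "p (f a) = \<zero>\<^bsub>Z\<^esub>" if "a \<in> carrier A" "q a = \<zero>\<^bsub>P\<^esub>" for a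
      using E2(9)[OF that] p(3)[OF E(6)[OF that(1)]] unfolding W_def by blast
  qed blast
  obtain v where v: "v \<in> rhom R Z N" "\<And>m. m \<in> carrier M \<Longrightarrow> v (p m) = g m"
  proof (rule rhom_factor[OF p(1,2) E(2) _ lm(2) fgD(1)[OF Z] lm(3)])
    show "g m = \<zero>\<^bsub>N\<^esub>" if "m \<in> carrier M" "p m = \<zero>\<^bsub>Z\<^esub>" for m
      using that p(3)[OF that(1)] E(8) E2(6) unfolding W_def by auto
  qed blast
  have "exact_at R u v P Z N"
  proof (rule exactI[OF lm(5) fgD(1)[OF Z] u(1) v(1)])
    fix x assume x: "x \<in> carrier P"
    obtain a where a: "a \<in> carrier A" "x = q a" using E2(10)[OF x] by blast
    show "v (u x) = \<zero>\<^bsub>N\<^esub>" using a u(2) v(2) E(6,8) by simp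
    show "x = \<zero>\<^bsub>P\<^esub>" if "u x = \<zero>\<^bsub>Z\<^esub>"
    proof -
      have "f a \<in> W" using that a u(2) p(3)[OF E(6)[OF a(1)]] by simp
      then obtain k where k: "k \<in> carrier K" "f a = f (h k)" unfolding W_def by blast
      then have "a = h k" using inj_onD[OF E(3) k(2) a(1) E2(6)] by blast
      then show ?thesis using a k E2(8) by simp
    qed
  next
    show "\<exists>y\<in>carrier Z. v y = z" if "z \<in> carrier N" for z
      using E(10)[OF that] v(2) rhomD(1)[OF p(1)] by metis
    fix y assume y: "y \<in> carrier Z" "v y = \<zero>\<^bsub>N\<^esub>"
    obtain m where m: "m \<in> carrier M" "y = p m" using y p(2) by blast
    then obtain a where a: "a \<in> carrier A" "m = f a" using E(9)[OF m(1)] v(2) y by auto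
    show "\<exists>x\<in>carrier P. y = u x"
      by (rule bexI[of _ "q a"]) (use a m u(2)[OF a(1)] E2(7)[OF a(1)] in simp_all)
  qed
  ultimately show ?thesis using SI Z o o2 by blast
qed

lemma rhom_onto_ex: "g \<in> rhom R M N \<Longrightarrow> g ` carrier M = carrier N \<Longrightarrow> z \<in> carrier N \<Longrightarrow> \<exists>y\<in>carrier M. g y = z"
  by (metis imageE)

text \<open>All of the diagram of two submodules is obtained by applying this also with the two exchanged.\<close>

lemma two_subs_half:
  assumes e: "exact_at R f g A M A'" and e2: "exact_at R h q C M C'"
    and o: "A \<in> Ob" "M \<in> Ob" "A' \<in> Ob" "C \<in> Ob" "C' \<in> Ob"
    and U: "U = {x \<in> carrier M. \<exists>a\<in>carrier A. \<exists>c\<in>carrier C. x = f a \<oplus>\<^bsub>M\<^esub> h c}" "M\<lparr>carrier := U\<rparr> \<in> Ob"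
    and D: "D = f ` carrier A \<inter> h ` carrier C" "M\<lparr>carrier := D\<rparr> \<in> Ob"
    and V: "V \<in> Ob" "v \<in> rhom R M V" "v ` carrier M = carrier V"
      "\<And>x. x \<in> carrier M \<Longrightarrow> v x = \<zero>\<^bsub>V\<^esub> \<longleftrightarrow> x \<in> D"
    and Q: "Q \<in> Ob" "r \<in> rhom R M Q" "r ` carrier M = carrier Q"
      "\<And>x. x \<in> carrier M \<Longrightarrow> r x = \<zero>\<^bsub>Q\<^esub> \<longleftrightarrow> x \<in> U"
  defines "P \<equiv> C'\<lparr>carrier := (\<lambda>a. q (f a)) ` carrier A\<rparr>"
  shows "S (M\<lparr>carrier := D\<rparr>) A P" "S C (M\<lparr>carrier := U\<rparr>) P" "S P C' Q" "S P V A'"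
proof -
  note lm = o[THEN fgD(1)]
  interpret M: left_module R M by (rule lm)
  note E = exactD[OF e] and E2 = exactD[OF e2]
  note lU = fgD(1)[OF U(2)] and lD = fgD(1)[OF D(2)] and lV = fgD(1)[OF V(1)] and lQ = fgD(1)[OF Q(1)]
  \<comment> \<open>Realising \<open>P\<close> as the image of \<open>A\<close> in
    \<open>C'\<close>, the quotient of \<open>M\<close> by \<open>C\<close>, lets one module serve
    as the quotient of \<open>A\<close> by the intersection and as the quotient of the sum by
    \<open>C\<close>.\<close>
  define P0 where "P0 = (\<lambda>a. q (f a)) ` carrier A"
  have qf: "(\<lambda>a. q (f a)) \<in> rhom R A C'" by (rule rhom_comp[OF E(1) E2(2)])
  have P0: "left_submodule R P0 C'" unfolding P0_def
    by (rule image_submodule[OF qf lm(1,5) whole_submodule[OF lm(1)]])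
  have PO: "P \<in> Ob" unfolding P_def using sub_fg[OF o(5) P0] unfolding P0_def .
  note lP = fgD(1)[OF PO]
  have Ps: "carrier P = P0" "\<zero>\<^bsub>P\<^esub> = \<zero>\<^bsub>C'\<^esub>" unfolding P_def P0_def by simp_all
  have P0C: "P0 \<subseteq> carrier C'" by (rule left_submoduleD(1)[OF lm(5) P0])
  have DM: "D \<subseteq> carrier M" using D(1) E(6) by blast
  have UM: "U \<subseteq> carrier M" using U(1) by blast
  have f0: "f \<zero>\<^bsub>A\<^esub> = \<zero>\<^bsub>M\<^esub>" by (rule rhom_zero[OF E(1) lm(1,2)])
  have h0: "h \<zero>\<^bsub>C\<^esub> = \<zero>\<^bsub>M\<^esub>" by (rule rhom_zero[OF E2(1) lm(4,2)])
  have z: "\<zero>\<^bsub>A\<^esub> \<in> carrier A" "\<zero>\<^bsub>C\<^esub> \<in> carrier C"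
    using left_submoduleD(2)[OF lm(1) whole_submodule[OF lm(1)]] left_submoduleD(2)[OF lm(4) whole_submodule[OF lm(4)]] .
  have fU: "f a \<in> U" if "a \<in> carrier A" for a
    unfolding U(1) using E(6)[OF that] that z(2) h0 M.M.r_zero[OF E(6)[OF that]]
    by (intro CollectI conjI bexI[of _ a] bexI[of _ "\<zero>\<^bsub>C\<^esub>"]) simp_all
  have hU: "h c \<in> U" if "c \<in> carrier C" for c
    unfolding U(1) using E2(6)[OF that] that z(1) f0 M.M.l_zero[OF E2(6)[OF that]]
    by (intro CollectI conjI bexI[of _ "\<zero>\<^bsub>A\<^esub>"] bexI[of _ c]) simp_all
  have UE: "\<exists>a\<in>carrier A. \<exists>c\<in>carrier C. x = f a \<oplus>\<^bsub>M\<^esub> h c" if "x \<in> U" for x using that U(1) by blast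
  interpret C': left_module R C' by (rule lm)
  have qU: "\<exists>a\<in>carrier A. q x = q (f a)" if xU: "x \<in> U" for x
  proof -
    obtain a c where ac: "a \<in> carrier A" "c \<in> carrier C" "x = f a \<oplus>\<^bsub>M\<^esub> h c" using UE[OF xU] by blast
    have "q x = q (f a) \<oplus>\<^bsub>C'\<^esub> q (h c)" using rhomD(2)[OF E2(2) E(6)[OF ac(1)] E2(6)[OF ac(2)]] ac(3) by simp
    also have "\<dots> = q (f a)" using E2(8)[OF ac(2)] C'.M.r_zero[OF E2(7)[OF E(6)[OF ac(1)]]] by simp
    finally show ?thesis using ac(1) by blast
  qed
  have inU: "x \<in> U" if x: "x \<in> carrier M" "a \<in> carrier A" "q x = q (f a)" for x a
  proof -
    have "q (x \<ominus>\<^bsub>M\<^esub> f a) = \<zero>\<^bsub>C'\<^esub>"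
      using rhom_minus[OF E2(2) lm(2,5) x(1) E(6)[OF x(2)]] x(3) C'.M.r_neg[OF E2(7)[OF E(6)[OF x(2)]]]
      by (simp add: a_minus_def)
    then obtain c where c: "c \<in> carrier C" "x \<ominus>\<^bsub>M\<^esub> f a = h c"
      using E2(9)[of "x \<ominus>\<^bsub>M\<^esub> f a"] x(1) E(6)[OF x(2)] by auto
    have "x = f a \<oplus>\<^bsub>M\<^esub> (x \<ominus>\<^bsub>M\<^esub> f a)"
      using x(1) E(6)[OF x(2)] by (simp add: a_minus_def M.M.a_lcomm M.M.r_neg)
    then show ?thesis unfolding U(1) using c x by auto
  qed
  define k where "k = inv_into (carrier A) f"
  have k: "k (f a) = a" if "a \<in> carrier A" for a unfolding k_def using E(3) that by simp
  have khom: "k \<in> rhom R (M\<lparr>carrier := f ` carrier A\<rparr>) A" unfolding k_def by (rule rhom_inv[OF E(1,3) refl lm(1)])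
  have kD: "k \<in> rhom R (M\<lparr>carrier := D\<rparr>) A" using rhom_sub_dom[OF khom, of D] D(1) by simp
  have qfP: "(\<lambda>a. q (f a)) \<in> rhom R A P" unfolding P_def by (rule rhom_sub_cod[OF qf]) simp
  have fz: "f a \<in> D \<longleftrightarrow> q (f a) = \<zero>\<^bsub>C'\<^esub>" if "a \<in> carrier A" for a
    unfolding D(1) using that E2(8) E2(9)[OF E(6)[OF that]] by auto
  have "exact_at R k (\<lambda>a. q (f a)) (M\<lparr>carrier := D\<rparr>) A P"
  proof (rule exactI[OF lD lm(1) kD qfP])
    fix x assume "x \<in> carrier (M\<lparr>carrier := D\<rparr>)"
    then obtain a where a: "a \<in> carrier A" "x = f a" "x \<in> D" using D(1) by auto
    show "k x = \<zero>\<^bsub>A\<^esub> \<Longrightarrow> x = \<zero>\<^bsub>M\<lparr>carrier := D\<rparr>\<^esub>" using a k f0 by simp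
    show "q (f (k x)) = \<zero>\<^bsub>P\<^esub>" using a k[OF a(1)] fz[OF a(1)] Ps(2) by simp
  next
    show "\<exists>y\<in>carrier A. q (f y) = z" if "z \<in> carrier P" for z using that Ps(1) unfolding P0_def by auto
    show "\<exists>x\<in>carrier (M\<lparr>carrier := D\<rparr>). y = k x" if "y \<in> carrier A" "q (f y) = \<zero>\<^bsub>P\<^esub>" for y
      by (rule bexI[of _ "f y"]) (use that k fz Ps(2) in simp_all)
  qed
  then show "S (M\<lparr>carrier := D\<rparr>) A P" by (rule SI[OF _ D(2) o(1) PO])
  have "exact_at R h q C (M\<lparr>carrier := U\<rparr>) P"
  proof (rule exactI[OF lm(4) lU])
    show "h \<in> rhom R C (M\<lparr>carrier := U\<rparr>)" by (rule rhom_sub_cod[OF E2(1)]) (use hU in blast)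
    show "q \<in> rhom R (M\<lparr>carrier := U\<rparr>) P" unfolding P_def
      by (rule rhom_sub_cod[OF rhom_sub_dom[OF E2(2) UM]]) (use qU in auto)
    show "x = \<zero>\<^bsub>C\<^esub>" if "x \<in> carrier C" "h x = \<zero>\<^bsub>M\<lparr>carrier := U\<rparr>\<^esub>" for x
      using exact_inj[OF e2 lm(4,2) that(1)] that(2) by simp
    show "\<exists>y\<in>carrier (M\<lparr>carrier := U\<rparr>). q y = z" if "z \<in> carrier P" for z
      using that Ps(1) fU unfolding P0_def by auto
    show "q (h x) = \<zero>\<^bsub>P\<^esub>" if "x \<in> carrier C" for x using E2(8)[OF that] Ps(2) by simp
    show "\<exists>x\<in>carrier C. y = h x" if "y \<in> carrier (M\<lparr>carrier := U\<rparr>)" "q y = \<zero>\<^bsub>P\<^esub>" for y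
      using E2(9)[of y] that UM Ps(2) by auto
  qed
  then show "S C (M\<lparr>carrier := U\<rparr>) P" by (rule SI[OF _ o(4) U(2) PO])
  obtain r' where r': "r' \<in> rhom R C' Q" "\<And>x. x \<in> carrier M \<Longrightarrow> r' (q x) = r x"
  proof (rule rhom_factor[OF E2(2,4) Q(2) _ lm(2,5) lQ])
    show "r x = \<zero>\<^bsub>Q\<^esub>" if "x \<in> carrier M" "q x = \<zero>\<^bsub>C'\<^esub>" for x
      using E2(9)[OF that] hU Q(4)[OF that(1)] by auto
  qed blast
  have "exact_at R (\<lambda>x. x) r' P C' Q"
  proof (rule exactI[OF lP lm(5) _ r'(1)])
    show "(\<lambda>x. x) \<in> rhom R P C'" unfolding P_def by (rule rhom_id[OF P0C[unfolded P0_def]])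
    show "\<exists>y\<in>carrier C'. r' y = z" if "z \<in> carrier Q" for z
      using rhom_onto_ex[OF Q(2,3) that] r'(2) E2(7) by metis
    show "r' x = \<zero>\<^bsub>Q\<^esub>" if "x \<in> carrier P" for x
      using that Ps(1) r'(2)[OF E(6)] Q(4)[OF E(6)] fU unfolding P0_def by auto
    show "\<exists>x\<in>carrier P. y = x" if y: "y \<in> carrier C'" "r' y = \<zero>\<^bsub>Q\<^esub>" for y
    proof -
      obtain m where m: "m \<in> carrier M" "y = q m" using E2(10)[OF y(1)] by blast
      then have "m \<in> U" using r'(2) Q(4) y(2) by simp
      then show ?thesis using qU m(2) Ps(1) unfolding P0_def by auto
    qed
  qed (use Ps in simp)
  then show "S P C' Q" by (rule SI[OF _ PO o(5) Q(1)])
  have vf: "(\<lambda>a. v (f a)) \<in> rhom R A V" by (rule rhom_comp[OF E(1) V(2)])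
  obtain u where u: "u \<in> rhom R P V" "\<And>a. a \<in> carrier A \<Longrightarrow> u (q (f a)) = v (f a)"
  proof (rule rhom_factor[OF qfP _ vf _ lm(1) lP lV])
    show "(\<lambda>a. q (f a)) ` carrier A = carrier P" using Ps(1) unfolding P0_def by simp
    show "v (f a) = \<zero>\<^bsub>V\<^esub>" if "a \<in> carrier A" "q (f a) = \<zero>\<^bsub>P\<^esub>" for a
      using that fz[OF that(1)] V(4)[OF E(6)[OF that(1)]] Ps(2) by simp
  qed blast
  obtain g' where g': "g' \<in> rhom R V A'" "\<And>x. x \<in> carrier M \<Longrightarrow> g' (v x) = g x"
  proof (rule rhom_factor[OF V(2,3) E(2) _ lm(2) lV lm(3)])
    show "g x = \<zero>\<^bsub>A'\<^esub>" if "x \<in> carrier M" "v x = \<zero>\<^bsub>V\<^esub>" for x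
      using V(4)[OF that(1)] that(2) D(1) E(8) by auto
  qed blast
  have "exact_at R u g' P V A'"
  proof (rule exactI[OF lP lV u(1) g'(1)])
    fix x assume "x \<in> carrier P"
    then obtain a where a: "a \<in> carrier A" "x = q (f a)" using Ps(1) unfolding P0_def by blast
    show "u x = \<zero>\<^bsub>V\<^esub> \<Longrightarrow> x = \<zero>\<^bsub>P\<^esub>" using a u(2)[OF a(1)] V(4)[OF E(6)[OF a(1)]] fz[OF a(1)] Ps(2) by simp
    show "g' (u x) = \<zero>\<^bsub>A'\<^esub>" using a u(2) g'(2)[OF E(6)[OF a(1)]] E(8) by simp
  next
    show "\<exists>y\<in>carrier V. g' y = z" if "z \<in> carrier A'" for z
      using E(10)[OF that] g'(2) rhomD(1)[OF V(2)] by metis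
    fix y assume y: "y \<in> carrier V" "g' y = \<zero>\<^bsub>A'\<^esub>"
    obtain m where m: "m \<in> carrier M" "v m = y" using rhom_onto_ex[OF V(2,3) y(1)] by blast
    then obtain a where a: "a \<in> carrier A" "m = f a" using E(9)[OF m(1)] g'(2) y by auto
    show "\<exists>x\<in>carrier P. y = u x"
      by (rule bexI[of _ "q (f a)"]) (use a m u(2)[OF a(1)] Ps(1) in \<open>auto simp: P0_def\<close>)
  qed
  then show "S P V A'" by (rule SI[OF _ PO V(1) o(3)])
qed

lemma S_two_subs:
  assumes "S A M A'" "S C M C'"
  shows "\<exists>D U V P P' R. S D A P \<and> S D C P' \<and>
      S A U P' \<and> S C U P \<and> S U M R \<and> S P C' R \<and> S P' A' R \<and> S D M V \<and> S P V A' \<and> S P' V C'"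
proof -
  obtain f g where e: "exact_at R f g A M A'" and o: "A \<in> Ob" "M \<in> Ob" "A' \<in> Ob" using assms SE by metis
  obtain h q where e2: "exact_at R h q C M C'" and o2: "C \<in> Ob" "C' \<in> Ob" using assms SE by metis
  note lm = fgD(1)[OF o(1)] fgD(1)[OF o(2)] fgD(1)[OF o(3)] fgD(1)[OF o2(1)] fgD(1)[OF o2(2)]
  interpret M: left_module R M by (rule lm)
  note E = exactD[OF e] and E2 = exactD[OF e2]
  have A0: "left_submodule R (f ` carrier A) M" by (rule image_submodule[OF E(1) lm(1,2) whole_submodule[OF lm(1)]])
  have C0: "left_submodule R (h ` carrier C) M" by (rule image_submodule[OF E2(1) lm(4,2) whole_submodule[OF lm(4)]])
  note A0D = left_submoduleD[OF lm(2) A0] and C0D = left_submoduleD[OF lm(2) C0]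
  define D where "D = f ` carrier A \<inter> h ` carrier C"
  define U where "U = {x \<in> carrier M. \<exists>a\<in>carrier A. \<exists>c\<in>carrier C. x = f a \<oplus>\<^bsub>M\<^esub> h c}"
  have D: "left_submodule R D M" unfolding left_submodule_iff[OF lm(2)]
  proof (intro conjI ballI)
    show "D \<subseteq> carrier M" using A0D(1) unfolding D_def by blast
    show "\<zero>\<^bsub>M\<^esub> \<in> D" using A0D(2) C0D(2) unfolding D_def by blast
    fix x assume x: "x \<in> D"
    show "x \<oplus>\<^bsub>M\<^esub> y \<in> D" if "y \<in> D" for y using x that A0D(3)[of x y] C0D(3)[of x y] unfolding D_def by blast
    show "a \<odot>\<^bsub>M\<^esub> x \<in> D" if "a \<in> carrier R" for a using x A0D(4)[OF that] C0D(4)[OF that] unfolding D_def by blast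
  qed
  \<comment> \<open>The sum of the two images is the preimage of the image of \<open>C\<close> in
    \<open>A'\<close>; this makes it a submodule by the closure lemmas already shown.\<close>
  have "U = {x \<in> carrier M. g x \<in> (\<lambda>c. g (h c)) ` carrier C}"
  proof (intro equalityI subsetI)
    interpret A': left_module R A' by (rule lm)
    fix x
    { assume "x \<in> U"
      then obtain a c where ac: "a \<in> carrier A" "c \<in> carrier C" "x = f a \<oplus>\<^bsub>M\<^esub> h c" "x \<in> carrier M" unfolding U_def by blast
      have "g x = g (h c)" using ac E(8) rhomD(2)[OF E(2) E(6)[OF ac(1)] E2(6)[OF ac(2)]]
          A'.M.l_zero[OF E(7)[OF E2(6)[OF ac(2)]]] by simp
      then show "x \<in> {x \<in> carrier M. g x \<in> (\<lambda>c. g (h c)) ` carrier C}" using ac by simp }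
    { assume "x \<in> {x \<in> carrier M. g x \<in> (\<lambda>c. g (h c)) ` carrier C}"
      then obtain c where c: "c \<in> carrier C" "x \<in> carrier M" "g x = g (h c)" by auto
      have "g (x \<ominus>\<^bsub>M\<^esub> h c) = \<zero>\<^bsub>A'\<^esub>"
        using rhom_minus[OF E(2) lm(2,3) c(2) E2(6)[OF c(1)]] c(3) A'.M.r_neg[OF E(7)[OF c(2)]] by (simp add: a_minus_def)
      then obtain a where a: "a \<in> carrier A" "x \<ominus>\<^bsub>M\<^esub> h c = f a"
        using E(9)[of "x \<ominus>\<^bsub>M\<^esub> h c"] c(2) E2(6)[OF c(1)] by auto
      have "x = (x \<ominus>\<^bsub>M\<^esub> h c) \<oplus>\<^bsub>M\<^esub> h c"
        using c(2) E2(6)[OF c(1)] by (simp add: a_minus_def M.M.a_assoc M.M.l_neg)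
      then show "x \<in> U" unfolding U_def using a c by auto }
  qed
  moreover have "(\<lambda>c. g (h c)) \<in> rhom R C A'" by (rule rhom_comp[OF E2(1) E(2)])
  ultimately have U: "left_submodule R U M"
    using vimage_submodule[OF E(2) lm(2,3) image_submodule[OF _ lm(4,3) whole_submodule[OF lm(4)]]] by simp
  have U': "U = {x \<in> carrier M. \<exists>c\<in>carrier C. \<exists>a\<in>carrier A. x = h c \<oplus>\<^bsub>M\<^esub> f a}"
  proof -
    have c: "f a \<oplus>\<^bsub>M\<^esub> h c = h c \<oplus>\<^bsub>M\<^esub> f a" if "a \<in> carrier A" "c \<in> carrier C" for a c
      using M.M.a_comm E(6)[OF that(1)] E2(6)[OF that(2)] by blast
    show ?thesis unfolding U_def by (rule Collect_cong) (metis c)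
  qed
  have D': "D = h ` carrier C \<inter> f ` carrier A" unfolding D_def by blast
  note UO = sub_fg[OF o(2) U] and DO = sub_fg[OF o(2) D]
  obtain V v where V: "V \<in> Ob" "v \<in> rhom R M V" "v ` carrier M = carrier V"
      "\<And>x. x \<in> carrier M \<Longrightarrow> v x = \<zero>\<^bsub>V\<^esub> \<longleftrightarrow> x \<in> D" using quotient[OF o(2) D] by metis
  obtain Q r where Q: "Q \<in> Ob" "r \<in> rhom R M Q" "r ` carrier M = carrier Q"
      "\<And>x. x \<in> carrier M \<Longrightarrow> r x = \<zero>\<^bsub>Q\<^esub> \<longleftrightarrow> x \<in> U" using quotient[OF o(2) U] by metis
  have "{y \<in> carrier M. v y = \<zero>\<^bsub>V\<^esub>} = D" "{y \<in> carrier M. r y = \<zero>\<^bsub>Q\<^esub>} = U"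
    using V(4) Q(4) left_submoduleD(1)[OF lm(2) D] left_submoduleD(1)[OF lm(2) U] by blast+
  then have "S (M\<lparr>carrier := D\<rparr>) M V" "S (M\<lparr>carrier := U\<rparr>) M Q"
    using S_quot[OF o(2) V(1-3)] S_quot[OF o(2) Q(1-3)] by simp_all
  moreover note two_subs_half[OF e e2 o o2 U_def UO D_def DO V Q]
    two_subs_half[OF e2 e o2(1) o(2) o2(2) o(1,3) U' UO D' DO V Q]
  ultimately show ?thesis by blast
qed

section \<open>Fibre products and amalgamated sums\<close>

lemma transport:
  assumes E: "left_module R (E :: ('r, 'm \<times> 'm) module)" and W: "left_submodule R W E"
  obtains Z :: "('r, 'm) module" and p where "left_module R Z" "p \<in> rhom R E Z" "p ` carrier E = carrier Z"
    "\<And>x. x \<in> carrier E \<Longrightarrow> p x = \<zero>\<^bsub>Z\<^esub> \<longleftrightarrow> x \<in> W"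
  using ex_quotient[OF E W inj_pr] by metis

lemma S_pullback:
  assumes "S Y' X' X" "S Y'' X'' X" shows "\<exists>Z. S Y' Z X'' \<and> S Y'' Z X'"
proof -
  obtain f g where e: "exact_at R f g Y' X' X" and o: "Y' \<in> Ob" "X' \<in> Ob" "X \<in> Ob" using assms SE by metis
  obtain h q where e2: "exact_at R h q Y'' X'' X" and o2: "Y'' \<in> Ob" "X'' \<in> Ob" using assms SE by metis
  note lm = fgD(1)[OF o(1)] fgD(1)[OF o(2)] fgD(1)[OF o(3)] fgD(1)[OF o2(1)] fgD(1)[OF o2(2)]
  note E = exactD[OF e] and E2 = exactD[OF e2]
  interpret X': left_module R X' by (rule lm)
  interpret X'': left_module R X'' by (rule lm)
  define W where "W = {u \<in> carrier X' \<times> carrier X''. g (fst u) = q (snd u)}"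
  have pm: "left_module R (prod_module X' X'')" by (rule prod_left_module[OF lm(2,5)])
  have g0: "g \<zero>\<^bsub>X'\<^esub> = \<zero>\<^bsub>X\<^esub>" "q \<zero>\<^bsub>X''\<^esub> = \<zero>\<^bsub>X\<^esub>" "f \<zero>\<^bsub>Y'\<^esub> = \<zero>\<^bsub>X'\<^esub>" "h \<zero>\<^bsub>Y''\<^esub> = \<zero>\<^bsub>X''\<^esub>"
    using rhom_zero[OF E(2) lm(2,3)] rhom_zero[OF E2(2) lm(5,3)] rhom_zero[OF E(1) lm(1,2)] rhom_zero[OF E2(1) lm(4,5)] .
  have Ws: "left_submodule R W (prod_module X' X'')"
    unfolding left_submodule_iff[OF pm] W_def
    using g0 rhomD[OF E(2)] rhomD[OF E2(2)] X'.lsmult_closed X''.lsmult_closed by auto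
  define E0 where "E0 = (prod_module X' X'')\<lparr>carrier := W\<rparr>"
  have E0: "left_module R E0" unfolding E0_def by (rule left_submoduleD(7)[OF pm Ws])
  have E0s: "carrier E0 = W" "\<zero>\<^bsub>E0\<^esub> = (\<zero>\<^bsub>X'\<^esub>, \<zero>\<^bsub>X''\<^esub>)" unfolding E0_def by simp_all
  \<comment> \<open>Dividing by the zero submodule changes nothing up to isomorphism; its only
    purpose is to move the fibre product from pairs to the carrier type of the modules.\<close>
  obtain Z :: "('r, 'm) module" and p where Z: "left_module R Z" and p: "p \<in> rhom R E0 Z" "p ` carrier E0 = carrier Z"
    "\<And>x. x \<in> carrier E0 \<Longrightarrow> p x = \<zero>\<^bsub>Z\<^esub> \<longleftrightarrow> x \<in> {\<zero>\<^bsub>E0\<^esub>}"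
    using transport[OF E0 zero_submodule[OF E0]] by metis
  have fst: "fst \<in> rhom R E0 X'" and snd: "snd \<in> rhom R E0 X''"
    by (rule rhomI, auto simp: E0_def W_def)+
  obtain p1 where p1: "p1 \<in> rhom R Z X'" "\<And>x. x \<in> carrier E0 \<Longrightarrow> p1 (p x) = fst x"
  proof (rule rhom_factor[OF p(1,2) fst _ E0 Z lm(2)])
    show "fst x = \<zero>\<^bsub>X'\<^esub>" if "x \<in> carrier E0" "p x = \<zero>\<^bsub>Z\<^esub>" for x using p(3)[OF that(1)] that(2) E0s(2) by simp
  qed blast
  obtain p2 where p2: "p2 \<in> rhom R Z X''" "\<And>x. x \<in> carrier E0 \<Longrightarrow> p2 (p x) = snd x"
  proof (rule rhom_factor[OF p(1,2) snd _ E0 Z lm(5)])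
    show "snd x = \<zero>\<^bsub>X''\<^esub>" if "x \<in> carrier E0" "p x = \<zero>\<^bsub>Z\<^esub>" for x using p(3)[OF that(1)] that(2) E0s(2) by simp
  qed blast
  have i1: "(\<lambda>y. (f y, \<zero>\<^bsub>X''\<^esub>)) \<in> rhom R Y' E0"
    by (rule rhomI) (auto simp: E0_def W_def E(6,8) g0 rhomD[OF E(1)] X''.zero_smult)
  have i2: "(\<lambda>y. (\<zero>\<^bsub>X'\<^esub>, h y)) \<in> rhom R Y'' E0"
    by (rule rhomI) (auto simp: E0_def W_def E2(6,8) g0 rhomD[OF E2(1)] X'.zero_smult)
  have Zex: "\<exists>a b. (a, b) \<in> W \<and> z = p (a, b)" if zZ: "z \<in> carrier Z" for z
  proof -
    obtain u where "u \<in> W" "p u = z" using rhom_onto_ex[OF p(1,2) zZ] E0s(1) by auto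
    then show ?thesis by (cases u) auto
  qed
  have "exact_at R (\<lambda>y. p (f y, \<zero>\<^bsub>X''\<^esub>)) p2 Y' Z X''"
  proof (rule exactI[OF lm(1) Z rhom_comp[OF i1 p(1)] p2(1)])
    fix y assume y: "y \<in> carrier Y'"
    note W1 = rhomD(1)[OF i1 y]
    show "p (f y, \<zero>\<^bsub>X''\<^esub>) = \<zero>\<^bsub>Z\<^esub> \<Longrightarrow> y = \<zero>\<^bsub>Y'\<^esub>"
      using p(3)[OF W1] E0s(2) exact_inj[OF e lm(1,2) y] by simp
    show "p2 (p (f y, \<zero>\<^bsub>X''\<^esub>)) = \<zero>\<^bsub>X''\<^esub>" using p2(2)[OF W1] by simp
  next
    show "\<exists>y\<in>carrier Z. p2 y = b" if b: "b \<in> carrier X''" for b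
    proof -
      obtain a where a: "a \<in> carrier X'" "q b = g a" using E(10)[OF E2(7)[OF b]] by blast
      then have w: "(a, b) \<in> carrier E0" using b E0s(1) by (simp add: W_def)
      show ?thesis by (rule bexI[of _ "p (a, b)"]) (use p2(2)[OF w] rhomD(1)[OF p(1) w] in simp_all)
    qed
    fix z assume z: "z \<in> carrier Z" "p2 z = \<zero>\<^bsub>X''\<^esub>"
    then obtain a b where ab: "(a, b) \<in> W" "z = p (a, b)" using Zex by blast
    then have b: "b = \<zero>\<^bsub>X''\<^esub>" using p2(2)[of "(a, b)"] z(2) E0s(1) by simp
    then have "g a = \<zero>\<^bsub>X\<^esub>" "a \<in> carrier X'" using ab(1) g0 by (simp_all add: W_def)
    then obtain y where "y \<in> carrier Y'" "a = f y" using E(9) by blast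
    then show "\<exists>y\<in>carrier Y'. z = p (f y, \<zero>\<^bsub>X''\<^esub>)" using ab(2) b by blast
  qed
  moreover have "exact_at R (\<lambda>y. p (\<zero>\<^bsub>X'\<^esub>, h y)) p1 Y'' Z X'"
  proof (rule exactI[OF lm(4) Z rhom_comp[OF i2 p(1)] p1(1)])
    fix y assume y: "y \<in> carrier Y''"
    note W1 = rhomD(1)[OF i2 y]
    show "p (\<zero>\<^bsub>X'\<^esub>, h y) = \<zero>\<^bsub>Z\<^esub> \<Longrightarrow> y = \<zero>\<^bsub>Y''\<^esub>"
      using p(3)[OF W1] E0s(2) exact_inj[OF e2 lm(4,5) y] by simp
    show "p1 (p (\<zero>\<^bsub>X'\<^esub>, h y)) = \<zero>\<^bsub>X'\<^esub>" using p1(2)[OF W1] by simp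
  next
    show "\<exists>y\<in>carrier Z. p1 y = a" if a: "a \<in> carrier X'" for a
    proof -
      obtain b where b: "b \<in> carrier X''" "g a = q b" using E2(10)[OF E(7)[OF a]] by blast
      then have w: "(a, b) \<in> carrier E0" using a E0s(1) by (simp add: W_def)
      show ?thesis by (rule bexI[of _ "p (a, b)"]) (use p1(2)[OF w] rhomD(1)[OF p(1) w] in simp_all)
    qed
    fix z assume z: "z \<in> carrier Z" "p1 z = \<zero>\<^bsub>X'\<^esub>"
    then obtain a b where ab: "(a, b) \<in> W" "z = p (a, b)" using Zex by blast
    then have a: "a = \<zero>\<^bsub>X'\<^esub>" using p1(2)[of "(a, b)"] z(2) E0s(1) by simp
    then have "q b = \<zero>\<^bsub>X\<^esub>" "b \<in> carrier X''" using ab(1) g0 by (simp_all add: W_def)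
    then obtain y where "y \<in> carrier Y''" "b = h y" using E2(9) by blast
    then show "\<exists>y\<in>carrier Y''. z = p (\<zero>\<^bsub>X'\<^esub>, h y)" using ab(2) a by blast
  qed
  moreover have "Z \<in> Ob" by (rule fg_ext[OF calculation(1) o(1) o2(2) Z])
  ultimately show ?thesis using SI o o2 by blast
qed

lemma S_pushout:
  assumes "S A M N" "S A M' N'" shows "\<exists>Z. S M Z N' \<and> S M' Z N"
proof -
  obtain f g where e: "exact_at R f g A M N" and o: "A \<in> Ob" "M \<in> Ob" "N \<in> Ob" using assms SE by metis
  obtain h q where e2: "exact_at R h q A M' N'" and o2: "M' \<in> Ob" "N' \<in> Ob" using assms SE by metis
  note lm = fgD(1)[OF o(1)] fgD(1)[OF o(2)] fgD(1)[OF o(3)] fgD(1)[OF o2(1)] fgD(1)[OF o2(2)]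
  note E = exactD[OF e] and E2 = exactD[OF e2]
  interpret A: left_module R A by (rule lm)
  interpret M: left_module R M by (rule lm)
  interpret M': left_module R M' by (rule lm)
  interpret N: left_module R N by (rule lm)
  interpret N': left_module R N' by (rule lm)
  define E0 where "E0 = prod_module M M'"
  have E0: "left_module R E0" unfolding E0_def by (rule prod_left_module[OF lm(2,4)])
  interpret E0: left_module R E0 by (rule E0)
  have E0s: "carrier E0 = carrier M \<times> carrier M'" "\<zero>\<^bsub>E0\<^esub> = (\<zero>\<^bsub>M\<^esub>, \<zero>\<^bsub>M'\<^esub>)"
    "u \<oplus>\<^bsub>E0\<^esub> w = (fst u \<oplus>\<^bsub>M\<^esub> fst w, snd u \<oplus>\<^bsub>M'\<^esub> snd w)" for u w unfolding E0_def by simp_all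
  have fh: "(\<lambda>a. (f a, \<ominus>\<^bsub>M'\<^esub> h a)) \<in> rhom R A E0"
    by (rule rhomI) (auto simp: E0_def E(6) E2(6) rhomD[OF E(1)] rhomD[OF E2(1)] M'.M.minus_add M'.smult_minus)
  \<comment> \<open>The antidiagonal copy of \<open>A\<close>. Modulo \<open>W\<close> the two
    images of an element of \<open>A\<close> coincide.\<close>
  define W where "W = (\<lambda>a. (f a, \<ominus>\<^bsub>M'\<^esub> h a)) ` carrier A"
  have Ws: "left_submodule R W E0" unfolding W_def by (rule image_submodule[OF fh lm(1) E0 whole_submodule[OF lm(1)]])
  obtain Z :: "('r, 'm) module" and p where Z: "left_module R Z" and p: "p \<in> rhom R E0 Z" "p ` carrier E0 = carrier Z"
    "\<And>x. x \<in> carrier E0 \<Longrightarrow> p x = \<zero>\<^bsub>Z\<^esub> \<longleftrightarrow> x \<in> W"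
    using transport[OF E0 Ws] by metis
  interpret Z: left_module R Z by (rule Z)
  have z: "f \<zero>\<^bsub>A\<^esub> = \<zero>\<^bsub>M\<^esub>" "h \<zero>\<^bsub>A\<^esub> = \<zero>\<^bsub>M'\<^esub>" "g \<zero>\<^bsub>M\<^esub> = \<zero>\<^bsub>N\<^esub>" "q \<zero>\<^bsub>M'\<^esub> = \<zero>\<^bsub>N'\<^esub>"
    using rhom_zero[OF E(1) lm(1,2)] rhom_zero[OF E2(1) lm(1,4)] rhom_zero[OF E(2) lm(2,3)] rhom_zero[OF E2(2) lm(4,5)] .
  have W0: "p (f a, \<ominus>\<^bsub>M'\<^esub> h a) = \<zero>\<^bsub>Z\<^esub>" if "a \<in> carrier A" for a
    using p(3)[OF rhomD(1)[OF fh that]] that unfolding W_def by blast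
  have gfst: "(\<lambda>u. g (fst u)) \<in> rhom R E0 N" "(\<lambda>u. q (snd u)) \<in> rhom R E0 N'"
    by (rule rhomI, auto simp: E0_def rhomD[OF E(2)] rhomD[OF E2(2)])+
  obtain p1 where p1: "p1 \<in> rhom R Z N" "\<And>x. x \<in> carrier E0 \<Longrightarrow> p1 (p x) = g (fst x)"
  proof (rule rhom_factor[OF p(1,2) gfst(1) _ E0 Z lm(3)])
    show "g (fst x) = \<zero>\<^bsub>N\<^esub>" if "x \<in> carrier E0" "p x = \<zero>\<^bsub>Z\<^esub>" for x
      using p(3)[OF that(1)] that(2) E(8) unfolding W_def by auto
  qed blast
  have qh: "q (\<ominus>\<^bsub>M'\<^esub> h a) = \<zero>\<^bsub>N'\<^esub>" if a: "a \<in> carrier A" for a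
  proof -
    have "\<ominus>\<^bsub>N'\<^esub> \<zero>\<^bsub>N'\<^esub> = \<zero>\<^bsub>N'\<^esub>" by (rule N'.M.minus_equality) auto
    then show ?thesis using rhom_neg[OF E2(2) lm(4,5) E2(6)[OF a]] E2(8)[OF a] by simp
  qed
  obtain p2 where p2: "p2 \<in> rhom R Z N'" "\<And>x. x \<in> carrier E0 \<Longrightarrow> p2 (p x) = q (snd x)"
  proof (rule rhom_factor[OF p(1,2) gfst(2) _ E0 Z lm(5)])
    show "q (snd x) = \<zero>\<^bsub>N'\<^esub>" if "x \<in> carrier E0" "p x = \<zero>\<^bsub>Z\<^esub>" for x
      using p(3)[OF that(1)] that(2) qh unfolding W_def by auto
  qed blast
  have i1: "(\<lambda>m. (m, \<zero>\<^bsub>M'\<^esub>)) \<in> rhom R M E0" by (rule rhomI) (auto simp: E0_def M'.zero_smult)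
  have i2: "(\<lambda>m. (\<zero>\<^bsub>M\<^esub>, m)) \<in> rhom R M' E0" by (rule rhomI) (auto simp: E0_def M.zero_smult)
  have Zex: "\<exists>a b. a \<in> carrier M \<and> b \<in> carrier M' \<and> z = p (a, b)" if zZ: "z \<in> carrier Z" for z
  proof -
    obtain u where "u \<in> carrier E0" "p u = z" using rhom_onto_ex[OF p(1,2) zZ] by auto
    then show ?thesis using E0s(1) by (cases u) auto
  qed
  \<comment> \<open>Shifting a pair by an element of the antidiagonal keeps its class. This is used
    to clear one coordinate when an element of a kernel is traced back.\<close>
  have padd: "p (a \<oplus>\<^bsub>M\<^esub> f x, b \<ominus>\<^bsub>M'\<^esub> h x) = p (a, b)" if "a \<in> carrier M" "b \<in> carrier M'" "x \<in> carrier A" for a b x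
  proof -
    have "p ((a, b) \<oplus>\<^bsub>E0\<^esub> (f x, \<ominus>\<^bsub>M'\<^esub> h x)) = p (a, b) \<oplus>\<^bsub>Z\<^esub> p (f x, \<ominus>\<^bsub>M'\<^esub> h x)"
      by (rule rhomD(2)[OF p(1)]) (use that E(6) E2(6) E0s(1) in auto)
    also have "\<dots> = p (a, b)" using W0[OF that(3)] rhomD(1)[OF p(1), of "(a, b)"] that E0s(1) by simp
    finally show ?thesis by (simp add: E0s(3) a_minus_def)
  qed
  have "exact_at R (\<lambda>m. p (m, \<zero>\<^bsub>M'\<^esub>)) p2 M Z N'"
  proof (rule exactI[OF lm(2) Z rhom_comp[OF i1 p(1)] p2(1)])
    fix m assume m: "m \<in> carrier M"
    note W1 = rhomD(1)[OF i1 m]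
    show "p2 (p (m, \<zero>\<^bsub>M'\<^esub>)) = \<zero>\<^bsub>N'\<^esub>" using p2(2)[OF W1] z by simp
    assume "p (m, \<zero>\<^bsub>M'\<^esub>) = \<zero>\<^bsub>Z\<^esub>"
    then obtain a where a: "a \<in> carrier A" "m = f a" "\<ominus>\<^bsub>M'\<^esub> h a = \<zero>\<^bsub>M'\<^esub>"
      using p(3)[OF W1] unfolding W_def by auto
    have "h a = \<zero>\<^bsub>M'\<^esub>" using a(3) M'.M.r_neg[OF E2(6)[OF a(1)]] M'.M.r_zero[OF E2(6)[OF a(1)]] by simp
    then show "m = \<zero>\<^bsub>M\<^esub>" using exact_inj[OF e2 lm(1,4) a(1)] a(2) z by simp
  next
    show "\<exists>y\<in>carrier Z. p2 y = n" if n: "n \<in> carrier N'" for n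
    proof -
      obtain b where b: "b \<in> carrier M'" "n = q b" using E2(10)[OF n] by blast
      note w = rhomD(1)[OF i2 b(1)]
      show ?thesis by (rule bexI[of _ "p (\<zero>\<^bsub>M\<^esub>, b)"]) (use p2(2)[OF w] rhomD(1)[OF p(1) w] b in simp_all)
    qed
    fix y assume y: "y \<in> carrier Z" "p2 y = \<zero>\<^bsub>N'\<^esub>"
    then obtain a b where ab: "a \<in> carrier M" "b \<in> carrier M'" "y = p (a, b)" using Zex by blast
    then have "q b = \<zero>\<^bsub>N'\<^esub>" using p2(2)[of "(a, b)"] y(2) E0s(1) by simp
    then obtain x where x: "x \<in> carrier A" "b = h x" using E2(9)[OF ab(2)] by blast
    have "p (a \<oplus>\<^bsub>M\<^esub> f x, b \<ominus>\<^bsub>M'\<^esub> h x) = y" using padd[OF ab(1,2) x(1)] ab(3) by simp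
    moreover have "b \<ominus>\<^bsub>M'\<^esub> h x = \<zero>\<^bsub>M'\<^esub>" using x ab(2) by (simp add: a_minus_def M'.M.r_neg)
    ultimately show "\<exists>m\<in>carrier M. y = p (m, \<zero>\<^bsub>M'\<^esub>)"
      by (intro bexI[of _ "a \<oplus>\<^bsub>M\<^esub> f x"]) (use ab(1) E(6)[OF x(1)] in simp_all)
  qed
  moreover have "exact_at R (\<lambda>m. p (\<zero>\<^bsub>M\<^esub>, m)) p1 M' Z N"
  proof (rule exactI[OF lm(4) Z rhom_comp[OF i2 p(1)] p1(1)])
    fix m assume m: "m \<in> carrier M'"
    note W1 = rhomD(1)[OF i2 m]
    show "p1 (p (\<zero>\<^bsub>M\<^esub>, m)) = \<zero>\<^bsub>N\<^esub>" using p1(2)[OF W1] z by simp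
    assume "p (\<zero>\<^bsub>M\<^esub>, m) = \<zero>\<^bsub>Z\<^esub>"
    then obtain a where a: "a \<in> carrier A" "f a = \<zero>\<^bsub>M\<^esub>" "m = \<ominus>\<^bsub>M'\<^esub> h a"
      using p(3)[OF W1] unfolding W_def by auto
    have "a = \<zero>\<^bsub>A\<^esub>" using exact_inj[OF e lm(1,2) a(1,2)] .
    moreover have "\<ominus>\<^bsub>M'\<^esub> \<zero>\<^bsub>M'\<^esub> = \<zero>\<^bsub>M'\<^esub>" by (rule M'.M.minus_equality) auto
    ultimately show "m = \<zero>\<^bsub>M'\<^esub>" using a(3) z by simp
  next
    show "\<exists>y\<in>carrier Z. p1 y = n" if n: "n \<in> carrier N" for n
    proof -
      obtain b where b: "b \<in> carrier M" "n = g b" using E(10)[OF n] by blast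
      note w = rhomD(1)[OF i1 b(1)]
      show ?thesis by (rule bexI[of _ "p (b, \<zero>\<^bsub>M'\<^esub>)"]) (use p1(2)[OF w] rhomD(1)[OF p(1) w] b in simp_all)
    qed
    fix y assume y: "y \<in> carrier Z" "p1 y = \<zero>\<^bsub>N\<^esub>"
    then obtain a b where ab: "a \<in> carrier M" "b \<in> carrier M'" "y = p (a, b)" using Zex by blast
    then have "g a = \<zero>\<^bsub>N\<^esub>" using p1(2)[of "(a, b)"] y(2) E0s(1) by simp
    then obtain x where x: "x \<in> carrier A" "a = f x" using E(9)[OF ab(1)] by blast
    have nx: "\<ominus>\<^bsub>A\<^esub> x \<in> carrier A" using x by simp
    have "p (a \<oplus>\<^bsub>M\<^esub> f (\<ominus>\<^bsub>A\<^esub> x), b \<ominus>\<^bsub>M'\<^esub> h (\<ominus>\<^bsub>A\<^esub> x)) = y" using padd[OF ab(1,2) nx] ab(3) by simp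
    moreover have "a \<oplus>\<^bsub>M\<^esub> f (\<ominus>\<^bsub>A\<^esub> x) = \<zero>\<^bsub>M\<^esub>"
      using rhom_neg[OF E(1) lm(1,2) x(1)] x ab(1) by (simp add: M.M.r_neg)
    ultimately show "\<exists>m\<in>carrier M'. y = p (\<zero>\<^bsub>M\<^esub>, m)"
      by (intro bexI[of _ "b \<ominus>\<^bsub>M'\<^esub> h (\<ominus>\<^bsub>A\<^esub> x)"]) (use ab(2) E2(6)[OF nx] in simp_all)
  qed
  moreover have "Z \<in> Ob" by (rule fg_ext[OF calculation(1) o(2) o2(2) Z])
  ultimately show ?thesis using SI o o2 by blast
qed

lemma sequences: "short_exact_sequences Ob S isom d"
proof (rule short_exact_sequences.intro)
  show "S L M N \<Longrightarrow> L \<in> Ob \<and> M \<in> Ob \<and> N \<in> Ob" for L M N by (simp add: S_def)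
  show "S L M N \<Longrightarrow> d M = d L + d N" for L M N by (rule S_d)
  show "M \<in> Ob \<Longrightarrow> isom M M" for M by (rule isom_refl)
  show "isom M N \<Longrightarrow> isom N M" for M N by (rule isom_sym)
  show "S L M N \<Longrightarrow> isom L L' \<Longrightarrow> isom M M' \<Longrightarrow> isom N N' \<Longrightarrow> S L' M' N'" for L L' M M' N N' by (rule S_isom)
  show "S L M N \<Longrightarrow> d L = 0 \<Longrightarrow> isom M N" for L M N by (rule S_zero_sub)
  show "S L M N \<Longrightarrow> d N = 0 \<Longrightarrow> isom L M" for L M N by (rule S_zero_quot)
  show "M \<in> Ob \<Longrightarrow> \<exists>Z. S Z M M \<and> d Z = 0" for M by (rule S_zero_ex)
  show "M \<in> Ob \<Longrightarrow> \<exists>Z. S M M Z \<and> d Z = 0" for M by (rule S_zero_ex)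
qed (rule S_preimage S_quotient_sub S_two_subs S_pullback S_pushout; assumption)+

end

subsection \<open>Modules over a bound quiver algebra\<close>

lemma field_field_ring: "field (field_ring :: 'k::field ring)"
proof -
  interpret cring "field_ring :: 'k ring"
  proof (rule cringI)
    show "abelian_group (field_ring :: 'k ring)"
      by (rule abelian_groupI) (auto simp: algebra_simps intro: exI[of _ "- x" for x] left_minus)
    show "Group.comm_monoid (field_ring :: 'k ring)" by (rule comm_monoidI) (auto simp: algebra_simps)
  qed (auto simp: algebra_simps)
  show ?thesis
    by (rule cring_fieldI) (auto simp: Units_def intro: exI[of _ "inverse x" for x] left_inverse)
qed

text \<open>Independent subsets of \<open>W\<close> remain independent in \<open>V\<close>, so their
  size is bounded; one that is maximal under inclusion spans \<open>W\<close>.\<close>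

lemma (in vectorspace) fin_dim_subspace:
  assumes fd: "fin_dim" and W: "subspace K W V"
  shows "vectorspace.fin_dim K (vs W)"
proof -
  interpret W: vectorspace K "vs W" by (rule subspace_is_vs[OF W])
  have sm: "submodule K W V" using W by (simp add: subspace_def)
  have WV: "W \<subseteq> carrier V" using sm by (simp add: submodule_def)
  have small: "finite A \<and> card A \<le> dim" if A: "A \<subseteq> W \<and> W.lin_indpt A" for A
  proof -
    have "lin_indpt A" using span_li_not_depend(2)[of A W] A sm by blast
    then show ?thesis using li_le_dim[OF fd, of A] A WV by blast
  qed
  have "W.lin_indpt {}" unfolding W.lin_dep_def by auto
  then obtain A where A: "finite A" "maximal A (\<lambda>S. S \<subseteq> carrier (vs W) \<and> W.lin_indpt S)"
    using maximal_exists[of "\<lambda>S. S \<subseteq> carrier (vs W) \<and> W.lin_indpt S" "dim" "{}"] small by auto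
  then show ?thesis using W.max_li_is_gen[OF A(2)] unfolding W.fin_dim_def maximal_def by blast
qed

text \<open>Rank-nullity for \<open>g\<close>, whose kernel is isomorphic to \<open>U\<close>
  through \<open>f\<close>.\<close>

lemma dim_exact:
  assumes f: "linear_map K U V f" "inj_on f (carrier U)" and g: "linear_map K V W g" "g ` carrier V = carrier W"
    and fg: "f ` carrier U = {y \<in> carrier V. g y = \<zero>\<^bsub>W\<^esub>}"
    and fd: "vectorspace.fin_dim K U" "vectorspace.fin_dim K V"
  shows "vectorspace.dim K V = vectorspace.dim K U + vectorspace.dim K W"
proof -
  interpret f: linear_map K U V f by (rule f)
  interpret g: linear_map K V W g by (rule g)
  have ker: "g.ker = f ` carrier U" unfolding g.ker_def fg by simp
  interpret k: vectorspace K "V\<lparr>carrier := g.ker\<rparr>"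
    using vectorspace.subspace_is_vs[OF _ g.kerT_is_subspace] g by (simp add: linear_map_def)
  interpret fk: linear_map K U "V\<lparr>carrier := g.ker\<rparr>" f
  proof unfold_locales
    show "f \<in> LinearCombinations.module_hom K U (V\<lparr>carrier := g.ker\<rparr>)"
      using f.f_hom ker unfolding LinearCombinations.module_hom_def by auto
  qed
  have "vectorspace.dim K U = vectorspace.dim K (V\<lparr>carrier := g.ker\<rparr>)"
    using fk.dim_eq[OF fd(1) f(2)] ker by simp
  moreover have "g.im = carrier W" by (rule g.surj_imp_imT_carrier[OF g(2)])
  then have "W\<lparr>carrier := g.im\<rparr> = W" by simp
  ultimately show ?thesis using g.rank_nullity[OF fd(2)] by simp
qed

lemma (in vectorspace) dim0_trivial:
  assumes "fin_dim" "dim = 0" shows "carrier V = {\<zero>\<^bsub>V\<^esub>}"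
proof -
  obtain B where B: "finite B" "basis B" using finite_basis_exists assms by blast
  then have "card B = 0" using dim_basis[of B] assms by simp
  then have "B = {}" using B by simp
  then show ?thesis using B(2) span_empty unfolding basis_def by simp
qed

section \<open>The path algebra and its quotient\<close>

locale bound_quiver_algebra =
  fixes Q :: "('v::finite, 'a) pre_digraph" and I :: "(('v, 'a) qpath \<Rightarrow> 'k::field) set"
  assumes bq: "bound_quiver Q I"
begin

abbreviation PA :: "(('v, 'a) qpath \<Rightarrow> 'k) ring" where "PA \<equiv> path_algebra Q"
abbreviation A :: "('v, 'a, 'k) bqa ring" where "A \<equiv> bq_algebra Q I"

sublocale fin_digraph Q using bq by (simp add: bound_quiver_def)
sublocale PA: ideal I PA using bq by (simp add: bound_quiver_def admissible_ideal_def)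

lemma verts_Q: "verts Q = UNIV" using bq by (simp add: bound_quiver_def)

lemma PA_simps: "carrier PA = {f. finite {p. f p \<noteq> 0} \<and> {p. f p \<noteq> 0} \<subseteq> qpaths Q}"
  "f \<oplus>\<^bsub>PA\<^esub> g = (\<lambda>p. f p + g p)" "\<zero>\<^bsub>PA\<^esub> = (\<lambda>_. 0)" "\<one>\<^bsub>PA\<^esub> = pa_scalar Q 1"
  "(f \<otimes>\<^bsub>PA\<^esub> g) (u, p) = (\<Sum>i\<le>length p. f (path_end Q (u, take i p), drop i p) * g (u, take i p))"
  by (simp_all add: path_algebra_def)

lemma end_Nil: "path_end Q (u, []) = u" by (simp add: path_end_def)

lemma qpaths_Nil: "(u, []) \<in> qpaths Q"
  by (simp add: qpaths_def awalk_Nil_iff verts_Q end_Nil)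

lemma qpaths_append: "(u, p @ p') \<in> qpaths Q \<longleftrightarrow> (u, p) \<in> qpaths Q \<and> (path_end Q (u, p), p') \<in> qpaths Q"
  by (simp add: qpaths_def path_end_def awlast_append)

lemma qpaths_Cons: "(u, a # p) \<in> qpaths Q \<longleftrightarrow> a \<in> arcs Q \<and> u = tail Q a \<and> (head Q a, p) \<in> qpaths Q"
  by (auto simp: qpaths_def path_end_def awalk_Cons_iff)

lemma scalar_carrier: "pa_scalar Q c \<in> carrier PA"
proof -
  have "{p. pa_scalar Q c p \<noteq> 0} \<subseteq> (\<lambda>u. (u, [])) ` UNIV" by (auto simp: pa_scalar_def split: if_splits)
  then show ?thesis using qpaths_Nil by (auto simp: PA_simps intro: finite_subset)
qed

lemma path_carrier: "q \<in> qpaths Q \<Longrightarrow> pa_path q \<in> carrier PA"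
  by (simp add: PA_simps pa_path_def)

lemma scalar_mult: "pa_scalar Q c \<otimes>\<^bsub>PA\<^esub> f = (\<lambda>p. c * f p)"
proof (rule ext, clarify)
  fix u p
  have "(pa_scalar Q c \<otimes>\<^bsub>PA\<^esub> f) (u, p) = (\<Sum>i\<le>length p. if i = length p then c * f (u, p) else 0)"
    unfolding PA_simps by (rule sum.cong) (auto simp: pa_scalar_def verts_Q)
  then show "(pa_scalar Q c \<otimes>\<^bsub>PA\<^esub> f) (u, p) = c * f (u, p)" by simp
qed

lemma mult_scalar: "f \<otimes>\<^bsub>PA\<^esub> pa_scalar Q c = (\<lambda>p. c * f p)"
proof (rule ext, clarify)
  fix u p
  have "(f \<otimes>\<^bsub>PA\<^esub> pa_scalar Q c) (u, p) = (\<Sum>i\<le>length p. if i = 0 then c * f (u, p) else 0)"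
    unfolding PA_simps by (rule sum.cong) (auto simp: pa_scalar_def verts_Q end_Nil)
  then show "(f \<otimes>\<^bsub>PA\<^esub> pa_scalar Q c) (u, p) = c * f (u, p)" by simp
qed

text \<open>The sum over all cuts of a path has at most one nonzero term, the cut at
  \<open>length p\<close>.\<close>

lemma path_mult: "pa_path (w, p') \<otimes>\<^bsub>PA\<^esub> pa_path (u, p) =
  (if w = path_end Q (u, p) then pa_path (u, p @ p') else (\<lambda>_. 0))"
proof (rule ext, clarify)
  fix u' s
  have t: "pa_path (w, p') (path_end Q (u', take i s), drop i s) * pa_path (u, p) (u', take i s) =
    (if i = length p then if w = path_end Q (u, p) \<and> (u', s) = (u, p @ p') then 1 else 0 else (0::'k))"
    if "i \<le> length s" for i
  proof -
    have eq: "(path_end Q (u', take i s), drop i s) = (w, p') \<and> (u', take i s) = (u, p) \<longleftrightarrow>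
        i = length p \<and> w = path_end Q (u, p) \<and> (u', s) = (u, p @ p')" (is "?X \<and> ?Y \<longleftrightarrow> ?R")
    proof
      assume xy: "?X \<and> ?Y"
      then have "s = p @ p'" using append_take_drop_id[of i s] by simp
      moreover have "i = length p" using xy that by (auto simp: min_def)
      ultimately show ?R using xy by auto
    next
      assume ?R
      then show "?X \<and> ?Y" by simp
    qed
    show ?thesis
    proof (cases "?X \<and> ?Y")
      case True
      then have R: ?R using eq by blast
      show ?thesis using True R unfolding pa_path_def by simp
    next
      case False
      then have nR: "\<not> ?R" using eq by blast
      have "pa_path (w, p') (path_end Q (u', take i s), drop i s) * pa_path (u, p) (u', take i s) = (0::'k)"
        using False unfolding pa_path_def
        by (cases ?X; cases ?Y) (simp_all only: if_True if_False mult_zero_left mult_zero_right simp_thms)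
      also have "0 = (if i = length p then if w = path_end Q (u, p) \<and> (u', s) = (u, p @ p') then 1 else 0 else (0::'k))"
        using nR by argo
      finally show ?thesis .
    qed
  qed
  have "(pa_path (w, p') \<otimes>\<^bsub>PA\<^esub> pa_path (u, p)) (u', s) =
    (\<Sum>i\<le>length s. if i = length p then if w = path_end Q (u, p) \<and> (u', s) = (u, p @ p') then 1 else 0 else (0::'k))"
    unfolding PA_simps by (rule sum.cong[OF refl]) (use t in simp)
  also have "\<dots> = (if w = path_end Q (u, p) \<and> (u', s) = (u, p @ p') then 1 else 0)" by auto
  finally show "(pa_path (w, p') \<otimes>\<^bsub>PA\<^esub> pa_path (u, p)) (u', s) =
    (if w = path_end Q (u, p) then pa_path (u, p @ p') else (\<lambda>_. 0)) (u', s)" by (simp add: pa_path_def)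
qed

text \<open>Paths span the path algebra, so an additive property need be checked only on scalar
  multiples of paths; the support is emptied one path at a time.\<close>

lemma pa_induct [consumes 1, case_names path add]:
  assumes f: "f \<in> carrier PA"
    and path: "\<And>c q. q \<in> qpaths Q \<Longrightarrow> P (pa_scalar Q c \<otimes>\<^bsub>PA\<^esub> pa_path q)"
    and add: "\<And>f g. f \<in> carrier PA \<Longrightarrow> g \<in> carrier PA \<Longrightarrow> P f \<Longrightarrow> P g \<Longrightarrow> P (f \<oplus>\<^bsub>PA\<^esub> g)"
  shows "P f"
proof -
  have "P f" if "finite X" "{p. f p \<noteq> 0} \<subseteq> X" "X \<subseteq> qpaths Q" for f and X :: "('v, 'a) qpath set"
    using that
  proof (induction X arbitrary: f rule: finite_induct)
    case empty
    \<comment> \<open>The zero element is written as 0 times a trivial path, at an arbitrary vertex,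
      so that \<open>path\<close> covers it.\<close>
    then have "f = pa_scalar Q 0 \<otimes>\<^bsub>PA\<^esub> pa_path (undefined, [])" by (auto simp: scalar_mult)
    then show ?case using path[OF qpaths_Nil] by simp
  next
    case (insert q X)
    define g where "g = f(q := 0)"
    have g: "{p. g p \<noteq> 0} \<subseteq> X" using insert.prems(1) by (auto simp: g_def)
    then have "g \<in> carrier PA" using insert by (auto simp: PA_simps intro: finite_subset)
    moreover have "P g" by (rule insert.IH[OF g]) (use insert.prems in blast)
    moreover have q: "q \<in> qpaths Q" using insert.prems by blast
    moreover have "pa_scalar Q (f q) \<otimes>\<^bsub>PA\<^esub> pa_path q \<in> carrier PA"
      using scalar_carrier path_carrier[OF q] by (rule PA.m_closed)
    ultimately have "P (g \<oplus>\<^bsub>PA\<^esub> (pa_scalar Q (f q) \<otimes>\<^bsub>PA\<^esub> pa_path q))" using add path by blast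
    moreover have "g \<oplus>\<^bsub>PA\<^esub> (pa_scalar Q (f q) \<otimes>\<^bsub>PA\<^esub> pa_path q) = f"
      by (auto simp: PA_simps scalar_mult pa_path_def g_def)
    ultimately show ?case by simp
  qed
  then show ?thesis using f by (auto simp: PA_simps)
qed

lemma coset_simps:
  "f \<in> carrier PA \<Longrightarrow> I +>\<^bsub>PA\<^esub> f \<in> carrier A"
  "f \<in> carrier PA \<Longrightarrow> g \<in> carrier PA \<Longrightarrow> I +>\<^bsub>PA\<^esub> (f \<oplus>\<^bsub>PA\<^esub> g) = (I +>\<^bsub>PA\<^esub> f) \<oplus>\<^bsub>A\<^esub> (I +>\<^bsub>PA\<^esub> g)"
  "f \<in> carrier PA \<Longrightarrow> g \<in> carrier PA \<Longrightarrow> I +>\<^bsub>PA\<^esub> (f \<otimes>\<^bsub>PA\<^esub> g) = (I +>\<^bsub>PA\<^esub> f) \<otimes>\<^bsub>A\<^esub> (I +>\<^bsub>PA\<^esub> g)"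
  "I +>\<^bsub>PA\<^esub> pa_scalar Q 1 = \<one>\<^bsub>A\<^esub>"
  using ring_hom_memE[OF PA.rcos_ring_hom] by (auto simp: PA_simps)

lemma coset_ex: "a \<in> carrier A \<Longrightarrow> \<exists>f\<in>carrier PA. a = I +>\<^bsub>PA\<^esub> f"
  by (auto simp: FactRing_def A_RCOSETS_def RCOSETS_def a_r_coset_def)

lemma coset_zero: "f \<in> I \<Longrightarrow> I +>\<^bsub>PA\<^esub> f = \<zero>\<^bsub>A\<^esub>"
  by (simp add: PA.a_rcos_const FactRing_def)

section \<open>Action of the path algebra on modules, and their underlying vector spaces\<close>

definition act :: "('v, 'a, 'k) bq_module \<Rightarrow> (('v, 'a) qpath \<Rightarrow> 'k) \<Rightarrow> (nat \<Rightarrow> 'k) \<Rightarrow> (nat \<Rightarrow> 'k)" where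
  "act M f x = (I +>\<^bsub>PA\<^esub> f) \<odot>\<^bsub>M\<^esub> x"

definition kspace :: "('v, 'a, 'k) bq_module \<Rightarrow> ('k, nat \<Rightarrow> 'k) module" where
  "kspace M = \<lparr>carrier = carrier M, mult = mult M, one = one M, zero = zero M, add = add M,
     smult = (\<lambda>c x. act M (pa_scalar Q c) x)\<rparr>"

lemma kspace_simps [simp]: "carrier (kspace M) = carrier M" "\<zero>\<^bsub>kspace M\<^esub> = \<zero>\<^bsub>M\<^esub>"
  "x \<oplus>\<^bsub>kspace M\<^esub> y = x \<oplus>\<^bsub>M\<^esub> y" "c \<odot>\<^bsub>kspace M\<^esub> x = act M (pa_scalar Q c) x"
  by (simp_all add: kspace_def)

lemma kspace_sub: "kspace (M\<lparr>carrier := L\<rparr>) = (kspace M)\<lparr>carrier := L\<rparr>"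
  by (simp add: kspace_def act_def)

lemma act_sub: "act (M\<lparr>carrier := L\<rparr>) f x = act M f x"
  by (simp add: act_def)

lemma vertex_space_eq: "vertex_space Q I M v = (kspace M)\<lparr>carrier := act M (pa_path (v, [])) ` carrier M\<rparr>"
  by (simp add: vertex_space_def kspace_def act_def)

context
  fixes M :: "('v, 'a, 'k) bq_module"
  assumes M: "left_module A M"
begin

interpretation M: left_module A M by (rule M)

lemma act_closed: "f \<in> carrier PA \<Longrightarrow> x \<in> carrier M \<Longrightarrow> act M f x \<in> carrier M"
  unfolding act_def by (intro M.lsmult_closed coset_simps)

lemma act_add: "f \<in> carrier PA \<Longrightarrow> g \<in> carrier PA \<Longrightarrow> x \<in> carrier M \<Longrightarrow>
    act M (f \<oplus>\<^bsub>PA\<^esub> g) x = act M f x \<oplus>\<^bsub>M\<^esub> act M g x"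
  unfolding act_def by (simp add: coset_simps(2)[of f g] M.lsmult_l_distr coset_simps(1))

lemma act_plus: "f \<in> carrier PA \<Longrightarrow> x \<in> carrier M \<Longrightarrow> y \<in> carrier M \<Longrightarrow>
    act M f (x \<oplus>\<^bsub>M\<^esub> y) = act M f x \<oplus>\<^bsub>M\<^esub> act M f y"
  unfolding act_def by (simp add: M.lsmult_r_distr coset_simps(1))

lemma act_mult: "f \<in> carrier PA \<Longrightarrow> g \<in> carrier PA \<Longrightarrow> x \<in> carrier M \<Longrightarrow>
    act M (f \<otimes>\<^bsub>PA\<^esub> g) x = act M f (act M g x)"
  unfolding act_def by (simp add: coset_simps(3)[of f g] M.lsmult_assoc coset_simps(1))

lemma act_one: "x \<in> carrier M \<Longrightarrow> act M (pa_scalar Q 1) x = x"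
  unfolding act_def coset_simps(4) by (rule M.lsmult_one)

lemma act_I: "f \<in> I \<Longrightarrow> x \<in> carrier M \<Longrightarrow> act M f x = \<zero>\<^bsub>M\<^esub>"
  unfolding act_def by (simp add: coset_zero M.smult_zero)

lemma act_0: "x \<in> carrier M \<Longrightarrow> act M (\<lambda>_. 0) x = \<zero>\<^bsub>M\<^esub>"
  using act_I[OF additive_subgroup.zero_closed[OF PA.is_additive_subgroup]] by (simp add: PA_simps)

lemma act_zero: "f \<in> carrier PA \<Longrightarrow> act M f \<zero>\<^bsub>M\<^esub> = \<zero>\<^bsub>M\<^esub>"
  unfolding act_def by (intro M.zero_smult coset_simps)

lemma act_scalar_comm: "f \<in> carrier PA \<Longrightarrow> x \<in> carrier M \<Longrightarrow>
    act M f (act M (pa_scalar Q c) x) = act M (pa_scalar Q c) (act M f x)"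
  using act_mult[OF _ scalar_carrier] act_mult[OF scalar_carrier] by (simp add: scalar_mult mult_scalar flip: act_mult)

lemma kspace_vs: "vectorspace field_ring (kspace M)"
proof (rule vs_criteria)
  show "field field_ring" by (rule field_field_ring)
  have sadd: "pa_scalar Q (a + b) = pa_scalar Q a \<oplus>\<^bsub>PA\<^esub> pa_scalar Q b"
    and smul: "pa_scalar Q (a * b) = pa_scalar Q a \<otimes>\<^bsub>PA\<^esub> pa_scalar Q b" for a b :: 'k
    by (auto simp: scalar_mult PA_simps) (auto simp: pa_scalar_def)
  show "\<forall>v\<in>carrier (kspace M). \<exists>neg_v\<in>carrier (kspace M). v \<oplus>\<^bsub>kspace M\<^esub> neg_v = \<zero>\<^bsub>kspace M\<^esub>"
    using M.M.r_neg M.M.a_inv_closed by auto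
  show "\<forall>a b v. a \<in> carrier field_ring \<and> b \<in> carrier field_ring \<and> v \<in> carrier (kspace M) \<longrightarrow>
      (a \<otimes>\<^bsub>field_ring\<^esub> b) \<odot>\<^bsub>kspace M\<^esub> v = a \<odot>\<^bsub>kspace M\<^esub> (b \<odot>\<^bsub>kspace M\<^esub> v)"
    by (simp add: smul act_mult scalar_carrier)
  show "\<forall>a b v. a \<in> carrier field_ring \<and> b \<in> carrier field_ring \<and> v \<in> carrier (kspace M) \<longrightarrow>
      (a \<oplus>\<^bsub>field_ring\<^esub> b) \<odot>\<^bsub>kspace M\<^esub> v = a \<odot>\<^bsub>kspace M\<^esub> v \<oplus>\<^bsub>kspace M\<^esub> b \<odot>\<^bsub>kspace M\<^esub> v"
    by (simp add: sadd act_add scalar_carrier)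
qed (simp_all add: act_closed scalar_carrier act_plus act_one M.M.a_ac)

lemma kspace_submodule:
  assumes "L \<subseteq> carrier M" "\<zero>\<^bsub>M\<^esub> \<in> L" "\<And>x y. x \<in> L \<Longrightarrow> y \<in> L \<Longrightarrow> x \<oplus>\<^bsub>M\<^esub> y \<in> L"
    "\<And>c x. x \<in> L \<Longrightarrow> act M (pa_scalar Q c) x \<in> L"
  shows "submodule field_ring L (kspace M)"
proof -
  interpret vectorspace field_ring "kspace M" by (rule kspace_vs)
  show ?thesis by (intro submodule.intro) (use assms module_axioms in auto)
qed

lemma left_submodule_kspace:
  assumes "left_submodule A L M" shows "submodule field_ring L (kspace M)"
  using left_submoduleD[OF M assms] coset_simps(1)[OF scalar_carrier]
  by (intro kspace_submodule) (auto simp: act_def)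

lemma left_submoduleI_act:
  assumes "L \<subseteq> carrier M" "\<zero>\<^bsub>M\<^esub> \<in> L" "\<And>x y. x \<in> L \<Longrightarrow> y \<in> L \<Longrightarrow> x \<oplus>\<^bsub>M\<^esub> y \<in> L"
    "\<And>f x. f \<in> carrier PA \<Longrightarrow> x \<in> L \<Longrightarrow> act M f x \<in> L"
  shows "left_submodule A L M"
  unfolding left_submodule_iff[OF M] using assms coset_ex unfolding act_def by metis

lemma vertex_subspace: "subspace field_ring (act M (pa_path (v, [])) ` carrier M) (kspace M)"
proof -
  have e: "pa_path (v, []) \<in> carrier PA" by (rule path_carrier[OF qpaths_Nil])
  have "submodule field_ring (act M (pa_path (v, [])) ` carrier M) (kspace M)"
  proof (rule kspace_submodule)
    show "act M (pa_path (v, [])) ` carrier M \<subseteq> carrier M" using act_closed[OF e] by blast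
    show "\<zero>\<^bsub>M\<^esub> \<in> act M (pa_path (v, [])) ` carrier M" using act_zero[OF e] M.M.zero_closed by (metis imageI)
    show "x \<oplus>\<^bsub>M\<^esub> y \<in> act M (pa_path (v, [])) ` carrier M"
      if xy: "x \<in> act M (pa_path (v, [])) ` carrier M" "y \<in> act M (pa_path (v, [])) ` carrier M" for x y
    proof -
      obtain x' y' where "x = act M (pa_path (v, [])) x'" "y = act M (pa_path (v, [])) y'" "x' \<in> carrier M" "y' \<in> carrier M"
        using xy by blast
      then show ?thesis using act_plus[OF e, of x' y'] by (intro image_eqI[of _ _ "x' \<oplus>\<^bsub>M\<^esub> y'"]) auto
    qed
    show "act M (pa_scalar Q c) x \<in> act M (pa_path (v, [])) ` carrier M"
      if x: "x \<in> act M (pa_path (v, [])) ` carrier M" for c x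
    proof -
      obtain x' where "x = act M (pa_path (v, [])) x'" "x' \<in> carrier M" using x by blast
      then show ?thesis using act_scalar_comm[OF e, of x' c] act_closed[OF scalar_carrier]
        by (intro image_eqI[of _ _ "act M (pa_scalar Q c) x'"]) auto
    qed
  qed
  then show ?thesis using kspace_vs by (simp add: subspace_def)
qed

lemma vertex_space_vs: "vectorspace field_ring (vertex_space Q I M v)"
  unfolding vertex_space_eq
  using vectorspace.subspace_is_vs[OF kspace_vs vertex_subspace] .

lemma idem: assumes "x \<in> act M (pa_path (v, [])) ` carrier M" shows "act M (pa_path (v, [])) x = x"
proof -
  have e: "pa_path (v, []) \<in> carrier PA" by (rule path_carrier[OF qpaths_Nil])
  have "pa_path (v, []) \<otimes>\<^bsub>PA\<^esub> pa_path (v, []) = pa_path (v, [])" by (simp add: path_mult end_Nil)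
  then show ?thesis using assms act_mult[OF e e] by auto
qed

text \<open>Every path factors through the idempotent of its source, so an element killed by all
  these idempotents is killed by the whole algebra, in particular by its unit.\<close>

lemma zero_if_vertices_zero:
  assumes x: "x \<in> carrier M" and z: "\<And>v. act M (pa_path (v, [])) x = \<zero>\<^bsub>M\<^esub>"
  shows "x = \<zero>\<^bsub>M\<^esub>"
proof -
  have "act M f x = \<zero>\<^bsub>M\<^esub>" if "f \<in> carrier PA" for f
    using that
  proof (induction f rule: pa_induct)
    case (path c q)
    obtain u p where q: "q = (u, p)" by (cases q)
    have e: "pa_path (u, []) \<in> carrier PA" by (rule path_carrier[OF qpaths_Nil])
    have "pa_path q \<otimes>\<^bsub>PA\<^esub> pa_path (u, []) = pa_path q" unfolding q by (simp add: path_mult end_Nil)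
    then have "act M (pa_path q) x = \<zero>\<^bsub>M\<^esub>"
      using act_mult[OF path_carrier[OF path] e x] z act_zero[OF path_carrier[OF path]] by simp
    then show ?case using act_mult[OF scalar_carrier path_carrier[OF path] x] act_zero[OF scalar_carrier] by simp
  next
    case (add f g)
    then show ?case using act_add[OF add(1,2) x] by simp
  qed
  then show ?thesis using act_one[OF x] scalar_carrier by metis
qed

end

section \<open>Finite generation and finite dimension\<close>

lemma long_path_in_I: obtains m where "m \<ge> 1" "\<And>u p. (u, p) \<in> qpaths Q \<Longrightarrow> length p \<ge> m \<Longrightarrow> pa_path (u, p) \<in> I"
proof -
  obtain m where m: "m \<ge> 2" "arrow_ideal_power Q m \<subseteq> I"
    using bq by (auto simp: bound_quiver_def admissible_ideal_def)
  \<comment> \<open>Stated for length at least \<open>n\<close>, so that peeling off the first arrow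
    may go down to \<open>n = 0\<close>, where the power is the whole algebra and any path may
    remain.\<close>
  have "pa_path (u, p) \<in> (arrow_ideal_power Q n :: (('v, 'a) qpath \<Rightarrow> 'k) set)"
    if "(u, p) \<in> qpaths Q" "length p \<ge> n" for u p n
    using that
  proof (induction n arbitrary: u p)
    case 0
    then show ?case by (simp add: path_carrier)
  next
    case (Suc n)
    then obtain a p' where p: "p = a # p'" by (cases p) auto
    have a: "a \<in> arcs Q" "u = tail Q a" "(head Q a, p') \<in> qpaths Q" using Suc.prems(1) p qpaths_Cons by auto
    have 1: "pa_path (head Q a, p') \<in> (arrow_ideal_power Q n :: (('v, 'a) qpath \<Rightarrow> 'k) set)"
      by (rule Suc.IH) (use a p Suc.prems in auto)
    have "(\<lambda>a. pa_path (tail Q a, [a])) ` arcs Q \<subseteq> carrier PA"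
      using path_carrier qpaths_Cons qpaths_Nil by auto
    then have 2: "pa_path (tail Q a, [a]) \<in> (arrow_ideal Q :: (('v, 'a) qpath \<Rightarrow> 'k) set)"
      unfolding arrow_ideal_def using PA.genideal_self a(1) by blast
    have "path_end Q (tail Q a, [a]) = head Q a" by (simp add: path_end_def)
    then have "pa_path (head Q a, p') \<otimes>\<^bsub>PA\<^esub> pa_path (tail Q a, [a]) = (pa_path (u, p) :: ('v, 'a) qpath \<Rightarrow> 'k)"
      by (simp add: path_mult p a(2))
    then show ?case using ideal_prod.prod[OF 1 2, of PA] by simp
  qed
  then show ?thesis using that[of m] m by auto
qed

lemma finite_short_paths: "finite {(u, p). (u, p) \<in> qpaths Q \<and> length p < m}"
proof (rule finite_subset)
  show "{(u, p). (u, p) \<in> qpaths Q \<and> length p < m} \<subseteq> UNIV \<times> {p. set p \<subseteq> arcs Q \<and> length p \<le> m}"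
    by (auto simp: qpaths_def awalk_def)
qed (simp add: finite_lists_length_le)

text \<open>Admissibility makes long paths act as zero, so the module is spanned by the finitely
  many short paths applied to the generators. That span is a submodule since composing paths gives a
  path or zero.\<close>

lemma fin_gen_fin_dim:
  fixes M :: "('v, 'a, 'k) bq_module"
  assumes M: "left_module A M" and fg: "fin_gen A M"
  shows "vectorspace.fin_dim field_ring (kspace M)"
proof -
  interpret V: vectorspace field_ring "kspace M" by (rule kspace_vs[OF M])
  obtain m where m: "m \<ge> 1" "\<And>u p. (u, p) \<in> qpaths Q \<Longrightarrow> length p \<ge> m \<Longrightarrow> pa_path (u, p) \<in> I"
    using long_path_in_I by blast
  obtain S where S: "finite S" "S \<subseteq> carrier M" "\<And>L. left_submodule A L M \<Longrightarrow> S \<subseteq> L \<Longrightarrow> L = carrier M"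
    using fg unfolding fin_gen_def by blast
  define B where "B = (\<lambda>(q, s). act M (pa_path q) s) ` ({(u, p). (u, p) \<in> qpaths Q \<and> length p < m} \<times> S)"
  have finB: "finite B" unfolding B_def using finite_short_paths S(1) by blast
  have BM: "B \<subseteq> carrier M" unfolding B_def using act_closed[OF M path_carrier] S(2) by auto
  have sp: "submodule field_ring (V.span B) (kspace M)" by (rule V.span_is_submodule) (use BM in simp)
  have spM: "V.span B \<subseteq> carrier M" using sp by (simp add: submodule_def)
  have BS: "B \<subseteq> V.span B" by (rule V.in_own_span) (use BM in simp)
  have sp0: "\<zero>\<^bsub>M\<^esub> \<in> V.span B" using submodule.zero_closed[OF sp] by simp
  have spadd: "x \<oplus>\<^bsub>M\<^esub> y \<in> V.span B" if "x \<in> V.span B" "y \<in> V.span B" for x y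
    using submodule.m_closed[OF sp that] by simp
  have spsc: "act M (pa_scalar Q c) x \<in> V.span B" if "x \<in> V.span B" for c x
    using submodule.smult_closed[OF sp _ that, of c] by simp
  have pB: "act M (pa_path q) s \<in> V.span B" if "q \<in> qpaths Q" "s \<in> S" for q s
  proof (cases "length (snd q) < m")
    case True
    then have "act M (pa_path q) s \<in> B" unfolding B_def using that by (cases q) force
    then show ?thesis using BS by blast
  next
    case False
    then have "pa_path q \<in> I" using m(2)[of "fst q" "snd q"] that by simp
    then have "act M (pa_path q) s = \<zero>\<^bsub>M\<^esub>" by (rule act_I[OF M]) (use S(2) that(2) in blast)
    then show ?thesis using sp0 by simp
  qed
  have path_span: "act M (pa_path q) x \<in> V.span B" if q: "q \<in> qpaths Q" and x: "x \<in> V.span B" for q x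
  proof -
    note qc = path_carrier[OF q]
    have "V.span B \<subseteq> {x \<in> carrier M. act M (pa_path q) x \<in> V.span B}"
    proof (rule V.span_is_subset)
      show "submodule field_ring {x \<in> carrier M. act M (pa_path q) x \<in> V.span B} (kspace M)"
      proof (rule kspace_submodule[OF M])
        show "\<zero>\<^bsub>M\<^esub> \<in> {x \<in> carrier M. act M (pa_path q) x \<in> V.span B}"
          using act_zero[OF M qc] sp0 V.M.zero_closed by simp
        show "x \<oplus>\<^bsub>M\<^esub> y \<in> {x \<in> carrier M. act M (pa_path q) x \<in> V.span B}"
          if "x \<in> {x \<in> carrier M. act M (pa_path q) x \<in> V.span B}" "y \<in> {x \<in> carrier M. act M (pa_path q) x \<in> V.span B}" for x y
          using that act_plus[OF M qc] spadd V.M.a_closed[of x y] by simp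
        show "act M (pa_scalar Q c) x \<in> {x \<in> carrier M. act M (pa_path q) x \<in> V.span B}"
          if "x \<in> {x \<in> carrier M. act M (pa_path q) x \<in> V.span B}" for c x
          using that act_scalar_comm[OF M qc] spsc act_closed[OF M scalar_carrier] by simp
      qed blast
      show "B \<subseteq> {x \<in> carrier M. act M (pa_path q) x \<in> V.span B}"
      proof
        fix b assume b: "b \<in> B"
        then obtain u p s where s: "(u, p) \<in> qpaths Q" "s \<in> S" "b = act M (pa_path (u, p)) s" unfolding B_def by auto
        obtain w p' where q': "q = (w, p')" by (cases q)
        have sM: "s \<in> carrier M" using s S by blast
        have "act M (pa_path q) b = act M (pa_path q \<otimes>\<^bsub>PA\<^esub> pa_path (u, p)) s"
          using act_mult[OF M qc path_carrier[OF s(1)] sM] s(3) by simp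
        also have "\<dots> \<in> V.span B"
        proof (cases "w = path_end Q (u, p)")
          case True
          then have "(u, p @ p') \<in> qpaths Q" using q q' s(1) qpaths_append by simp
          then show ?thesis using pB[OF _ s(2)] True q' by (simp add: path_mult)
        next
          case False
          then show ?thesis using q' act_0[OF M sM] sp0 by (simp add: path_mult)
        qed
        finally show "b \<in> {x \<in> carrier M. act M (pa_path q) x \<in> V.span B}" using b BM by blast
      qed
    qed
    then show ?thesis using x by blast
  qed
  have act_span: "act M f x \<in> V.span B" if f: "f \<in> carrier PA" and x: "x \<in> V.span B" for f x
    using f
  proof (induction f rule: pa_induct)
    case (path c q)
    then show ?case using act_mult[OF M scalar_carrier path_carrier[OF path], of x] x spM spsc[OF path_span[OF path x]] by auto
  next
    case (add f g)
    then show ?case using act_add[OF M add(1,2), of x] x spM spadd by auto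
  qed
  have act_S: "act M f s \<in> V.span B" if f: "f \<in> carrier PA" and s: "s \<in> S" for f s
    using f
  proof (induction f rule: pa_induct)
    case (path c q)
    then show ?case using act_mult[OF M scalar_carrier path_carrier[OF path], of s] s S(2) spsc[OF pB[OF path s]] by auto
  next
    case (add f g)
    then show ?case using act_add[OF M add(1,2), of s] s S(2) spadd by auto
  qed
  have "left_submodule A (V.span B) M"
    by (rule left_submoduleI_act[OF M spM sp0 spadd act_span])
  moreover have "S \<subseteq> V.span B"
  proof
    fix s assume "s \<in> S"
    then show "s \<in> V.span B" using act_S[OF scalar_carrier, of s 1] act_one[OF M, of s] S(2) by auto
  qed
  ultimately have "V.span B = carrier M" by (rule S(3))
  then show ?thesis unfolding V.fin_dim_def using finB BM by (intro exI[of _ B]) simp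
qed

lemma fin_dim_fin_gen:
  fixes M :: "('v, 'a, 'k) bq_module"
  assumes M: "left_module A M" and fd: "vectorspace.fin_dim field_ring (kspace M)"
  shows "fin_gen A M"
proof -
  interpret V: vectorspace field_ring "kspace M" by (rule kspace_vs[OF M])
  obtain B where B: "finite B" "B \<subseteq> carrier M" "V.span B = carrier M" using fd unfolding V.fin_dim_def by auto
  show ?thesis
  proof (rule fin_genI[OF B(1,2)])
    fix L assume L: "left_submodule A L M" "B \<subseteq> L"
    have "V.span B \<subseteq> L" by (rule V.span_is_subset[OF L(2) left_submodule_kspace[OF M L(1)]])
    then show "L = carrier M" using B(3) left_submoduleD(1)[OF M L(1)] by simp
  qed
qed

lemma fg_fin_dim: "M \<in> fg_modules A \<Longrightarrow> vectorspace.fin_dim field_ring (kspace M)"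
  by (rule fin_gen_fin_dim) (auto dest: fgD)

lemma sub_fg:
  fixes M :: "('v, 'a, 'k) bq_module"
  assumes "M \<in> fg_modules A" "left_submodule A L M" shows "M\<lparr>carrier := L\<rparr> \<in> fg_modules A"
proof -
  note M = fgD(1)[OF assms(1)]
  interpret V: vectorspace field_ring "kspace M" by (rule kspace_vs[OF M])
  have "subspace field_ring L (kspace M)"
    using left_submodule_kspace[OF M assms(2)] V.vectorspace_axioms by (simp add: subspace_def)
  then have "vectorspace.fin_dim field_ring (kspace (M\<lparr>carrier := L\<rparr>))"
    unfolding kspace_sub by (rule V.fin_dim_subspace[OF fg_fin_dim[OF assms(1)]])
  then show ?thesis using fin_dim_fin_gen[OF left_submoduleD(7)[OF M assms(2)]] left_submoduleD(7)[OF M assms(2)]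
    by (simp add: fg_modules_def)
qed

lemma vertex_fin_dim: "M \<in> fg_modules A \<Longrightarrow> vectorspace.fin_dim field_ring (vertex_space Q I M v)"
  unfolding vertex_space_eq
  by (rule vectorspace.fin_dim_subspace[OF kspace_vs fg_fin_dim vertex_subspace]) (auto dest: fgD)

section \<open>Additivity of the dimension vector\<close>

lemma act_rhom: "f \<in> rhom A M N \<Longrightarrow> h \<in> carrier PA \<Longrightarrow> x \<in> carrier M \<Longrightarrow> f (act M h x) = act N h (f x)"
  unfolding act_def using rhomD(3)[of f A M N "I +>\<^bsub>PA\<^esub> h" x] coset_simps(1)[of h] by blast

lemma vertex_linear:
  assumes f: "f \<in> rhom A M N" and M: "left_module A M" and N: "left_module A N"
  shows "linear_map field_ring (vertex_space Q I M v) (vertex_space Q I N v) f"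
proof -
  interpret V: vectorspace field_ring "vertex_space Q I M v" by (rule vertex_space_vs[OF M])
  interpret W: vectorspace field_ring "vertex_space Q I N v" by (rule vertex_space_vs[OF N])
  have e: "pa_path (v, []) \<in> carrier PA" by (rule path_carrier[OF qpaths_Nil])
  show ?thesis
  proof unfold_locales
    show "f \<in> LinearCombinations.module_hom field_ring (vertex_space Q I M v) (vertex_space Q I N v)"
      unfolding LinearCombinations.module_hom_def vertex_space_eq
      using act_rhom[OF f e] act_rhom[OF f scalar_carrier] act_closed[OF M e] rhomD(1,2)[OF f] by auto
  qed
qed

text \<open>Cutting down by an idempotent is exact: it commutes with homomorphisms, and a preimage
  \<open>x\<close> of an element fixed by it can be replaced by the image of \<open>x\<close> under
  it.\<close>

lemma vertex_dim_exact:
  assumes e: "exact_at A f g X Y Z" and o: "X \<in> fg_modules A" "Y \<in> fg_modules A" "Z \<in> fg_modules A"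
  shows "vectorspace.dim field_ring (vertex_space Q I Y v) =
    vectorspace.dim field_ring (vertex_space Q I X v) + vectorspace.dim field_ring (vertex_space Q I Z v)"
proof -
  note lm = fgD(1)[OF o(1)] fgD(1)[OF o(2)] fgD(1)[OF o(3)]
  note E = exactD[OF e]
  define ev where "ev = (pa_path (v, []) :: ('v, 'a) qpath \<Rightarrow> 'k)"
  have e: "ev \<in> carrier PA" unfolding ev_def by (rule path_carrier[OF qpaths_Nil])
  have cs: "carrier (vertex_space Q I M v) = act M ev ` carrier M" "\<zero>\<^bsub>vertex_space Q I M v\<^esub> = \<zero>\<^bsub>M\<^esub>" for M
    by (simp_all add: vertex_space_eq ev_def)
  have sub: "act M ev ` carrier M \<subseteq> carrier M" if "left_module A M" for M using act_closed[OF that e] by blast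
  have id: "act M ev x = x" if "left_module A M" "x \<in> act M ev ` carrier M" for M x
    using idem[OF that(1)] that(2) unfolding ev_def by blast
  show ?thesis
  proof (rule dim_exact[OF vertex_linear[OF E(1) lm(1,2)] _ vertex_linear[OF E(2) lm(2,3)] _ _
        vertex_fin_dim[OF o(1)] vertex_fin_dim[OF o(2)]])
    show "inj_on f (carrier (vertex_space Q I X v))" using E(3) sub[OF lm(1)] unfolding cs by (rule inj_on_subset)
    show "g ` carrier (vertex_space Q I Y v) = carrier (vertex_space Q I Z v)"
    proof -
      have "g ` act Y ev ` carrier Y = act Z ev ` g ` carrier Y"
        using act_rhom[OF E(2) e] by (force simp: image_image)
      then show ?thesis unfolding cs E(4) .
    qed
    show "f ` carrier (vertex_space Q I X v) = {y \<in> carrier (vertex_space Q I Y v). g y = \<zero>\<^bsub>vertex_space Q I Z v\<^esub>}"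
      unfolding cs
    proof (intro equalityI subsetI)
      fix y assume "y \<in> f ` act X ev ` carrier X"
      then obtain x where x: "x \<in> carrier X" "y = f (act X ev x)" by blast
      then show "y \<in> {y \<in> act Y ev ` carrier Y. g y = \<zero>\<^bsub>Z\<^esub>}"
        using act_rhom[OF E(1) e x(1)] E(6)[OF x(1)] E(8)[OF act_closed[OF lm(1) e x(1)]] by auto
    next
      fix y assume "y \<in> {y \<in> act Y ev ` carrier Y. g y = \<zero>\<^bsub>Z\<^esub>}"
      then have y: "y \<in> act Y ev ` carrier Y" "g y = \<zero>\<^bsub>Z\<^esub>" by auto
      then obtain x where x: "x \<in> carrier X" "y = f x" using E(9)[of y] sub[OF lm(2)] by blast
      then have "y = f (act X ev x)" using act_rhom[OF E(1) e x(1)] id[OF lm(2) y(1)] by simp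
      then show "y \<in> f ` act X ev ` carrier X" using x(1) by blast
    qed
  qed
qed

definition tdim :: "('v, 'a, 'k) bq_module \<Rightarrow> nat" where
  "tdim M = (\<Sum>v\<in>UNIV. vectorspace.dim field_ring (vertex_space Q I M v))"

text \<open>Pullbacks and pushouts live on pairs of elements; this brings them back to the carrier type of the modules.\<close>

definition interleave :: "(nat \<Rightarrow> 'k) \<times> (nat \<Rightarrow> 'k) \<Rightarrow> (nat \<Rightarrow> 'k)" where
  "interleave u n = (if even n then fst u (n div 2) else snd u (n div 2))"

lemma inj_interleave: "inj interleave"
proof (rule injI)
  fix u w assume eq: "interleave u = interleave w"
  have "fst u n = fst w n" for n using fun_cong[OF eq, of "2 * n"] by (simp add: interleave_def)
  moreover have "snd u n = snd w n" for n using fun_cong[OF eq, of "Suc (2 * n)"] by (simp add: interleave_def)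
  ultimately show "u = w" by (intro prod_eqI ext)
qed

sublocale N: noetherian_modules A interleave tdim
proof
  show "inj interleave" by (rule inj_interleave)
  show "M\<lparr>carrier := L\<rparr> \<in> fg_modules A" if "M \<in> fg_modules A" "left_submodule A L M" for M :: "('v, 'a, 'k) bq_module" and L
    by (rule sub_fg[OF that])
  show "tdim Y = tdim X + tdim Z" if "short_exact A X Y Z" and o: "X \<in> fg_modules A" "Y \<in> fg_modules A" "Z \<in> fg_modules A" for X Y Z
  proof -
    obtain f g where "exact_at A f g X Y Z" using \<open>short_exact A X Y Z\<close> unfolding short_exact_iff by blast
    then show ?thesis unfolding tdim_def using vertex_dim_exact[OF _ o] by (simp add: sum.distrib)
  qed
  show "carrier M = {\<zero>\<^bsub>M\<^esub>}" if o: "M \<in> fg_modules A" and "tdim M = 0" for M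
  proof -
    note M = fgD(1)[OF o]
    interpret M: left_module A M by (rule M)
    have "carrier (vertex_space Q I M v) = {\<zero>\<^bsub>vertex_space Q I M v\<^esub>}" for v
      by (rule vectorspace.dim0_trivial[OF vertex_space_vs[OF M] vertex_fin_dim[OF o]])
        (use \<open>tdim M = 0\<close> in \<open>simp add: tdim_def\<close>)
    then have "act M (pa_path (v, [])) x = \<zero>\<^bsub>M\<^esub>" if "x \<in> carrier M" for x v
      using that by (fastforce simp: vertex_space_eq)
    then show ?thesis using zero_if_vertices_zero[OF M] M.M.zero_closed by blast
  qed
qed

lemma dv_add: "N.S X Y Z \<Longrightarrow> dimension_vector Q I Y = dimension_vector Q I X + dimension_vector Q I Z"
  unfolding N.S_def dimension_vector_def using vertex_dim_exact by (auto simp: vec_eq_iff)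

section \<open>Simple modules at the vertices\<close>

lemma scalar_add: "pa_scalar Q (a + b) = pa_scalar Q a \<oplus>\<^bsub>PA\<^esub> pa_scalar Q b"
  by (auto simp: PA_simps pa_scalar_def)

lemma scalar_times: "pa_scalar Q (a * b) = pa_scalar Q a \<otimes>\<^bsub>PA\<^esub> pa_scalar Q b"
  unfolding scalar_mult by (auto simp: pa_scalar_def)

lemma scalar_0: "pa_scalar Q 0 = (\<lambda>_. 0)"
  by (auto simp: pa_scalar_def)

text \<open>\<open>S\<close> is the simple module at the vertex \<open>w\<close>, spanned over the field by \<open>y\<close>.\<close>

definition simple_gen :: "'v \<Rightarrow> ('v, 'a, 'k) bq_module \<Rightarrow> (nat \<Rightarrow> 'k) \<Rightarrow> bool" where
  "simple_gen w S y \<longleftrightarrow> S \<in> fg_modules A \<and> y \<in> carrier S \<and> y \<noteq> \<zero>\<^bsub>S\<^esub> \<and>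
    carrier S = range (\<lambda>c. act S (pa_scalar Q c) y) \<and>
    (\<forall>f\<in>carrier PA. act S f y = act S (pa_scalar Q (f (w, []))) y)"

lemma simple_gen_act:
  assumes "simple_gen w S y" "f \<in> carrier PA"
  shows "act S f (act S (pa_scalar Q c) y) = act S (pa_scalar Q (c * f (w, []))) y"
proof -
  have S: "left_module A S" "y \<in> carrier S" using assms by (auto simp: simple_gen_def dest: fgD)
  have "act S f (act S (pa_scalar Q c) y) = act S (pa_scalar Q c) (act S f y)"
    by (rule act_scalar_comm[OF S(1) assms(2) S(2)])
  also have "act S f y = act S (pa_scalar Q (f (w, []))) y" using assms by (simp add: simple_gen_def)
  finally show ?thesis using act_mult[OF S(1) scalar_carrier scalar_carrier S(2)] by (simp add: scalar_times)
qed

lemma simple_gen_inj: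
  assumes "simple_gen w S y" "act S (pa_scalar Q c) y = act S (pa_scalar Q c') y"
  shows "c = c'"
proof (rule ccontr)
  assume ne: "c \<noteq> c'"
  have S: "left_module A S" "y \<in> carrier S" "y \<noteq> \<zero>\<^bsub>S\<^esub>" using assms by (auto simp: simple_gen_def dest: fgD)
  have "act S (pa_scalar Q (c - c')) y = act S (pa_scalar Q c) y \<oplus>\<^bsub>S\<^esub> act S (pa_scalar Q (- c')) y"
    using act_add[OF S(1) scalar_carrier scalar_carrier S(2), of c "- c'"] by (simp flip: scalar_add)
  also have "\<dots> = act S (pa_scalar Q (c' + - c')) y"
    unfolding assms(2) scalar_add by (rule act_add[OF S(1) scalar_carrier scalar_carrier S(2), symmetric])
  also have "\<dots> = \<zero>\<^bsub>S\<^esub>" using act_0[OF S(1,2)] by (simp add: scalar_0)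
  finally have "act S (pa_scalar Q (inverse (c - c'))) (act S (pa_scalar Q (c - c')) y) = \<zero>\<^bsub>S\<^esub>"
    using act_zero[OF S(1) scalar_carrier] by simp
  then have "act S (pa_scalar Q (inverse (c - c') * (c - c'))) y = \<zero>\<^bsub>S\<^esub>"
    using act_mult[OF S(1) scalar_carrier scalar_carrier S(2)] by (simp add: scalar_times)
  then show False using ne S act_one[OF S(1,2)] by simp
qed

text \<open>In both modules an algebra element acts on the generator through its coefficient at the
  trivial path, so matching coordinates is linear over the algebra. This makes an additive function
  depend on the vertex only.\<close>

lemma simple_gen_isom:
  assumes y: "simple_gen w S y" and z: "simple_gen w S' z" shows "N.isom S S'"
proof -
  have hom: "\<exists>h\<in>rhom A S S'. \<forall>c. h (act S (pa_scalar Q c) y) = act S' (pa_scalar Q c) z"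
    if y: "simple_gen w S y" and z: "simple_gen w S' z" for S S' y z
  proof -
    have S: "left_module A S" "y \<in> carrier S" "carrier S = range (\<lambda>c. act S (pa_scalar Q c) y)"
      using y by (auto simp: simple_gen_def dest: fgD)
    have S': "left_module A S'" "z \<in> carrier S'" "carrier S' = range (\<lambda>c. act S' (pa_scalar Q c) z)"
      using z by (auto simp: simple_gen_def dest: fgD)
    define h where "h x = act S' (pa_scalar Q (SOME c. x = act S (pa_scalar Q c) y)) z" for x
    have h: "h (act S (pa_scalar Q c) y) = act S' (pa_scalar Q c) z" for c
    proof -
      have "(SOME c'. act S (pa_scalar Q c) y = act S (pa_scalar Q c') y) = c"
        by (rule some_equality) (use simple_gen_inj[OF y] in auto)
      then show ?thesis by (simp add: h_def)
    qed
    have "h \<in> rhom A S S'"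
    proof (rule rhomI)
      fix x assume "x \<in> carrier S"
      then obtain c where x: "x = act S (pa_scalar Q c) y" using S(3) by blast
      show "h x \<in> carrier S'" unfolding x h using act_closed[OF S'(1) scalar_carrier S'(2)] .
      show "h (a \<odot>\<^bsub>S\<^esub> x) = a \<odot>\<^bsub>S'\<^esub> h x" if "a \<in> carrier A" for a
      proof -
        obtain f where f: "f \<in> carrier PA" "a = I +>\<^bsub>PA\<^esub> f" using coset_ex \<open>a \<in> carrier A\<close> by blast
        have "h (act S f x) = act S' f (h x)"
          unfolding x h simple_gen_act[OF y f(1)] simple_gen_act[OF z f(1)] ..
        then show ?thesis by (simp add: act_def f(2))
      qed
      fix x' assume "x' \<in> carrier S"
      then obtain c' where x': "x' = act S (pa_scalar Q c') y" using S(3) by blast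
      have "x \<oplus>\<^bsub>S\<^esub> x' = act S (pa_scalar Q (c + c')) y" unfolding x x' scalar_add
        by (rule act_add[OF S(1) scalar_carrier scalar_carrier S(2), symmetric])
      moreover have "h x \<oplus>\<^bsub>S'\<^esub> h x' = act S' (pa_scalar Q (c + c')) z" unfolding x x' scalar_add h
        by (rule act_add[OF S'(1) scalar_carrier scalar_carrier S'(2), symmetric])
      ultimately show "h (x \<oplus>\<^bsub>S\<^esub> x') = h x \<oplus>\<^bsub>S'\<^esub> h x'" by (simp add: h)
    qed
    then show ?thesis using h by blast
  qed
  obtain h where h: "h \<in> rhom A S S'" "\<And>c. h (act S (pa_scalar Q c) y) = act S' (pa_scalar Q c) z" using hom[OF y z] by blast
  obtain k where k: "k \<in> rhom A S' S" "\<And>c. k (act S' (pa_scalar Q c) z) = act S (pa_scalar Q c) y" using hom[OF z y] by blast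
  have cs: "carrier S = range (\<lambda>c. act S (pa_scalar Q c) y)" "carrier S' = range (\<lambda>c. act S' (pa_scalar Q c) z)"
    "S \<in> fg_modules A" "S' \<in> fg_modules A" using y z by (auto simp: simple_gen_def)
  show ?thesis
  proof (rule N.isomI[OF h(1) k(1) _ _ cs(3,4)])
    show "k (h x) = x" if "x \<in> carrier S" for x using that h(2) k(2) unfolding cs(1) by auto
    show "h (k x) = x" if "x \<in> carrier S'" for x using that h(2) k(2) unfolding cs(2) by auto
  qed
qed

text \<open>Path lengths with nonzero action are bounded by admissibility. Take a longest such path
  and a nonzero value \<open>y\<close> of it: every nontrivial path kills \<open>y\<close>, as it
  would extend the longest one, so the scalar multiples of \<open>y\<close> form a
  submodule.\<close>

lemma ex_simple_submodule:
  assumes Mfg: "M \<in> fg_modules A" and nz: "carrier M \<noteq> {\<zero>\<^bsub>M\<^esub>}"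
  obtains w L y where "left_submodule A L M" "simple_gen w (M\<lparr>carrier := L\<rparr>) y"
proof -
  have M: "left_module A M" using Mfg by (rule fgD)
  interpret M: left_module A M by (rule M)
  obtain m where m: "m \<ge> 1" "\<And>u p. (u, p) \<in> qpaths Q \<Longrightarrow> length p \<ge> m \<Longrightarrow> pa_path (u, p) \<in> I"
    using long_path_in_I by blast
  define P where "P l \<longleftrightarrow> (\<exists>u p x. (u, p) \<in> qpaths Q \<and> length p = l \<and> x \<in> carrier M \<and> act M (pa_path (u, p)) x \<noteq> \<zero>\<^bsub>M\<^esub>)" for l
  obtain x0 where x0: "x0 \<in> carrier M" "x0 \<noteq> \<zero>\<^bsub>M\<^esub>" using nz M.M.zero_closed by blast
  then obtain v where "act M (pa_path (v, [])) x0 \<noteq> \<zero>\<^bsub>M\<^esub>" using zero_if_vertices_zero[OF M x0(1)] by blast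
  then have "P 0" unfolding P_def using qpaths_Nil x0(1) by (intro exI[of _ v] exI[of _ "[]"] exI[of _ x0]) simp
  moreover have "\<forall>l. P l \<longrightarrow> l \<le> m"
  proof (intro allI impI)
    fix l assume "P l"
    then obtain u p x where *: "(u, p) \<in> qpaths Q" "length p = l" "x \<in> carrier M" "act M (pa_path (u, p)) x \<noteq> \<zero>\<^bsub>M\<^esub>"
      unfolding P_def by blast
    have "\<not> length p \<ge> m"
    proof
      assume "length p \<ge> m"
      then have "pa_path (u, p) \<in> I" by (rule m(2)[OF *(1)])
      then show False using act_I[OF M _ *(3)] *(4) by blast
    qed
    then show "l \<le> m" using *(2) by simp
  qed
  ultimately obtain l where l: "P l" "\<And>l'. P l' \<Longrightarrow> l' \<le> l" using GreatestI_nat[of P 0 m] Greatest_le_nat[of P _ m] by metis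
  obtain u p x where x: "(u, p) \<in> qpaths Q" "length p = l" "x \<in> carrier M" "act M (pa_path (u, p)) x \<noteq> \<zero>\<^bsub>M\<^esub>"
    using l(1) unfolding P_def by blast
  define y where "y = act M (pa_path (u, p)) x"
  define w where "w = path_end Q (u, p)"
  note up = path_carrier[OF x(1)]
  have y: "y \<in> carrier M" "y \<noteq> \<zero>\<^bsub>M\<^esub>" unfolding y_def using act_closed[OF M up x(3)] x(4) by auto
  have y0: "act M (pa_scalar Q 0) y = \<zero>\<^bsub>M\<^esub>" unfolding scalar_0 by (rule act_0[OF M y(1)])
  have path_y: "act M (pa_path (w', p')) y = (if (w', p') = (w, []) then y else \<zero>\<^bsub>M\<^esub>)" if q: "(w', p') \<in> qpaths Q" for w' p'
  proof -
    have e: "act M (pa_path (w', p')) y = act M (if w' = w then pa_path (u, p @ p') else (\<lambda>_. 0)) x"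
      unfolding y_def w_def path_mult[symmetric] by (rule act_mult[OF M path_carrier[OF q] up x(3), symmetric])
    show ?thesis
    proof (cases "w' = w")
      case False
      then show ?thesis using e act_0[OF M x(3)] by simp
    next
      case True
      show ?thesis
      proof (cases "p' = []")
        case True
        then show ?thesis using e \<open>w' = w\<close> unfolding y_def by simp
      next
        case False
        have "(u, p @ p') \<in> qpaths Q" using q True x(1) qpaths_append unfolding w_def by simp
        moreover have "\<not> P (length (p @ p'))" using l(2)[of "length (p @ p')"] x(2) False by auto
        ultimately have "act M (pa_path (u, p @ p')) x = \<zero>\<^bsub>M\<^esub>" unfolding P_def using x(3) by blast
        then show ?thesis using e True False by simp
      qed
    qed
  qed
  have act_y: "act M f y = act M (pa_scalar Q (f (w, []))) y" if "f \<in> carrier PA" for f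
    using that
  proof (induction f rule: pa_induct)
    case (path c q)
    obtain w' p' where q: "q = (w', p')" by (cases q)
    have "act M (pa_scalar Q c \<otimes>\<^bsub>PA\<^esub> pa_path q) y = act M (pa_scalar Q c) (act M (pa_path q) y)"
      by (rule act_mult[OF M scalar_carrier path_carrier[OF path] y(1)])
    then show ?case
      using path_y[OF path[unfolded q]] y0 act_zero[OF M scalar_carrier, of c]
      by (auto simp: q scalar_mult pa_path_def)
  next
    case (add f g)
    have "(f \<oplus>\<^bsub>PA\<^esub> g) (w, []) = f (w, []) + g (w, [])" by (simp add: PA_simps)
    then show ?case using act_add[OF M add(1,2) y(1)] add(3,4) act_add[OF M scalar_carrier scalar_carrier y(1)]
      by (simp add: scalar_add)
  qed
  define L where "L = range (\<lambda>c. act M (pa_scalar Q c) y)"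
  have yL: "y \<in> L" unfolding L_def using act_one[OF M y(1)] by (intro image_eqI[of _ _ 1]) auto
  have L: "left_submodule A L M"
  proof (rule left_submoduleI_act[OF M])
    show "L \<subseteq> carrier M" unfolding L_def using act_closed[OF M scalar_carrier y(1)] by blast
    show "\<zero>\<^bsub>M\<^esub> \<in> L" unfolding L_def using y0 by (metis rangeI)
    show "a \<oplus>\<^bsub>M\<^esub> b \<in> L" if ab: "a \<in> L" "b \<in> L" for a b
    proof -
      obtain c c' where "a = act M (pa_scalar Q c) y" "b = act M (pa_scalar Q c') y" using ab unfolding L_def by blast
      then have "a \<oplus>\<^bsub>M\<^esub> b = act M (pa_scalar Q (c + c')) y"
        using act_add[OF M scalar_carrier scalar_carrier y(1)] by (simp add: scalar_add)
      then show ?thesis unfolding L_def by blast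
    qed
    show "act M f a \<in> L" if f: "f \<in> carrier PA" and a: "a \<in> L" for f a
    proof -
      obtain c where c: "a = act M (pa_scalar Q c) y" using a unfolding L_def by blast
      have "act M f a = act M (pa_scalar Q (c * f (w, []))) y"
        unfolding c act_scalar_comm[OF M f y(1)] act_y[OF f] scalar_times
        by (rule act_mult[OF M scalar_carrier scalar_carrier y(1), symmetric])
      then show ?thesis unfolding L_def by blast
    qed
  qed
  have "simple_gen w (M\<lparr>carrier := L\<rparr>) y"
    unfolding simple_gen_def act_sub using sub_fg[OF Mfg L] yL y(2) act_y L_def by simp
  then show ?thesis using that L by blast
qed

lemma simple_dv:
  assumes y: "simple_gen w S y" shows "dimension_vector Q I S = axis w 1"
proof -
  have S: "left_module A S" "y \<in> carrier S" "y \<noteq> \<zero>\<^bsub>S\<^esub>" "carrier S = range (\<lambda>c. act S (pa_scalar Q c) y)"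
    using y by (auto simp: simple_gen_def dest: fgD)
  have "vectorspace.dim field_ring (vertex_space Q I S v) = (if v = w then 1 else 0)" for v
  proof -
    interpret V: vectorspace field_ring "vertex_space Q I S v" by (rule vertex_space_vs[OF S(1)])
    have e: "pa_path (v, []) \<in> carrier PA" by (rule path_carrier[OF qpaths_Nil])
    have cs: "carrier (vertex_space Q I S v) = range (\<lambda>c. act S (pa_scalar Q (c * pa_path (v, [] :: 'a list) (w, []))) y)"
      unfolding vertex_space_eq S(4) using simple_gen_act[OF y e] by (auto simp: image_image)
    have zs: "\<zero>\<^bsub>vertex_space Q I S v\<^esub> = \<zero>\<^bsub>S\<^esub>" by (simp add: vertex_space_eq)
    show ?thesis
    proof (cases "v = w")
      case True
      then have cs': "carrier (vertex_space Q I S v) = range (\<lambda>c. act S (pa_scalar Q c) y)"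
        unfolding cs by (simp add: pa_path_def)
      then have yV: "y \<in> carrier (vertex_space Q I S v)" using S(2,4) by simp
      have "V.span {y} = carrier (vertex_space Q I S v)"
      proof
        show "V.span {y} \<subseteq> carrier (vertex_space Q I S v)" by (rule V.span_is_subset2) (use yV in simp)
        have sm: "submodule field_ring (V.span {y}) (vertex_space Q I S v)" by (rule V.span_is_submodule) (use yV in simp)
        have "y \<in> V.span {y}" by (rule V.span_self[OF yV])
        then have "c \<odot>\<^bsub>vertex_space Q I S v\<^esub> y \<in> V.span {y}" for c
          using submodule.smult_closed[OF sm, of c y] by simp
        then have "act S (pa_scalar Q c) y \<in> V.span {y}" for c by (simp add: vertex_space_eq)
        then show "carrier (vertex_space Q I S v) \<subseteq> V.span {y}" unfolding cs' by blast
      qed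
      then show ?thesis using V.dim1I[of y] S(3) zs yV True by simp
    next
      case False
      have "act S (pa_scalar Q 0) y = \<zero>\<^bsub>S\<^esub>" unfolding scalar_0 by (rule act_0[OF S(1,2)])
      then have "carrier (vertex_space Q I S v) = {\<zero>\<^bsub>S\<^esub>}" unfolding cs using False by (simp add: pa_path_def)
      moreover have "V.span {\<zero>\<^bsub>vertex_space Q I S v\<^esub>} \<subseteq> carrier (vertex_space Q I S v)"
        by (rule V.span_is_subset2) simp
      ultimately have "V.span {\<zero>\<^bsub>vertex_space Q I S v\<^esub>} = carrier (vertex_space Q I S v)"
        using V.span_zero[of "{\<zero>\<^bsub>vertex_space Q I S v\<^esub>}"] zs by (simp add: subset_antisym)
      then show ?thesis using V.dim0I False by simp
    qed
  qed
  then show ?thesis by (auto simp: dimension_vector_def axis_def vec_eq_iff)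
qed

lemma tdim_zero_dv: "tdim M = 0 \<Longrightarrow> dimension_vector Q I M = 0"
  by (simp add: tdim_def dimension_vector_def vec_eq_iff)

lemma tdim_zero_iff: assumes "M \<in> fg_modules A" shows "tdim M = 0 \<longleftrightarrow> carrier M = {\<zero>\<^bsub>M\<^esub>}"
proof
  show "tdim M = 0 \<Longrightarrow> carrier M = {\<zero>\<^bsub>M\<^esub>}" by (rule N.d_zero[OF assms])
  assume c: "carrier M = {\<zero>\<^bsub>M\<^esub>}"
  \<comment> \<open>On a module with one element the identity gives an exact sequence with three
    equal terms, and additivity leaves only dimension zero.\<close>
  have "exact_at A (\<lambda>x. x) (\<lambda>x. x) M M M"
    unfolding exact_at_def using c by (auto intro!: rhomI)
  then have "N.S M M M" using N.SI assms by blast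
  then show "tdim M = 0" using N.S_d[of M M M] by simp
qed

text \<open>Dimension vectors of simple modules are unit vectors, so the components of
  \<open>\<theta>\<close> must be the values on simple modules. Splitting off a simple submodule
  reduces the dimension.\<close>

lemma additive_linear:
  fixes \<psi> :: "('v, 'a, 'k) bq_module \<Rightarrow> int"
  assumes add: "\<And>X Y Z. N.S X Y Z \<Longrightarrow> \<psi> Y = \<psi> X + \<psi> Z"
  shows "\<exists>\<theta>. \<forall>M\<in>fg_modules A. real_of_int (\<psi> M) = inner \<theta> (dimension_vector Q I M)"
proof -
  interpret E: short_exact_sequences "fg_modules A" N.S N.isom tdim by (rule N.sequences)
  define \<theta> :: "real ^ 'v" where "\<theta> = (\<chi> w. real_of_int (\<psi> (SOME S. \<exists>y. simple_gen w S y)))"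
  have simp: "real_of_int (\<psi> S) = \<theta> $ w" if y: "simple_gen w S y" for w S y
  proof -
    obtain z where z: "simple_gen w (SOME S. \<exists>y. simple_gen w S y) z"
      using someI[of "\<lambda>S. \<exists>y. simple_gen w S y" S] y by blast
    have "\<psi> S = \<psi> (SOME S. \<exists>y. simple_gen w S y)"
      by (rule E.additive_iso[OF add simple_gen_isom[OF y z]]) (use y in \<open>auto simp: simple_gen_def\<close>)
    then show ?thesis by (simp add: \<theta>_def)
  qed
  have "real_of_int (\<psi> M) = inner \<theta> (dimension_vector Q I M)" if "M \<in> fg_modules A" for M
    using that
  proof (induction "tdim M" arbitrary: M rule: less_induct)
    case less
    show ?case
    proof (cases "tdim M = 0")
      case True
      then show ?thesis using E.dv_zero[OF add less.prems True] by (simp add: tdim_zero_dv)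
    next
      case False
      have "carrier M \<noteq> {\<zero>\<^bsub>M\<^esub>}"
        using tdim_zero_iff[OF less.prems] False by simp
      then obtain w L y where L: "left_submodule A L M" "simple_gen w (M\<lparr>carrier := L\<rparr>) y"
        using ex_simple_submodule[OF less.prems] by blast
      obtain Z where Z: "N.S (M\<lparr>carrier := L\<rparr>) M Z" using N.S_sub[OF less.prems L(1)] by blast
      have "tdim (M\<lparr>carrier := L\<rparr>) \<noteq> 0"
        using N.d_zero[of "M\<lparr>carrier := L\<rparr>"] L(2) by (auto simp: simple_gen_def)
      then have "tdim Z < tdim M" using N.S_d[OF Z] by simp
      then have "real_of_int (\<psi> Z) = inner \<theta> (dimension_vector Q I Z)" using less.hyps Z by (auto simp: N.S_def)
      then show ?thesis using add[OF Z] dv_add[OF Z] simp[OF L(2)] simple_dv[OF L(2)]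
        by (simp add: inner_add_right inner_axis)
    qed
  qed
  then show ?thesis by blast
qed

sublocale G: graded_sequences "fg_modules A" N.S N.isom tdim "dimension_vector Q I"
proof (intro graded_sequences.intro graded_sequences_axioms.intro)
  show "short_exact_sequences (fg_modules A) N.S N.isom tdim" by (rule N.sequences)
  show "dimension_vector Q I Y = dimension_vector Q I X + dimension_vector Q I Z" if "N.S X Y Z" for X Y Z
    by (rule dv_add[OF that])
  show "\<exists>\<theta>. \<forall>M\<in>fg_modules A. real_of_int (\<psi> M) = inner \<theta> (dimension_vector Q I M)"
    if "\<And>X Y Z. N.S X Y Z \<Longrightarrow> \<psi> Y = \<psi> X + \<psi> Z" for \<psi>
    by (rule additive_linear) (rule that)
qed

end

subsection \<open>Polynomials with one sign change\<close>

text \<open>Divided by the \<open>j\<close>-th power of the variable, the sum has negative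
  coefficients only at negative exponents and positive ones only at nonnegative exponents, so every
  term is nondecreasing, and the one for \<open>k = 0\<close> strictly increases.\<close>

lemma one_sign_change_pos:
  fixes b :: "nat \<Rightarrow> real"
  assumes j: "0 < j" "j \<le> r" and neg: "\<And>k. k < j \<Longrightarrow> b k < 0" and pos: "\<And>k. j \<le> k \<Longrightarrow> k \<le> r \<Longrightarrow> b k > 0"
    and xy: "0 < x" "x < y" and x: "(\<Sum>k\<le>r. b k * x ^ k) \<ge> 0"
  shows "(\<Sum>k\<le>r. b k * y ^ k) > 0"
proof -
  define t where "t = y / x"
  have t: "t > 1" "y = t * x" using xy by (simp_all add: t_def)
  have "t ^ j * (\<Sum>k\<le>r. b k * x ^ k) < (\<Sum>k\<le>r. b k * y ^ k)"
    unfolding sum_distrib_left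
  proof (rule sum_strict_mono_ex1)
    have bk: "t ^ j * b k \<le> t ^ k * b k" if "k \<le> r" for k
    proof (cases "k < j")
      case True
      then have "t ^ k \<le> t ^ j" using t by (intro power_increasing) auto
      then show ?thesis using neg[OF True] by (intro mult_right_mono_neg) auto
    next
      case False
      then have "t ^ j \<le> t ^ k" using t by (intro power_increasing) auto
      then show ?thesis using pos[of k] False that by (intro mult_right_mono) auto
    qed
    show "\<forall>k\<in>{..r}. t ^ j * (b k * x ^ k) \<le> b k * y ^ k"
    proof
      fix k assume "k \<in> {..r}"
      then have "(t ^ j * b k) * x ^ k \<le> (t ^ k * b k) * x ^ k" using xy by (intro mult_right_mono[OF bk]) auto
      then show "t ^ j * (b k * x ^ k) \<le> b k * y ^ k" by (simp add: t(2) power_mult_distrib mult_ac)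
    qed
    have "1 < t ^ j" using t j by (simp add: one_less_power)
    then have "t ^ j * b 0 < b 0" using neg[OF j(1)] by (simp add: mult_less_cancel_right1)
    then show "\<exists>k\<in>{..r}. t ^ j * (b k * x ^ k) < b k * y ^ k" by (intro bexI[of _ 0]) auto
  qed simp
  moreover have "t ^ j * (\<Sum>k\<le>r. b k * x ^ k) \<ge> 0" using t x by simp
  ultimately show ?thesis by simp
qed

text \<open>Multiplying the derivative by \<open>x\<close> weights the term for \<open>k\<close>
  with \<open>k\<close>. At a root the weight may be replaced by \<open>k - j\<close>, which makes
  all terms nonnegative and the one for \<open>k = 0\<close> positive.\<close>

lemma one_sign_change_deriv:
  fixes b :: "nat \<Rightarrow> real"
  assumes j: "0 < j" "j \<le> r" and neg: "\<And>k. k < j \<Longrightarrow> b k < 0" and pos: "\<And>k. j \<le> k \<Longrightarrow> k \<le> r \<Longrightarrow> b k > 0"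
    and x: "0 < x" "(\<Sum>k\<le>r. b k * x ^ k) = 0"
  shows "(\<Sum>k\<le>r. b k * (real k * x ^ (k - 1))) > 0"
proof -
  have "x * (\<Sum>k\<le>r. b k * (real k * x ^ (k - 1))) = (\<Sum>k\<le>r. real k * (b k * x ^ k))"
    unfolding sum_distrib_left
  proof (rule sum.cong)
    fix k show "x * (b k * (real k * x ^ (k - 1))) = real k * (b k * x ^ k)" by (cases k) auto
  qed simp
  also have "\<dots> = (\<Sum>k\<le>r. (real k - real j) * (b k * x ^ k)) + real j * (\<Sum>k\<le>r. b k * x ^ k)"
    unfolding sum_distrib_left sum.distrib[symmetric] by (rule sum.cong) (simp_all add: algebra_simps)
  also have "\<dots> = (\<Sum>k\<le>r. (real k - real j) * (b k * x ^ k))" using x by simp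
  also have "\<dots> > 0"
  proof (rule sum_pos2[of _ 0])
    show "0 < (real 0 - real j) * (b 0 * x ^ 0)" using neg[OF j(1)] j by (simp add: mult_pos_neg)
    show "0 \<le> (real k - real j) * (b k * x ^ k)" if "k \<in> {..r}" for k
    proof (cases "k < j")
      case True
      then have "b k * x ^ k \<le> 0" using neg[OF True] x by (simp add: mult_nonpos_nonneg)
      then show ?thesis using True by (simp add: mult_nonpos_nonpos)
    next
      case False
      then have "b k * x ^ k \<ge> 0" using pos[of k] that x by (simp add: less_imp_le)
      then show ?thesis using False by simp
    qed
  qed auto
  finally show ?thesis using x by (simp add: zero_less_mult_iff)
qed

text \<open>The exponent of \<open>M\<close> in the term for \<open>k\<close> is
  \<open>2 * l * k - k * k\<close>, that is \<open>l * l\<close> minus the square of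
  \<open>l - k\<close>. It is greatest at \<open>k = l\<close>, by at least 1, so one factor
  \<open>M\<close> outweighs all other terms together.\<close>

lemma ex_dominating_base:
  fixes c :: "nat \<Rightarrow> nat \<Rightarrow> real"
  assumes nz: "\<And>k j. k \<le> r \<Longrightarrow> j \<in> {1..r} \<Longrightarrow> c k j \<noteq> 0"
  obtains M :: real where "M > 1"
    "\<And>l j. l \<le> r \<Longrightarrow> j \<in> {1..r} \<Longrightarrow> c l j * (\<Sum>k\<le>r. M powr (- (real k)\<^sup>2) * c k j * (M powr (2 * real l)) ^ k) > 0"
proof
  \<comment> \<open>The double sum exceeds every single ratio \<open>C / |c l j|\<close> needed
    below, since all summands are nonnegative; the 2 guarantees \<open>M > 1\<close>.\<close>
  define M where "M = 2 + (\<Sum>l\<le>r. \<Sum>j\<in>{1..r}. (\<Sum>k\<le>r. \<bar>c k j\<bar>) / \<bar>c l j\<bar>)"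
  have "M \<ge> 2" unfolding M_def by (simp add: sum_nonneg)
  then show M1: "M > 1" by simp
  fix l j assume l: "l \<le> r" and j: "j \<in> {1..r}"
  define E where "E = M powr ((real l)\<^sup>2)"
  have E: "E > 0" unfolding E_def using M1 by simp
  define C where "C = (\<Sum>k\<le>r. \<bar>c k j\<bar>)"
  have "C / \<bar>c l j\<bar> \<le> (\<Sum>j\<in>{1..r}. (\<Sum>k\<le>r. \<bar>c k j\<bar>) / \<bar>c l j\<bar>)"
    unfolding C_def by (rule member_le_sum[OF j]) (simp_all add: sum_nonneg)
  also have "\<dots> \<le> (\<Sum>l\<le>r. \<Sum>j\<in>{1..r}. (\<Sum>k\<le>r. \<bar>c k j\<bar>) / \<bar>c l j\<bar>)"
    by (rule member_le_sum[of l "{..r}" "\<lambda>l. \<Sum>j\<in>{1..r}. (\<Sum>k\<le>r. \<bar>c k j\<bar>) / \<bar>c l j\<bar>"]) (use l in \<open>simp_all add: sum_nonneg\<close>)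
  also have "\<dots> < M" unfolding M_def by simp
  finally have CM: "C < M * \<bar>c l j\<bar>" using nz[OF l j] by (simp add: divide_less_eq)
  define g where "g k = M powr (2 * real l * real k - (real k)\<^sup>2) * c k j" for k
  have trm: "M powr (- (real k)\<^sup>2) * c k j * (M powr (2 * real l)) ^ k = g k" for k
  proof -
    have "(M powr (2 * real l)) ^ k = M powr (2 * real l * real k)"
      using M1 by (simp add: powr_powr flip: powr_realpow)
    then show ?thesis unfolding g_def using M1 by (simp add: powr_diff powr_minus divide_inverse)
  qed
  have gl: "g l = E * c l j" unfolding g_def E_def by (simp add: power2_eq_square)
  have small: "\<bar>g k\<bar> \<le> E / M * \<bar>c k j\<bar>" if "k \<noteq> l" for k
  proof -
    have "1 \<le> (real l - real k)\<^sup>2"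
    proof -
      have "\<bar>real l - real k\<bar> \<ge> 1" using that by linarith
      then show ?thesis using abs_le_square_iff[of 1 "real l - real k"] by simp
    qed
    then have "2 * real l * real k - (real k)\<^sup>2 \<le> (real l)\<^sup>2 - 1" by (simp add: power2_diff)
    then have "M powr (2 * real l * real k - (real k)\<^sup>2) \<le> M powr ((real l)\<^sup>2 - 1)" using M1 by (intro powr_mono) auto
    also have "\<dots> = E / M" unfolding E_def using M1 by (simp add: powr_diff)
    finally show ?thesis using mult_right_mono[of _ "E / M" "\<bar>c k j\<bar>"] unfolding g_def by (simp add: abs_mult)
  qed
  have "(\<Sum>k\<le>r. g k) = g l + (\<Sum>k\<in>{..r} - {l}. g k)" using l by (subst sum.remove[of _ l]) auto
  moreover have "\<bar>\<Sum>k\<in>{..r} - {l}. g k\<bar> < E * \<bar>c l j\<bar>"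
  proof -
    have "\<bar>\<Sum>k\<in>{..r} - {l}. g k\<bar> \<le> (\<Sum>k\<in>{..r} - {l}. E / M * \<bar>c k j\<bar>)"
      by (rule order_trans[OF sum_abs sum_mono]) (use small in auto)
    also have "\<dots> \<le> (\<Sum>k\<le>r. E / M * \<bar>c k j\<bar>)" by (rule sum_mono2) (use E M1 in auto)
    also have "\<dots> = E / M * C" unfolding C_def sum_distrib_left ..
    also have "\<dots> < E / M * (M * \<bar>c l j\<bar>)" using CM E M1 by (intro mult_strict_left_mono) auto
    also have "\<dots> = E * \<bar>c l j\<bar>" using M1 by simp
    finally show ?thesis .
  qed
  ultimately have *: "\<bar>(\<Sum>k\<le>r. g k) - E * c l j\<bar> < E * \<bar>c l j\<bar>" using gl by simp
  have "c l j * (\<Sum>k\<le>r. g k) > 0"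
  proof (cases "c l j > 0")
    case True
    then have "(\<Sum>k\<le>r. g k) > 0" using * by (simp add: abs_less_iff)
    then show ?thesis using True by simp
  next
    case False
    then have "c l j < 0" using nz[OF l j] by simp
    then have "(\<Sum>k\<le>r. g k) < 0" using * by (simp add: abs_less_iff)
    then show ?thesis using \<open>c l j < 0\<close> by (simp add: mult_neg_neg)
  qed
  then show "c l j * (\<Sum>k\<le>r. M powr (- (real k)\<^sup>2) * c k j * (M powr (2 * real l)) ^ k) > 0"
    unfolding trm .
qed

text \<open>At the points \<open>p (j - 1)\<close> and \<open>p j\<close> the sum for
  \<open>j\<close> has the signs of its dominating coefficient, negative and positive. So the root
  for \<open>j\<close> lies between them, which orders the roots; the bounds 1 and \<open>X\<close>
  are \<open>p 0\<close> and \<open>p r\<close>.\<close>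

lemma ex_curve:
  fixes c :: "nat \<Rightarrow> nat \<Rightarrow> real"
  assumes pos: "\<And>k j. k \<le> r \<Longrightarrow> 0 < j \<Longrightarrow> j \<le> k \<Longrightarrow> c k j > 0"
    and neg: "\<And>k j. k < j \<Longrightarrow> j \<le> r \<Longrightarrow> c k j < 0"
  obtains a X x where "\<And>k. a k > 0" "X \<ge> 1" "strict_mono_on {1..r} x" "\<And>j. j \<in> {1..r} \<Longrightarrow> 1 < x j \<and> x j < X"
    "\<And>j y. j \<in> {1..r} \<Longrightarrow> 0 < y \<Longrightarrow> y < x j \<Longrightarrow> (\<Sum>k\<le>r. a k * c k j * y ^ k) < 0"
    "\<And>j y. j \<in> {1..r} \<Longrightarrow> x j < y \<Longrightarrow> (\<Sum>k\<le>r. a k * c k j * y ^ k) > 0"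
    "\<And>j. j \<in> {1..r} \<Longrightarrow> (\<Sum>k\<le>r. a k * c k j * x j ^ k) = 0"
    "\<And>j. j \<in> {1..r} \<Longrightarrow> (\<Sum>k\<le>r. a k * c k j * (real k * x j ^ (k - 1))) > 0"
proof -
  have nz: "c k j \<noteq> 0" if "k \<le> r" "j \<in> {1..r}" for k j
    using pos[of k j] neg[of k j] that by (cases "j \<le> k") auto
  obtain M where M: "M > 1" "\<And>l j. l \<le> r \<Longrightarrow> j \<in> {1..r} \<Longrightarrow>
      c l j * (\<Sum>k\<le>r. M powr (- (real k)\<^sup>2) * c k j * (M powr (2 * real l)) ^ k) > 0"
    using ex_dominating_base[of r c] nz by blast
  define a where "a k = M powr (- (real k)\<^sup>2)" for k :: nat
  define p where "p l = M powr (2 * real l)" for l :: nat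
  define F where "F j y = (\<Sum>k\<le>r. a k * c k j * y ^ k)" for j y
  have a: "a k > 0" for k unfolding a_def using M by simp
  have p0: "p l > 0" for l unfolding p_def using M by simp
  have pmono: "p l \<le> p l'" if "l \<le> l'" for l l' unfolding p_def using M that by (intro powr_mono) auto
  have Fpos: "F j (p l) > 0" if "j \<in> {1..r}" "j \<le> l" "l \<le> r" for j l
    using M(2)[of l j] pos[of l j] that unfolding F_def a_def p_def by (auto simp: zero_less_mult_iff)
  have Fneg: "F j (p l) < 0" if "j \<in> {1..r}" "l < j" for j l
    using M(2)[of l j] neg[of l j] that unfolding F_def a_def p_def by (auto simp: zero_less_mult_iff)
  have "\<exists>x. p (j - 1) < x \<and> x < p j \<and> F j x = 0" if j: "j \<in> {1..r}" for j
  proof -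
    have s: "F j (p (j - 1)) < 0" "F j (p j) > 0" using Fneg[of j "j - 1"] Fpos[of j j] j by auto
    have "continuous_on {p (j - 1)..p j} (F j)" unfolding F_def by (intro continuous_intros)
    then obtain x where x: "p (j - 1) \<le> x" "x \<le> p j" "F j x = 0"
      using IVT'[of "F j" "p (j - 1)" 0 "p j"] s pmono[of "j - 1" j] by auto
    moreover have "x \<noteq> p (j - 1)" "x \<noteq> p j" using x s by auto
    ultimately show ?thesis by (intro exI[of _ x]) simp
  qed
  then obtain x where x: "\<And>j. j \<in> {1..r} \<Longrightarrow> p (j - 1) < x j \<and> x j < p j \<and> F j (x j) = 0" by metis
  have x0: "x j > 0" if "j \<in> {1..r}" for j using x[OF that] p0[of "j - 1"] by simp
  have bneg: "a k * c k j < 0" if "j \<in> {1..r}" "k < j" for j k using neg[of k j] a[of k] that by (simp add: mult_pos_neg)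
  have bpos: "a k * c k j > 0" if "j \<in> {1..r}" "j \<le> k" "k \<le> r" for j k using pos[of k j] a[of k] that by simp
  show ?thesis
  proof (rule that[of a "p r" x])
    show "a k > 0" for k by (rule a)
    show "1 \<le> p r" unfolding p_def using M by (intro ge_one_powr_ge_zero) auto
    show "strict_mono_on {1..r} x"
    proof (rule strict_mono_onI)
      fix i j assume ij: "i \<in> {1..r}" "j \<in> {1..r}" "i < j"
      have "x i < p i" using x ij by blast
      also have "\<dots> \<le> p (j - 1)" using ij by (intro pmono) simp
      also have "\<dots> < x j" using x ij by blast
      finally show "x i < x j" .
    qed
    fix j assume j: "j \<in> {1..r}"
    note bn = bneg[OF j] and bp = bpos[OF j]
    have j': "0 < j" "j \<le> r" using j by auto
    have "p 0 = 1" unfolding p_def using M by simp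
    then show "1 < x j \<and> x j < p r" using x[OF j] pmono[of 0 "j - 1"] pmono[of j r] j by auto
    show F0: "(\<Sum>k\<le>r. a k * c k j * x j ^ k) = 0" using x[OF j] unfolding F_def by blast
    show "(\<Sum>k\<le>r. a k * c k j * y ^ k) > 0" if "x j < y" for y
      by (rule one_sign_change_pos[OF j' _ _ x0[OF j] that]) (use bn bp F0 in auto)
    show "(\<Sum>k\<le>r. a k * c k j * y ^ k) < 0" if y: "0 < y" "y < x j" for y
    proof (rule ccontr)
      assume "\<not> ?thesis"
      then have "(\<Sum>k\<le>r. a k * c k j * x j ^ k) > 0"
        by (intro one_sign_change_pos[OF j' _ _ y]) (use bn bp in auto)
      then show False using F0 by simp
    qed
    show "(\<Sum>k\<le>r. a k * c k j * (real k * x j ^ (k - 1))) > 0"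
      by (rule one_sign_change_deriv[OF j' _ _ x0[OF j] F0]) (use bn bp in auto)
  qed
qed

section \<open>Smoothness of polynomial paths\<close>

lemma polynomial_path_derivative:
  fixes \<theta> :: "nat \<Rightarrow> 'b::real_normed_vector"
  shows "((\<lambda>t. \<Sum>k\<le>r. poly (q k) t *\<^sub>R \<theta> k) has_vector_derivative (\<Sum>k\<le>r. poly (pderiv (q k)) t *\<^sub>R \<theta> k)) (at t within S)"
proof (rule has_vector_derivative_sum)
  fix k
  have "(poly (q k) has_real_derivative poly (pderiv (q k)) t) (at t within S)"
    by (rule has_field_derivative_at_within[OF poly_DERIV])
  then show "((\<lambda>t. poly (q k) t *\<^sub>R \<theta> k) has_vector_derivative poly (pderiv (q k)) t *\<^sub>R \<theta> k) (at t within S)"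
    using has_vector_derivative_scaleR[OF _ has_vector_derivative_const[of "\<theta> k"]] by fastforce
qed

lemma polynomial_path_smooth:
  fixes \<theta> :: "nat \<Rightarrow> 'b::real_normed_vector"
  shows "smooth_path (\<lambda>t. \<Sum>k\<le>r. poly (q k) t *\<^sub>R \<theta> k)"
  unfolding smooth_path_def
proof (intro exI[of _ "\<lambda>m t. \<Sum>k\<le>r. poly ((pderiv ^^ m) (q k)) t *\<^sub>R \<theta> k"] conjI allI ballI)
  show "((\<lambda>t. \<Sum>k\<le>r. poly ((pderiv ^^ m) (q k)) t *\<^sub>R \<theta> k) has_vector_derivative
      (\<Sum>k\<le>r. poly ((pderiv ^^ Suc m) (q k)) t *\<^sub>R \<theta> k)) (at t within {0..1})" for m t
    using polynomial_path_derivative[of "\<lambda>k. (pderiv ^^ m) (q k)"] by simp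
qed simp

subsection \<open>The path\<close>

context bound_quiver_algebra begin

abbreviation dv :: "('v, 'a, 'k) bq_module \<Rightarrow> real ^ 'v" where "dv \<equiv> dimension_vector Q I"
abbreviation stab :: "('v, 'a, 'k) bq_module \<Rightarrow> (real ^ 'v) set" where "stab \<equiv> stability_space Q I"

section \<open>Translation of torsion classes and chains to the abstract setting\<close>

lemma quotient_S: "X \<in> fg_modules A \<Longrightarrow> Y \<in> fg_modules A \<Longrightarrow> is_quotient A X Y \<Longrightarrow> \<exists>K. N.S K X Y"
  unfolding is_quotient_def using N.S_quot by blast

lemma S_quotient: "N.S K X Y \<Longrightarrow> is_quotient A X Y"
  unfolding is_quotient_def N.S_def using exactD(2,4) by blast

lemma short_exact_S: "X \<in> fg_modules A \<Longrightarrow> Y \<in> fg_modules A \<Longrightarrow> Z \<in> fg_modules A \<Longrightarrow> short_exact A X Y Z \<longleftrightarrow> N.S X Y Z"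
  unfolding short_exact_iff N.S_def by blast

text \<open>Nonemptiness on the left yields the zero modules required on the right: a zero module is
  a quotient of any member.\<close>

lemma torsion_class_iff:
  fixes U :: "('v, 'a, 'k) bq_module set"
  shows "torsion_class A U \<longleftrightarrow> G.torsion U \<and> U \<noteq> {}"
proof
  assume U: "torsion_class A U"
  note U' = U[unfolded torsion_class_def]
  have sub: "U \<subseteq> fg_modules A" by (rule U'[THEN conjunct1])
  have ne: "U \<noteq> {}" by (rule U'[THEN conjunct2, THEN conjunct1])
  have quot: "Y \<in> U" if "X \<in> U" "Y \<in> fg_modules A" "is_quotient A X Y" for X Y
  proof -
    have "\<forall>X\<in>U. \<forall>Y\<in>fg_modules A. is_quotient A X Y \<longrightarrow> Y \<in> U"
      by (rule U'[THEN conjunct2, THEN conjunct2, THEN conjunct1])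
    from bspec[OF bspec[OF this that(1)] that(2)] show ?thesis using that(3) by (rule mp)
  qed
  have ext: "Y \<in> U" if "X \<in> U" "Z \<in> U" "Y \<in> fg_modules A" "short_exact A X Y Z" for X Y Z
  proof -
    have "\<forall>X\<in>U. \<forall>Z\<in>U. \<forall>Y\<in>fg_modules A. short_exact A X Y Z \<longrightarrow> Y \<in> U"
      by (rule U'[THEN conjunct2, THEN conjunct2, THEN conjunct2])
    from bspec[OF bspec[OF bspec[OF this that(1)] that(2)] that(3)] show ?thesis using that(4) by (rule mp)
  qed
  have "G.torsion U" unfolding G.torsion_def
  proof (intro conjI allI impI)
    show "U \<subseteq> fg_modules A" by (rule sub)
    show "{M \<in> fg_modules A. tdim M = 0} \<subseteq> U"
    proof
      fix Z :: "('v, 'a, 'k) bq_module" assume "Z \<in> {M \<in> fg_modules A. tdim M = 0}"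
      then have Z: "Z \<in> fg_modules A" "carrier Z = {\<zero>\<^bsub>Z\<^esub>}" using tdim_zero_iff by auto
      interpret Z: left_module A Z using Z(1) by (rule fgD)
      obtain X where X: "X \<in> U" using ne by blast
      then interpret X: left_module A X using sub fgD by blast
      have "(\<lambda>_. \<zero>\<^bsub>Z\<^esub>) \<in> rhom A X Z" by (rule rhomI) (auto simp: Z.zero_smult)
      then have "is_quotient A X Z" unfolding is_quotient_def
        by (rule bexI[rotated]) (use Z(2) X.M.zero_closed in auto)
      then show "Z \<in> U" by (rule quot[OF X Z(1)])
    qed
    show "Z \<in> U" if "N.S X Y Z \<and> Y \<in> U" for X Y Z
      using quot[of Y Z] S_quotient[of X Y Z] that by (simp add: N.S_def)
    show "Y \<in> U" if "N.S X Y Z \<and> X \<in> U \<and> Z \<in> U" for X Y Z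
    proof -
      have o: "X \<in> fg_modules A" "Y \<in> fg_modules A" "Z \<in> fg_modules A" using that by (simp_all add: N.S_def)
      then show ?thesis using ext[of X Z Y] short_exact_S[OF o] that by blast
    qed
  qed
  then show "G.torsion U \<and> U \<noteq> {}" using ne by simp
next
  assume U: "G.torsion U \<and> U \<noteq> {}"
  then have T: "G.torsion U" by simp
  note D = G.torsionD[OF T]
  show "torsion_class A U" unfolding torsion_class_def
  proof (intro conjI ballI impI)
    show "U \<subseteq> fg_modules A" by (rule D(1))
    show "U \<noteq> {}" using U by simp
    show "Y \<in> U" if XY: "X \<in> U" "Y \<in> fg_modules A" "is_quotient A X Y" for X Y
    proof -
      have "X \<in> fg_modules A" using XY(1) D(1) by blast
      then obtain K where "N.S K X Y" using quotient_S XY by blast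
      then show ?thesis by (rule D(3)[OF _ XY(1)])
    qed
    show "Y \<in> U" if XY: "X \<in> U" "Z \<in> U" "Y \<in> fg_modules A" "short_exact A X Y Z" for X Y Z
    proof -
      have "X \<in> fg_modules A" "Z \<in> fg_modules A" using XY D(1) by blast+
      then have "N.S X Y Z" using short_exact_S XY by blast
      then show ?thesis by (rule D(4)[OF _ XY(1,2)])
    qed
  qed
qed

lemma mgs_max_chain:
  assumes "maximal_green_sequence A T r" shows "G.max_chain T r"
  unfolding G.max_chain_def
proof (intro conjI allI impI)
  note m = assms[unfolded maximal_green_sequence_def]
  note m1 = m[THEN conjunct1] and m2 = m[THEN conjunct2, THEN conjunct1]
  note m3 = m[THEN conjunct2, THEN conjunct2, THEN conjunct1]
  note m4 = m[THEN conjunct2, THEN conjunct2, THEN conjunct2, THEN conjunct1]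
  note m5 = m[THEN conjunct2, THEN conjunct2, THEN conjunct2, THEN conjunct2]
  have tc: "torsion_class A (T i)" if "i \<le> r" for i using m1 that by simp
  show "G.torsion (T i)" if "i \<le> r" for i using tc[OF that] torsion_class_iff by blast
  have "T 0 = {M \<in> fg_modules A. carrier M = {\<zero>\<^bsub>M\<^esub>}}" by (rule m2)
  then show "T 0 = {M \<in> fg_modules A. tdim M = 0}" using tdim_zero_iff by auto
  show "T r = fg_modules A" by (rule m3)
  show "T i \<subset> T (Suc i)" if "i < r" for i using m4 that by simp
  show "U = T i \<or> U = T (Suc i)" if i: "i < r" and U: "G.torsion U \<and> T i \<subseteq> U \<and> U \<subseteq> T (Suc i)" for i U
  proof -
    have "T i \<noteq> {}" using tc[of i] i torsion_class_iff by auto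
    then have "torsion_class A U" using torsion_class_iff U by blast
    then show ?thesis using m5[rule_format, OF i, of U] U by simp
  qed
qed

text \<open>\<open>stability_space\<close> speaks of subsets of \<open>N\<close>, exact sequences of
  subobjects up to isomorphism; the two agree because the dimension vector is invariant under
  isomorphism.\<close>

lemma stab_sub:
  assumes "N.S X N Y" "\<theta> \<in> stab N" shows "inner \<theta> (dv X) \<le> 0"
proof -
  obtain f g where e: "exact_at A f g X N Y" and o: "X \<in> fg_modules A" "N \<in> fg_modules A" "Y \<in> fg_modules A"
    using N.SE[OF assms(1)] by blast
  note lm = fgD(1)[OF o(1)] fgD(1)[OF o(2)]
  define L where "L = f ` carrier X"
  have L: "left_submodule A L N" unfolding L_def
    by (rule image_submodule[OF exactD(1)[OF e] lm whole_submodule[OF lm(1)]])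
  have "f \<in> rhom A X (N\<lparr>carrier := L\<rparr>)" by (rule rhom_sub_cod[OF exactD(1)[OF e]]) (simp add: L_def)
  then have "N.isom X (N\<lparr>carrier := L\<rparr>)" unfolding N.isom_def
    using o(1) sub_fg[OF o(2) L] exactD(3)[OF e] by (auto simp: bij_betw_def L_def)
  then have "dv X = dv (N\<lparr>carrier := L\<rparr>)" using G.additive_iso[where f = dv, OF G.dv_add] o(1) by blast
  then show ?thesis using assms(2) L by (simp add: stability_space_def)
qed

lemma stabI:
  assumes "N \<in> fg_modules A" "inner \<theta> (dv N) = 0" "\<And>X Y. N.S X N Y \<Longrightarrow> inner \<theta> (dv X) \<le> 0"
  shows "\<theta> \<in> stab N"
  unfolding stability_space_def using assms N.S_sub[OF assms(1)] by blast

lemma nonzero_iff: "N \<in> bq_mod_nonzero Q I \<longleftrightarrow> N \<in> fg_modules A \<and> tdim N \<noteq> 0"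
  using tdim_zero_iff[of N] by (auto simp: bq_mod_nonzero_def bq_mod_def)

text \<open>The torsion-free part of \<open>X\<close> is one of its quotients, so for
  \<open>X\<close> in the class of \<open>\<theta>\<close> it would have to be both nonnegative and
  negative unless it is zero. Conversely all quotients of an object of \<open>T\<close> are in
  \<open>T\<close>.\<close>

lemma torsion_class_of_eqI:
  assumes T: "G.torsion T"
    and pos: "\<And>X. X \<in> T \<Longrightarrow> inner \<theta> (dv X) \<ge> 0"
    and neg: "\<And>Y. Y \<in> G.free T \<Longrightarrow> tdim Y \<noteq> 0 \<Longrightarrow> inner \<theta> (dv Y) < 0"
  shows "torsion_class_of Q I \<theta> = T"
proof (intro equalityI subsetI)
  interpret P: torsion_pair "fg_modules A" N.S N.isom tdim T "G.free T" by (rule G.torsion_pair_free[OF T])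
  fix X
  { assume "X \<in> torsion_class_of Q I \<theta>"
    then have X: "X \<in> fg_modules A" "\<And>Y. Y \<in> fg_modules A \<Longrightarrow> is_quotient A X Y \<Longrightarrow> inner \<theta> (dv Y) \<ge> 0"
      by (auto simp: torsion_class_of_def bq_mod_def)
    obtain X1 Y where XY: "N.S X1 X Y" "X1 \<in> T" "Y \<in> G.free T" using P.decomp[OF X(1)] by blast
    have "Y \<in> fg_modules A" using XY(1) by (simp add: N.S_def)
    then have "inner \<theta> (dv Y) \<ge> 0" using X(2) S_quotient[OF XY(1)] by blast
    then have "tdim Y = 0" using neg[OF XY(3)] by fastforce
    then show "X \<in> T" by (rule P.T_of_zero_quot[OF XY(1,2)]) }
  { assume X: "X \<in> T"
    then have "X \<in> fg_modules A" using P.T_Ob by blast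
    moreover have "inner \<theta> (dv Y) \<ge> 0" if "Y \<in> fg_modules A" "is_quotient A X Y" for Y
      using quotient_S[OF \<open>X \<in> fg_modules A\<close> that] P.T_quot X pos by blast
    ultimately show "X \<in> torsion_class_of Q I \<theta>" by (auto simp: torsion_class_of_def bq_mod_def) }
qed

section \<open>Points with a given sign pattern on the bricks\<close>

context
  fixes T :: "nat \<Rightarrow> ('v, 'a, 'k) bq_module set" and r :: nat and B :: "nat \<Rightarrow> ('v, 'a, 'k) bq_module"
  assumes c: "G.max_chain T r" and B: "G.bricks T r B"
begin

text \<open>For a point of the stability space of \<open>N\<close>, the torsion part of
  \<open>N\<close> has value at most 0, hence is zero; then \<open>N\<close> is torsion-free and its
  own value is negative instead of 0.\<close>

lemma chamber_point:
  assumes k: "k \<le> r" and pos: "\<And>j. 0 < j \<Longrightarrow> j \<le> k \<Longrightarrow> inner \<theta> (dv (B j)) > 0"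
    and neg: "\<And>j. k < j \<Longrightarrow> j \<le> r \<Longrightarrow> inner \<theta> (dv (B j)) < 0"
  shows "torsion_class_of Q I \<theta> = T k" "N \<in> bq_mod_nonzero Q I \<Longrightarrow> \<theta> \<notin> stab N"
proof -
  note T = G.max_chainD(1)[OF c k]
  interpret P: torsion_pair "fg_modules A" N.S N.isom tdim "T k" "G.free (T k)" by (rule G.torsion_pair_free[OF T])
  have p: "inner \<theta> (dv X) > 0" if "X \<in> T k" "tdim X \<noteq> 0" for X by (rule G.sign_T[OF c B k pos that])
  have n: "inner \<theta> (dv Y) < 0" if "Y \<in> G.free (T k)" "tdim Y \<noteq> 0" for Y by (rule G.sign_F[OF c B k neg that])
  show "torsion_class_of Q I \<theta> = T k"
  proof (rule torsion_class_of_eqI[OF T _ n])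
    show "inner \<theta> (dv X) \<ge> 0" if "X \<in> T k" for X
      using p[OF that] tdim_zero_dv[of X] by (cases "tdim X = 0") auto
  qed
  show "\<theta> \<notin> stab N" if N: "N \<in> bq_mod_nonzero Q I"
  proof
    assume s: "\<theta> \<in> stab N"
    have N': "N \<in> fg_modules A" "tdim N \<noteq> 0" using N nonzero_iff by blast+
    obtain X Y where XY: "N.S X N Y" "X \<in> T k" "Y \<in> G.free (T k)" using P.decomp[OF N'(1)] by blast
    have "tdim X = 0" using p[OF XY(2)] stab_sub[OF XY(1) s] by fastforce
    then have "N \<in> G.free (T k)" by (rule P.F_of_zero_sub[OF XY(1,3)])
    then have "inner \<theta> (dv N) < 0" using n N'(2) by blast
    then show False using s by (simp add: stability_space_def)
  qed
qed

text \<open>On the wall the larger class \<open>T (Suc i)\<close> results, since the definition of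
  the class of \<open>\<theta>\<close> admits the value 0. A module with \<open>\<theta>\<close> in
  its stability space is squeezed from two sides: its part in \<open>T i\<close> and its quotient in
  \<open>free (T (Suc i))\<close> both vanish.\<close>

lemma wall_point:
  assumes i: "i < r" and pos: "\<And>j. 0 < j \<Longrightarrow> j \<le> i \<Longrightarrow> inner \<theta> (dv (B j)) > 0"
    and zero: "inner \<theta> (dv (B (Suc i))) = 0"
    and neg: "\<And>j. Suc i < j \<Longrightarrow> j \<le> r \<Longrightarrow> inner \<theta> (dv (B j)) < 0"
  shows "torsion_class_of Q I \<theta> = T (Suc i)"
    "N \<in> bq_mod_nonzero Q I \<Longrightarrow> \<theta> \<in> stab N \<Longrightarrow> \<exists>m\<ge>1. dv N = real m *\<^sub>R dv (B (Suc i))"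
    "\<theta> \<in> stab (B (Suc i))"
proof -
  have k: "i \<le> r" "Suc i \<le> r" using i by simp_all
  note T = G.max_chainD(1)[OF c k(1)] and T' = G.max_chainD(1)[OF c k(2)]
  interpret P: torsion_pair "fg_modules A" N.S N.isom tdim "T i" "G.free (T i)" by (rule G.torsion_pair_free[OF T])
  interpret P': torsion_pair "fg_modules A" N.S N.isom tdim "T (Suc i)" "G.free (T (Suc i))" by (rule G.torsion_pair_free[OF T'])
  have p: "inner \<theta> (dv X) > 0" if "X \<in> T i" "tdim X \<noteq> 0" for X by (rule G.sign_T[OF c B k(1) pos that])
  have p0: "inner \<theta> (dv X) \<ge> 0" if "X \<in> T i" for X
    using p[OF that] tdim_zero_dv[of X] by (cases "tdim X = 0") auto
  have n: "inner \<theta> (dv Y) < 0" if "Y \<in> G.free (T (Suc i))" "tdim Y \<noteq> 0" for Y by (rule G.sign_F[OF c B k(2) neg that])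
  have n0: "inner \<theta> (dv X) \<le> 0" if "X \<in> G.free (T (Suc i))" for X
    using n[OF that] tdim_zero_dv[of X] by (cases "tdim X = 0") auto
  have W: "\<exists>m\<ge>1. dv E = real m *\<^sub>R dv (B (Suc i))" if "E \<in> T (Suc i)" "E \<in> G.free (T i)" "tdim E \<noteq> 0" for E
    using B i that unfolding G.bricks_def by blast
  have W0: "inner \<theta> (dv E) = 0" if E: "E \<in> T (Suc i)" "E \<in> G.free (T i)" for E
  proof (cases "tdim E = 0")
    case True
    then show ?thesis by (simp add: tdim_zero_dv)
  next
    case False
    then obtain m where "dv E = real m *\<^sub>R dv (B (Suc i))" using W[OF E False] by blast
    then show ?thesis using zero by simp
  qed
  have Bi: "B (Suc i) \<in> T (Suc i)" "B (Suc i) \<in> G.free (T i)" "tdim (B (Suc i)) \<noteq> 0"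
    using B i unfolding G.bricks_def by blast+
  have free: "inner \<theta> (dv Y) \<le> 0" if Y: "Y \<in> G.free (T i)" for Y
  proof -
    have "Y \<in> fg_modules A" using Y P.F_Ob by blast
    then obtain X2 Y2 where XY: "N.S X2 Y Y2" "X2 \<in> T (Suc i)" "Y2 \<in> G.free (T (Suc i))" using P'.decomp by blast
    have "inner \<theta> (dv X2) = 0" by (rule W0[OF XY(2) P.F_sub[OF XY(1) Y]])
    then show ?thesis using n0[OF XY(3)] dv_add[OF XY(1)] by (simp add: inner_add_right)
  qed
  show "torsion_class_of Q I \<theta> = T (Suc i)"
  proof (rule torsion_class_of_eqI[OF T' _ n])
    fix X assume X: "X \<in> T (Suc i)"
    then have "X \<in> fg_modules A" using P'.T_Ob by blast
    then obtain X1 Y1 where XY: "N.S X1 X Y1" "X1 \<in> T i" "Y1 \<in> G.free (T i)" using P.decomp by blast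
    have "inner \<theta> (dv Y1) = 0" by (rule W0[OF P'.T_quot[OF XY(1) X] XY(3)])
    then show "inner \<theta> (dv X) \<ge> 0" using p0[OF XY(2)] dv_add[OF XY(1)] by (simp add: inner_add_right)
  qed
  show "\<exists>m\<ge>1. dv N = real m *\<^sub>R dv (B (Suc i))" if N: "N \<in> bq_mod_nonzero Q I" and s: "\<theta> \<in> stab N"
  proof -
    have N': "N \<in> fg_modules A" "tdim N \<noteq> 0" using N nonzero_iff by blast+
    obtain X Y where XY: "N.S X N Y" "X \<in> T i" "Y \<in> G.free (T i)" using P.decomp[OF N'(1)] by blast
    have "tdim X = 0" using p[OF XY(2)] stab_sub[OF XY(1) s] by fastforce
    then have NF: "N \<in> G.free (T i)" by (rule P.F_of_zero_sub[OF XY(1,3)])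
    obtain X2 Y2 where XY2: "N.S X2 N Y2" "X2 \<in> T (Suc i)" "Y2 \<in> G.free (T (Suc i))" using P'.decomp[OF N'(1)] by blast
    have "inner \<theta> (dv X2) = 0" by (rule W0[OF XY2(2) P.F_sub[OF XY2(1) NF]])
    moreover have "inner \<theta> (dv N) = 0" using s by (simp add: stability_space_def)
    ultimately have "inner \<theta> (dv Y2) = 0" using dv_add[OF XY2(1)] by (simp add: inner_add_right)
    then have "tdim Y2 = 0" using n[OF XY2(3)] by fastforce
    then have "N \<in> T (Suc i)" by (rule P'.T_of_zero_quot[OF XY2(1,2)])
    then show ?thesis by (rule W[OF _ NF N'(2)])
  qed
  show "\<theta> \<in> stab (B (Suc i))"
  proof (rule stabI)
    show "B (Suc i) \<in> fg_modules A" using Bi(1) P'.T_Ob by blast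
    show "inner \<theta> (dv X) \<le> 0" if "N.S X (B (Suc i)) Y" for X Y by (rule free[OF P.F_sub[OF that Bi(2)]])
  qed (rule zero)
qed

text \<open>The signs on the other bricks are finitely many open conditions, so a relatively open
  piece of the hyperplane orthogonal to the brick consists of points of the same kind as
  \<open>\<theta>\<close> and lies in the stability space.\<close>

lemma brick_wall:
  assumes i: "i < r" and pos: "\<And>j. 0 < j \<Longrightarrow> j \<le> i \<Longrightarrow> inner \<theta> (dv (B j)) > 0"
    and zero: "inner \<theta> (dv (B (Suc i))) = 0"
    and neg: "\<And>j. Suc i < j \<Longrightarrow> j \<le> r \<Longrightarrow> inner \<theta> (dv (B j)) < 0"
    and nz: "dv (B (Suc i)) \<noteq> 0"
  shows "is_wall Q I (B (Suc i))"
proof -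
  define H where "H = {\<eta> :: real ^ 'v. inner (dv (B (Suc i))) \<eta> = 0}"
  define O1 where "O1 = (\<Inter>j\<in>{1..i}. {\<eta>. inner (dv (B j)) \<eta> > 0})"
  define O2 where "O2 = (\<Inter>j\<in>{Suc (Suc i)..r}. {\<eta>. inner (dv (B j)) \<eta> < 0})"
  have "open O1" "open O2" unfolding O1_def O2_def
    by (auto intro!: open_INT open_halfspace_gt open_halfspace_lt)
  then have O: "open (O1 \<inter> O2)" by (rule open_Int)
  have "\<theta> \<in> H \<inter> (O1 \<inter> O2)"
    unfolding H_def O1_def O2_def using pos zero neg by (auto simp: inner_commute)
  moreover have "convex H" unfolding H_def by (rule convex_hyperplane)
  ultimately have "aff_dim (H \<inter> (O1 \<inter> O2)) = aff_dim H" using O by (intro aff_dim_convex_Int_open) auto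
  moreover have "H \<inter> (O1 \<inter> O2) \<subseteq> stab (B (Suc i))"
  proof
    fix \<eta> assume \<eta>: "\<eta> \<in> H \<inter> (O1 \<inter> O2)"
    show "\<eta> \<in> stab (B (Suc i))"
      by (rule wall_point(3)[OF i]) (use \<eta> in \<open>auto simp: H_def O1_def O2_def inner_commute\<close>)
  qed
  then have "aff_dim (H \<inter> (O1 \<inter> O2)) \<le> aff_dim (stab (B (Suc i)))" by (rule aff_dim_subset)
  moreover have "stab (B (Suc i)) \<subseteq> H" unfolding H_def stability_space_def by (auto simp: inner_commute)
  then have "aff_dim (stab (B (Suc i))) \<le> aff_dim H" by (rule aff_dim_subset)
  moreover have "aff_dim H = int CARD('v) - 1" unfolding H_def using nz by (simp add: aff_dim_hyperplane)
  ultimately have "aff_dim (stab (B (Suc i))) = int CARD('v) - 1" by linarith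
  moreover have "B (Suc i) \<in> bq_mod_nonzero Q I"
    using B i G.torsionD(1)[OF G.max_chainD(1)[OF c, of "Suc i"]] unfolding nonzero_iff G.bricks_def by auto
  ultimately show ?thesis by (simp add: is_wall_def)
qed

text \<open>All points with this sign pattern avoid every stability space. They form an open set,
  which therefore avoids the closure of the union too.\<close>

lemma chamber_point_in_chamber:
  assumes k: "k \<le> r" and pos: "\<And>j. 0 < j \<Longrightarrow> j \<le> k \<Longrightarrow> inner \<theta> (dv (B j)) > 0"
    and neg: "\<And>j. k < j \<Longrightarrow> j \<le> r \<Longrightarrow> inner \<theta> (dv (B j)) < 0"
  shows "\<exists>C\<in>chambers Q I. \<theta> \<in> C"
proof -
  define O1 where "O1 = (\<Inter>j\<in>{1..k}. {\<eta>. inner (dv (B j)) \<eta> > 0})"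
  define O2 where "O2 = (\<Inter>j\<in>{Suc k..r}. {\<eta>. inner (dv (B j)) \<eta> < 0})"
  have "open O1" "open O2" unfolding O1_def O2_def
    by (auto intro!: open_INT open_halfspace_gt open_halfspace_lt)
  then have O: "open (O1 \<inter> O2)" by (rule open_Int)
  have \<theta>: "\<theta> \<in> O1 \<inter> O2" unfolding O1_def O2_def using pos neg by (auto simp: inner_commute)
  have "\<eta> \<notin> stab N" if "N \<in> bq_mod_nonzero Q I" "\<eta> \<in> O1 \<inter> O2" for N \<eta>
    by (rule chamber_point(2)[OF k _ _ that(1)]) (use that(2) in \<open>auto simp: O1_def O2_def inner_commute\<close>)
  then have "(O1 \<inter> O2) \<inter> (\<Union>N \<in> bq_mod_nonzero Q I. stab N) = {}" by blast
  then have "(O1 \<inter> O2) \<inter> closure (\<Union>N \<in> bq_mod_nonzero Q I. stab N) = {}"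
    using open_Int_closure_eq_empty[OF O] by blast
  then have "\<theta> \<in> UNIV - closure (\<Union>N \<in> bq_mod_nonzero Q I. stab N)" using \<theta> by blast
  then show ?thesis unfolding chambers_def by (metis Union_components UnionE)
qed

lemma ex_green_path:
  assumes pos: "\<And>k j. k \<le> r \<Longrightarrow> 0 < j \<Longrightarrow> j \<le> k \<Longrightarrow> inner (\<theta> k) (dv (B j)) > 0"
    and neg: "\<And>k j. k \<le> r \<Longrightarrow> k < j \<Longrightarrow> j \<le> r \<Longrightarrow> inner (\<theta> k) (dv (B j)) < 0"
  shows "\<exists>\<gamma> :: real \<Rightarrow> real ^ 'v. D_generic Q I \<gamma> \<and>
    (\<exists>t :: nat \<Rightarrow> real. strict_mono_on {1..r} t \<and>
      {s \<in> {0..1}. \<exists>N \<in> bq_mod_nonzero Q I. \<gamma> s \<in> stability_space Q I N} = t ` {1..r} \<and>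
      {s \<in> {0..1}. \<exists>N. is_wall Q I N \<and> \<gamma> s \<in> stability_space Q I N} = t ` {1..r}) \<and>
    (\<forall>s \<in> {0..1}. green_at Q I \<gamma> s) \<and>
    (\<forall>s \<in> {0..1}. \<exists>k\<le>r. torsion_class_of Q I (\<gamma> s) = T k) \<and>
    (\<forall>s \<in> {0..1}. \<forall>s' \<in> {0..1}. s < s' \<longrightarrow>
      torsion_class_of Q I (\<gamma> s) \<subseteq> torsion_class_of Q I (\<gamma> s'))"
proof -
  define c' where "c' k j = inner (\<theta> k) (dv (B j))" for k j
  obtain a X x where a: "\<And>k. a k > 0" and X: "X \<ge> 1" and xmono: "strict_mono_on {1..r} x"
    and xX: "\<And>j. j \<in> {1..r} \<Longrightarrow> 1 < x j \<and> x j < X"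
    and Fneg: "\<And>j y. j \<in> {1..r} \<Longrightarrow> 0 < y \<Longrightarrow> y < x j \<Longrightarrow> (\<Sum>k\<le>r. a k * c' k j * y ^ k) < 0"
    and Fpos: "\<And>j y. j \<in> {1..r} \<Longrightarrow> x j < y \<Longrightarrow> (\<Sum>k\<le>r. a k * c' k j * y ^ k) > 0"
    and F0: "\<And>j. j \<in> {1..r} \<Longrightarrow> (\<Sum>k\<le>r. a k * c' k j * x j ^ k) = 0"
    and F': "\<And>j. j \<in> {1..r} \<Longrightarrow> (\<Sum>k\<le>r. a k * c' k j * (real k * x j ^ (k - 1))) > 0"
  proof (rule ex_curve[of r c'])
    show "c' k j > 0" if "k \<le> r" "0 < j" "j \<le> k" for k j unfolding c'_def by (rule pos[OF that])
    show "c' k j < 0" if "k < j" "j \<le> r" for k j unfolding c'_def by (rule neg) (use that in auto)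
  qed blast
  \<comment> \<open>The curve is followed from parameter 1 to \<open>X\<close>, an interval with all
    roots in its interior; \<open>y\<close> rescales \<open>{0..1}\<close> to it.\<close>
  define q where "q k = Polynomial.smult (a k) ([:1, X - 1:] ^ k)" for k
  define y where "y s = 1 + s * (X - 1)" for s
  define \<gamma> where "\<gamma> s = (\<Sum>k\<le>r. poly (q k) s *\<^sub>R \<theta> k)" for s
  have pq: "poly (q k) s = a k * y s ^ k" for k s by (simp add: q_def y_def poly_power)
  have pq': "poly (pderiv (q k)) s = (X - 1) * (a k * (real k * y s ^ (k - 1)))" for k s
    by (simp add: q_def y_def pderiv_smult pderiv_power pderiv_pCons poly_power)
  have \<gamma>B: "inner (\<gamma> s) (dv (B j)) = (\<Sum>k\<le>r. a k * c' k j * y s ^ k)" for s j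
    unfolding \<gamma>_def by (simp add: inner_sum_left pq c'_def mult_ac)
  have smooth: "smooth_path \<gamma>" unfolding \<gamma>_def by (rule polynomial_path_smooth)
  have vel: "velocity \<gamma> s = (\<Sum>k\<le>r. poly (pderiv (q k)) s *\<^sub>R \<theta> k)" if "s \<in> {0..1}" for s
    unfolding \<gamma>_def
    by (rule vector_derivative_within_closed_interval[OF _ _ polynomial_path_derivative]) (use that in auto)
  have velB: "inner (velocity \<gamma> s) (dv (B j)) = (X - 1) * (\<Sum>k\<le>r. a k * c' k j * (real k * y s ^ (k - 1)))"
    if "s \<in> {0..1}" for s j
    unfolding vel[OF that] by (simp add: inner_sum_left pq' c'_def mult_ac sum_distrib_left)
  have y1: "y s \<ge> 1" if "s \<in> {0..1}" for s using that X by (simp add: y_def)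
  have ymono: "y s \<le> y s'" if "s \<le> s'" for s s' using that X by (simp add: y_def mult_right_mono)
  \<comment> \<open>The number of the last wall reached, with 0 inserted for the case that there is
    none. A wall counts from the moment it is met, in accordance with \<open>wall_point\<close>,
    where the larger class holds on the wall itself.\<close>
  define k where "k s = Max (insert 0 {j \<in> {1..r}. x j \<le> y s})" for s
  have kr: "k s \<le> r" for s unfolding k_def by (subst Max_le_iff) auto
  have kmono: "k s \<le> k s'" if "s \<le> s'" for s s'
    unfolding k_def by (rule Max_mono) (use ymono[OF that] in auto)
  have kup: "y s < x j" if "k s < j" "j \<le> r" for s j
  proof (rule ccontr)
    assume "\<not> y s < x j"
    then have "j \<in> insert 0 {j \<in> {1..r}. x j \<le> y s}" using that by auto
    then have "j \<le> k s" unfolding k_def by (intro Max_ge) auto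
    then show False using that by simp
  qed
  have kin: "x (k s) \<le> y s" if "0 < k s" for s
  proof -
    have "k s \<in> insert 0 {j \<in> {1..r}. x j \<le> y s}" unfolding k_def by (rule Max_in) auto
    then show ?thesis using that by auto
  qed
  have klow: "x j < x (k s)" if "0 < j" "j < k s" for s j
    by (rule strict_mono_onD[OF xmono]) (use that kr[of s] in auto)
  have gneg: "inner (\<gamma> s) (dv (B j)) < 0" if "s \<in> {0..1}" "k s < j" "j \<le> r" for s j
    unfolding \<gamma>B by (rule Fneg) (use that kup[of s j] y1[of s] in auto)
  have gpos: "inner (\<gamma> s) (dv (B j)) > 0" if "s \<in> {0..1}" "0 < j" "j < k s" for s j
    unfolding \<gamma>B by (rule Fpos) (use that klow[of j s] kin[of s] kr[of s] in auto)
  define wall where "wall s \<longleftrightarrow> 0 < k s \<and> x (k s) = y s" for s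
  have gk: "inner (\<gamma> s) (dv (B (k s))) > 0" if "s \<in> {0..1}" "\<not> wall s" "0 < k s" for s
    unfolding \<gamma>B by (rule Fpos) (use that kin[of s] kr[of s] in \<open>auto simp: wall_def\<close>)
  have gw: "inner (\<gamma> s) (dv (B (k s))) = 0" if "wall s" for s
    unfolding \<gamma>B using F0[of "k s"] that kr[of s] by (simp add: wall_def)
  have ch: "torsion_class_of Q I (\<gamma> s) = T (k s)" "N \<in> bq_mod_nonzero Q I \<Longrightarrow> \<gamma> s \<notin> stab N"
    "\<exists>C\<in>chambers Q I. \<gamma> s \<in> C"
    if s: "s \<in> {0..1}" "\<not> wall s" for s N
  proof -
    have p: "inner (\<gamma> s) (dv (B j)) > 0" if "0 < j" "j \<le> k s" for j
      using gpos[OF s(1), of j] gk[OF s] that by (cases "j = k s") auto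
    show "torsion_class_of Q I (\<gamma> s) = T (k s)" by (rule chamber_point(1)[OF kr p gneg[OF s(1)]])
    show "N \<in> bq_mod_nonzero Q I \<Longrightarrow> \<gamma> s \<notin> stab N" by (rule chamber_point(2)[OF kr p gneg[OF s(1)]])
    show "\<exists>C\<in>chambers Q I. \<gamma> s \<in> C" by (rule chamber_point_in_chamber[OF kr p gneg[OF s(1)]])
  qed
  have wl: "torsion_class_of Q I (\<gamma> s) = T (k s)"
    "N \<in> bq_mod_nonzero Q I \<Longrightarrow> \<gamma> s \<in> stab N \<Longrightarrow> \<exists>m\<ge>1. dv N = real m *\<^sub>R dv (B (k s))"
    "\<gamma> s \<in> stab (B (k s))" "is_wall Q I (B (k s))" "inner (velocity \<gamma> s) (dv (B (k s))) > 0"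
    if s: "s \<in> {0..1}" "wall s" for s N
  proof -
    obtain i where i: "k s = Suc i" using s(2) by (cases "k s") (auto simp: wall_def)
    have ir: "i < r" using kr[of s] i by simp
    have p: "inner (\<gamma> s) (dv (B j)) > 0" if "0 < j" "j \<le> i" for j using gpos[OF s(1), of j] that i by simp
    have z: "inner (\<gamma> s) (dv (B (Suc i))) = 0" using gw[OF s(2)] i by simp
    have n: "inner (\<gamma> s) (dv (B j)) < 0" if "Suc i < j" "j \<le> r" for j using gneg[OF s(1), of j] that i by simp
    note w = wall_point[OF ir p z n]
    show "torsion_class_of Q I (\<gamma> s) = T (k s)" "\<gamma> s \<in> stab (B (k s))" using w(1,3) i by simp_all
    show "N \<in> bq_mod_nonzero Q I \<Longrightarrow> \<gamma> s \<in> stab N \<Longrightarrow> \<exists>m\<ge>1. dv N = real m *\<^sub>R dv (B (k s))"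
      unfolding i by (rule w(2))
    have kj: "k s \<in> {1..r}" using kr[of s] i by simp
    \<comment> \<open>\<open>X\<close> could equal 1 only for \<open>r = 0\<close>, when the path is
      constant; here a root lies strictly between 1 and \<open>X\<close>, so the rescaling factor
      \<open>X - 1\<close> is positive.\<close>
    have "X > 1" using xX[OF kj] by simp
    then show v: "inner (velocity \<gamma> s) (dv (B (k s))) > 0"
      using velB[OF s(1), of "k s"] F'[OF kj] s(2) by (simp add: wall_def)
    \<comment> \<open>The velocity has a nonzero product with this vector, which therefore spans a
      line and has a genuine hyperplane as orthogonal complement.\<close>
    then have nz: "dv (B (Suc i)) \<noteq> 0" using i by auto
    show "is_wall Q I (B (k s))" unfolding i by (rule brick_wall[OF ir p z n nz])
  qed
  have tors: "torsion_class_of Q I (\<gamma> s) = T (k s)" if "s \<in> {0..1}" for s using ch(1) wl(1) that by blast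
  have stab_wall: "wall s" if "s \<in> {0..1}" "N \<in> bq_mod_nonzero Q I" "\<gamma> s \<in> stab N" for s N
    using ch(2) that by blast
  have green: "inner (velocity \<gamma> s) (dv N) > 0"
    if s: "s \<in> {0..1}" and N: "N \<in> bq_mod_nonzero Q I" "\<gamma> s \<in> stab N" for s N
  proof -
    have w: "wall s" by (rule stab_wall[OF s N])
    then obtain m where "m \<ge> 1" "dv N = real m *\<^sub>R dv (B (k s))" using wl(2)[OF s w N] by blast
    then show ?thesis using wl(5)[OF s w] by simp
  qed
  \<comment> \<open>The inverse of the rescaling \<open>y\<close>, applied to the roots; the
    denominator is nonzero whenever an index \<open>j\<close> in \<open>{1..r}\<close>
    exists.\<close>
  define t where "t j = (x j - 1) / (X - 1)" for j
  have t01: "t j \<in> {0..1}" "y (t j) = x j" if "j \<in> {1..r}" for j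
    using xX[OF that] by (auto simp: t_def y_def divide_le_eq_1)
  have kt: "k (t j) = j" if j: "j \<in> {1..r}" for j
  proof (rule antisym)
    show "j \<le> k (t j)"
    proof (rule ccontr)
      assume "\<not> j \<le> k (t j)"
      then have "k (t j) < j" "j \<le> r" using j by simp_all
      then have "y (t j) < x j" by (rule kup)
      then show False using t01(2)[OF j] by simp
    qed
    show "k (t j) \<le> j"
    proof (rule ccontr)
      assume "\<not> k (t j) \<le> j"
      then have "x j < x (k (t j))" using klow[of j "t j"] j by simp
      then show False using kin[of "t j"] t01(2)[OF j] \<open>\<not> k (t j) \<le> j\<close> by simp
    qed
  qed
  have wall_t: "wall s \<longleftrightarrow> s \<in> t ` {1..r}" if s: "s \<in> {0..1}" for s
  proof
    assume w: "wall s"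
    then have kj: "k s \<in> {1..r}" using kr[of s] by (simp add: wall_def)
    have "X > 1" using xX[OF kj] by simp
    then have "t (k s) = s" using w by (simp add: wall_def t_def y_def)
    then show "s \<in> t ` {1..r}" using kj by (metis imageI)
  next
    assume "s \<in> t ` {1..r}"
    then obtain j where j: "j \<in> {1..r}" "s = t j" by blast
    then show "wall s" using kt[OF j(1)] t01(2)[OF j(1)] by (simp add: wall_def)
  qed
  have tmono: "strict_mono_on {1..r} t"
  proof (rule strict_mono_onI)
    fix i j assume ij: "i \<in> {1..r}" "j \<in> {1..r}" "i < j"
    have "X > 1" using xX[OF ij(1)] by simp
    moreover have "x i < x j" by (rule strict_mono_onD[OF xmono ij])
    ultimately show "t i < t j" by (simp add: t_def divide_strict_right_mono)
  qed
  have t_in: "t j \<in> {0..1}" if "j \<in> {1..r}" for j by (rule t01(1)[OF that])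
  have set1: "{s \<in> {0..1}. \<exists>N \<in> bq_mod_nonzero Q I. \<gamma> s \<in> stab N} = t ` {1..r}"
  proof (intro equalityI subsetI)
    fix s assume "s \<in> {s \<in> {0..1}. \<exists>N \<in> bq_mod_nonzero Q I. \<gamma> s \<in> stab N}"
    then show "s \<in> t ` {1..r}" using stab_wall wall_t by blast
  next
    fix s assume s: "s \<in> t ` {1..r}"
    then have s01: "s \<in> {0..1}" using t_in by blast
    then have w: "wall s" using wall_t s by blast
    show "s \<in> {s \<in> {0..1}. \<exists>N \<in> bq_mod_nonzero Q I. \<gamma> s \<in> stab N}"
      using wl(3,4)[OF s01 w] s01 unfolding is_wall_def by blast
  qed
  have set2: "{s \<in> {0..1}. \<exists>N. is_wall Q I N \<and> \<gamma> s \<in> stab N} = t ` {1..r}"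
  proof (intro equalityI subsetI)
    fix s assume "s \<in> {s \<in> {0..1}. \<exists>N. is_wall Q I N \<and> \<gamma> s \<in> stab N}"
    then show "s \<in> t ` {1..r}" using stab_wall wall_t unfolding is_wall_def by blast
  next
    fix s assume s: "s \<in> t ` {1..r}"
    then have s01: "s \<in> {0..1}" using t_in by blast
    then have w: "wall s" using wall_t s by blast
    show "s \<in> {s \<in> {0..1}. \<exists>N. is_wall Q I N \<and> \<gamma> s \<in> stab N}"
      using wl(3,4)[OF s01 w] s01 by blast
  qed
  have ends: "\<not> wall 0" "\<not> wall 1"
  proof -
    show "\<not> wall 0" using xX[of "k 0"] kr[of 0] by (auto simp: wall_def y_def)
    show "\<not> wall 1" using xX[of "k 1"] kr[of 1] by (auto simp: wall_def y_def)
  qed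
  have "D_generic Q I \<gamma>" unfolding D_generic_def
  proof (intro conjI ballI allI impI)
    show "smooth_path \<gamma>" by (rule smooth)
    fix s :: real
    { assume "s \<in> {0, 1}"
      then have s: "s \<in> {0..1}" "\<not> wall s" using ends by auto
      show "\<gamma> s \<notin> stab N" if "N \<in> bq_mod_nonzero Q I" for N by (rule ch(2)[OF s that])
      show "\<exists>C\<in>chambers Q I. \<gamma> s \<in> C" by (rule ch(3)[OF s]) }
    assume s: "s \<in> {0..1}"
    show "\<exists>c. dv N = c *\<^sub>R dv N'" if N: "is_wall Q I N \<and> is_wall Q I N' \<and> \<gamma> s \<in> stab N \<inter> stab N'" for N N'
    proof -
      have nz: "N \<in> bq_mod_nonzero Q I" "N' \<in> bq_mod_nonzero Q I" and st: "\<gamma> s \<in> stab N" "\<gamma> s \<in> stab N'"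
        using N by (auto simp: is_wall_def)
      have w: "wall s" by (rule stab_wall[OF s nz(1) st(1)])
      obtain m where m: "dv N = real m *\<^sub>R dv (B (k s))" using wl(2)[OF s w nz(1) st(1)] by blast
      obtain m' where m': "m' \<ge> 1" "dv N' = real m' *\<^sub>R dv (B (k s))" using wl(2)[OF s w nz(2) st(2)] by blast
      show ?thesis by (rule exI[of _ "real m / real m'"]) (use m m' in simp)
    qed
    show "inner (velocity \<gamma> s) (dv N) \<noteq> 0" if "N \<in> bq_mod_nonzero Q I" "\<gamma> s \<in> stab N" for N
      using green[OF s that] by simp
  qed
  moreover have "\<forall>s\<in>{0..1}. green_at Q I \<gamma> s" unfolding green_at_def using green by blast
  moreover have "\<forall>s\<in>{0..1}. \<exists>k\<le>r. torsion_class_of Q I (\<gamma> s) = T k" using tors kr by blast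
  moreover have "\<forall>s\<in>{0..1}. \<forall>s'\<in>{0..1}. s < s' \<longrightarrow> torsion_class_of Q I (\<gamma> s) \<subseteq> torsion_class_of Q I (\<gamma> s')"
    \<comment> \<open>The class at \<open>s\<close> is \<open>T (k s)\<close> on walls and off them,
      so its growth is just monotonicity of \<open>k\<close> and of the chain.\<close>
    using tors G.chain_mono[OF c kmono kr] by simp
  ultimately show ?thesis using set1 set2 tmono by blast
qed

end

end

theorem theorem1p3:
  fixes Q :: "('v::finite, 'a) pre_digraph"
    and I :: "(('v, 'a) qpath \<Rightarrow> 'k::field) set"
    and T :: "nat \<Rightarrow> ('v, 'a, 'k) bq_module set"
    and r :: nat
  assumes "bound_quiver Q I"
    and "maximal_green_sequence (bq_algebra Q I) T r"
  shows "\<exists>\<gamma> :: real \<Rightarrow> real ^ 'v. D_generic Q I \<gamma> \<and>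
    (\<exists>t :: nat \<Rightarrow> real. strict_mono_on {1..r} t \<and>
      {s \<in> {0..1}. \<exists>N \<in> bq_mod_nonzero Q I. \<gamma> s \<in> stability_space Q I N} = t ` {1..r} \<and>
      {s \<in> {0..1}. \<exists>N. is_wall Q I N \<and> \<gamma> s \<in> stability_space Q I N} = t ` {1..r}) \<and>
    (\<forall>s \<in> {0..1}. green_at Q I \<gamma> s) \<and>
    (\<forall>s \<in> {0..1}. \<exists>k\<le>r. torsion_class_of Q I (\<gamma> s) = T k) \<and>
    (\<forall>s \<in> {0..1}. \<forall>s' \<in> {0..1}. s < s' \<longrightarrow>
      torsion_class_of Q I (\<gamma> s) \<subseteq> torsion_class_of Q I (\<gamma> s'))"
proof -
  interpret bound_quiver_algebra Q I by unfold_locales (rule assms(1))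
  have c: "G.max_chain T r" by (rule mgs_max_chain[OF assms(2)])
  obtain B \<theta> where B: "G.bricks T r B"
    and \<theta>: "\<And>k j. k \<le> r \<Longrightarrow> 0 < j \<Longrightarrow> j \<le> k \<Longrightarrow> inner (\<theta> k) (dv (B j)) > 0"
      "\<And>k j. k \<le> r \<Longrightarrow> k < j \<Longrightarrow> j \<le> r \<Longrightarrow> inner (\<theta> k) (dv (B j)) < 0"
    using G.ex_bricks_chambers[OF c] by metis
  show ?thesis by (rule ex_green_path[OF c B \<theta>])
qed

end
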